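(* Let $k$ be a field of characteristic zero, let $x,y,z$ be indeterminates over $k$, let $R^*=k[y,z]_{(y,z)}[[x]]$, and let $\alpha,\beta\in xk[[x]]$ be algebraically independent over $k(x)$. Set $f=(y-\alpha)^2$, $g=(z-\beta)^2$, and $A=k(x,y,z,f,g)\cap R^*$ (intersection taken inside the fraction field of $R^*$), and let $P=(f,g)A$. Let $B_r$ ($r\ge 1$) and $B=\bigcup_{r\ge1}B_r$ be the rings defined in the context. Then: (1) $A=B$ is a three-dimensional regular local domain that is a nested union of five-dimensional regular local domains. (2) $P$ is a height-two prime ideal of $A$. (3) If $A^*$ denotes the $(xA)$-adic completion of $A$, then $A^*=k[y,z]_{(y,z)}[[x]]$ and $PA^*$ is not integrally closed. (4) If $\widehat A$ denotes the completion of $A$ with respect to the powers of the maximal ideal of $A$, then $\widehat A=k[[x,y,z]]$ and $P\widehat A$ is not integrally closed.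
   Context: The ring $R^*=k[y,z]_{(y,z)}[[x]]$ is the $(xR)$-adic completion of $R=k[x,y,z]_{(x,y,z)}$. Definition of $B_r$ and $B$. Write $f=y^2+\sum_{j=1}^\infty b_jx^j$ and $g=z^2+\sum_{j=1}^\infty c_jx^j$ with $b_j\in k[y]$ and $c_j\in k[z]$. For each $r\ge1$ define the $r$-th endpieces in $R^*$ by $$f_r=\sum_{j=r}^\infty (b_jx^j)/x^r,\qquad g_r=\sum_{j=r}^\infty (c_jx^j)/x^r .$$ Let $B_r$ be the localization of $k[x,y,z,f_r,g_r]$ at the maximal ideal generated by $(x,y,z,f_r-b_r,g_r-c_r)$, and let $B=\bigcup_{r=1}^\infty B_r$ (a nested union inside the fraction field of $R^*$). An element $r$ of a commutative ring $R$ is integral over an ideal $I$ if there are $n\ge 1$ and $a_i\in I^i$ ($1\le i\le n$) with $r^n+\sum_{i=1}^n a_ir^{n-i}=0$; $I$ is integrally closed if it contains every element of $R$ integral over it. The equalities $A^*=k[y,z]_{(y,z)}[[x]]$ and $\widehat A=k[[x,y,z]]$ are the identifications induced by the inclusions $A\subseteq R^*\subseteq k[[x,y,z]]$. *)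

theory Defs
  imports "HOL-Algebra.Algebra" "HOL-Algebra.Algebraic_Closure_Type" "HOL-Library.Extended_Nat"
begin

section \<open>Commutative algebra\<close>

definition prime_chain :: "('a, 'b) ring_scheme \<Rightarrow> nat \<Rightarrow> (nat \<Rightarrow> 'a set) \<Rightarrow> bool" where
  "prime_chain R n p \<longleftrightarrow> (\<forall>i\<le>n. primeideal (p i) R) \<and> (\<forall>i<n. p i \<subset> p (Suc i))"

definition ideal_height :: "('a, 'b) ring_scheme \<Rightarrow> 'a set \<Rightarrow> enat" where
  "ideal_height R P = (SUP n \<in> {n. \<exists>p. prime_chain R n p \<and> p n = P}. enat n)"

definition krull_dim :: "('a, 'b) ring_scheme \<Rightarrow> enat" where
  "krull_dim R = (SUP n \<in> {n. \<exists>p. prime_chain R n p}. enat n)"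

definition local_ring :: "('a, 'b) ring_scheme \<Rightarrow> bool" where
  "local_ring R \<longleftrightarrow> cring R \<and> (\<exists>!M. maximalideal M R)"

definition max_ideal :: "('a, 'b) ring_scheme \<Rightarrow> 'a set" where
  "max_ideal R = (THE M. maximalideal M R)"

definition embedding_dim :: "('a, 'b) ring_scheme \<Rightarrow> nat" where
  "embedding_dim R =
     (LEAST n. \<exists>S. S \<subseteq> carrier R \<and> finite S \<and> card S = n \<and> max_ideal R = Idl\<^bsub>R\<^esub> S)"

definition regular_local_ring :: "('a, 'b) ring_scheme \<Rightarrow> bool" where
  "regular_local_ring R \<longleftrightarrow>
     noetherian_ring R \<and> local_ring R \<and> enat (embedding_dim R) = krull_dim R"

definition regular_local_domain :: "('a, 'b) ring_scheme \<Rightarrow> bool" where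
  "regular_local_domain R \<longleftrightarrow> domain R \<and> regular_local_ring R"

definition ideal_power :: "('a, 'b) ring_scheme \<Rightarrow> 'a set \<Rightarrow> nat \<Rightarrow> 'a set" where
  "ideal_power R I n = I [^]\<^bsub>ideals_set R\<^esub> n"

definition integral_over_ideal :: "('a, 'b) ring_scheme \<Rightarrow> 'a set \<Rightarrow> 'a \<Rightarrow> bool" where
  "integral_over_ideal R I r \<longleftrightarrow>
     (\<exists>n::nat. \<exists>a :: nat \<Rightarrow> 'a. 1 \<le> n \<and> (\<forall>i\<in>{1..n}. a i \<in> ideal_power R I i) \<and>
        r [^]\<^bsub>R\<^esub> n \<oplus>\<^bsub>R\<^esub> (\<Oplus>\<^bsub>R\<^esub> i\<in>{1..n}. a i \<otimes>\<^bsub>R\<^esub> r [^]\<^bsub>R\<^esub> (n - i)) = \<zero>\<^bsub>R\<^esub>)"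

definition integrally_closed_ideal :: "('a, 'b) ring_scheme \<Rightarrow> 'a set \<Rightarrow> bool" where
  "integrally_closed_ideal R I \<longleftrightarrow> (\<forall>r\<in>carrier R. integral_over_ideal R I r \<longrightarrow> r \<in> I)"

text \<open>The inverse limit of the rings \<open>R / I\<^sup>n\<close>. Elements are sequences of cosets; a coset of
  \<open>I\<^sup>n\<^sup>+\<^sup>1\<close> is mapped to a given coset of \<open>I\<^sup>n\<close> under \<open>R / I\<^sup>n\<^sup>+\<^sup>1 \<rightarrow> R / I\<^sup>n\<close> exactly if it is
  contained in it.\<close>

definition adic_completion :: "('a, 'b) ring_scheme \<Rightarrow> 'a set \<Rightarrow> (nat \<Rightarrow> 'a set) ring" where
  "adic_completion R I =
     \<lparr>carrier = {s. (\<forall>n. s n \<in> carrier (R Quot ideal_power R I n)) \<and> (\<forall>n. s (Suc n) \<subseteq> s n)},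
      monoid.mult = (\<lambda>s t n. s n \<otimes>\<^bsub>R Quot ideal_power R I n\<^esub> t n),
      one = (\<lambda>n. \<one>\<^bsub>R Quot ideal_power R I n\<^esub>),
      ring.zero = (\<lambda>n. \<zero>\<^bsub>R Quot ideal_power R I n\<^esub>),
      add = (\<lambda>s t n. s n \<oplus>\<^bsub>R Quot ideal_power R I n\<^esub> t n)\<rparr>"

definition completion_map :: "('a, 'b) ring_scheme \<Rightarrow> 'a set \<Rightarrow> 'a \<Rightarrow> nat \<Rightarrow> 'a set" where
  "completion_map R I a = (\<lambda>n. ideal_power R I n +>\<^bsub>R\<^esub> a)"

text \<open>The completion of \<open>R\<close> is identified with the overring \<open>T\<close> through the inclusion of \<open>R\<close>
  in \<open>T\<close>. An isomorphism over \<open>R\<close> carries \<open>I\<^sup>n\<close> times the completion to \<open>I\<^sup>n T\<close>, so if \<open>I\<close> is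
  finitely generated and \<open>T\<close> is separated in the \<open>I\<close>-adic topology, there is at most one.\<close>

definition completion_is ::
    "('a, 'b) ring_scheme \<Rightarrow> 'a set \<Rightarrow> ('a, 'c) ring_scheme \<Rightarrow> bool" where
  "completion_is R I T \<longleftrightarrow> carrier R \<subseteq> carrier T \<and>
     (\<exists>h \<in> ring_iso (adic_completion R I) T. \<forall>a\<in>carrier R. h (completion_map R I a) = a)"

definition extension_to_completion ::
    "('a, 'b) ring_scheme \<Rightarrow> 'a set \<Rightarrow> 'a set \<Rightarrow> (nat \<Rightarrow> 'a set) set" where
  "extension_to_completion R I P = Idl\<^bsub>adic_completion R I\<^esub> (completion_map R I ` P)"


section \<open>Subrings of the fraction field of \<open>k[[x,y,z]]\<close>\<close>

text \<open>The ring \<open>k[[x,y,z]]\<close> is represented as \<open>k[[z]][[y]][[x]]\<close>, the outermost variable being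
  \<open>x\<close>. All rings in the statement are subsets of its fraction field, which contains
  the fraction field of \<open>R\<^sup>*\<close>.\<close>

type_synonym 'k pser = "'k fps fps fps"
type_synonym 'k pfrac = "'k fps fps fps fract"

definition subring_on :: "'a::field set \<Rightarrow> 'a ring" where
  "subring_on S = ring_of_type_algebra\<lparr>carrier := S\<rparr>"

definition ring_adjoin :: "'a::field set \<Rightarrow> 'a set" where
  "ring_adjoin H = generate_ring ring_of_type_algebra H"

definition field_adjoin :: "'a::field set \<Rightarrow> 'a set" where
  "field_adjoin H = generate_field ring_of_type_algebra H"

definition localize_at :: "'a::field set \<Rightarrow> 'a set \<Rightarrow> 'a set" where
  "localize_at D M = {a / b | a b. a \<in> D \<and> b \<in> D - M}"

definition alg_independent_pair :: "'a::field set \<Rightarrow> 'a \<Rightarrow> 'a \<Rightarrow> bool" where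
  "alg_independent_pair F a b \<longleftrightarrow>
     (\<forall>p :: 'a poly poly. (\<forall>i j. Polynomial.coeff (Polynomial.coeff p i) j \<in> F) \<longrightarrow>
        poly (poly p [:b:]) a = 0 \<longrightarrow> p = 0)"

definition emb :: "'k::field pser \<Rightarrow> 'k pfrac" where
  "emb F = Fraction_Field.Fract F 1"

definition scalars :: "'k::field pfrac set" where
  "scalars = range (\<lambda>c. emb (fps_const (fps_const (fps_const c))))"

definition Xs :: "'k::field pser" where "Xs = fps_X"
definition Ys :: "'k::field pser" where "Ys = fps_const fps_X"
definition Zs :: "'k::field pser" where "Zs = fps_const (fps_const fps_X)"

text \<open>The inclusion of \<open>k[[x]]\<close> in \<open>k[[x,y,z]]\<close>.\<close>

definition in_x :: "'k::field fps \<Rightarrow> 'k pser" where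
  "in_x \<alpha> = Abs_fps (\<lambda>n. fps_const (fps_const (fps_nth \<alpha> n)))"

definition kyz_loc :: "'k::field pfrac set" where
  "kyz_loc =
     (let D = ring_adjoin (scalars \<union> {emb Ys, emb Zs})
      in localize_at D (Idl\<^bsub>subring_on D\<^esub> {emb Ys, emb Zs}))"

definition Rstar :: "'k::field pfrac set" where
  "Rstar = {emb F | F. \<forall>n. emb (fps_const (fps_nth F n)) \<in> kyz_loc}"

definition kxyz_series :: "'k::field pfrac set" where
  "kxyz_series = range emb"

definition f_elt :: "'k::field fps \<Rightarrow> 'k pser" where
  "f_elt \<alpha> = (Ys - in_x \<alpha>)\<^sup>2"

definition g_elt :: "'k::field fps \<Rightarrow> 'k pser" where
  "g_elt \<beta> = (Zs - in_x \<beta>)\<^sup>2"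

definition A_ring :: "'k::field fps \<Rightarrow> 'k fps \<Rightarrow> 'k pfrac set" where
  "A_ring \<alpha> \<beta> =
     field_adjoin (scalars \<union> {emb Xs, emb Ys, emb Zs, emb (f_elt \<alpha>), emb (g_elt \<beta>)}) \<inter> Rstar"

definition P_ideal :: "'k::field fps \<Rightarrow> 'k fps \<Rightarrow> 'k pfrac set" where
  "P_ideal \<alpha> \<beta> = Idl\<^bsub>subring_on (A_ring \<alpha> \<beta>)\<^esub> {emb (f_elt \<alpha>), emb (g_elt \<beta>)}"

text \<open>For \<open>F = \<Sum>\<^sub>j b\<^sub>j x\<^sup>j\<close>, the series \<open>fps_shift r F\<close> is the endpiece
  \<open>\<Sum>\<^sub>j\<^sub>\<ge>\<^sub>r b\<^sub>j x\<^sup>j / x\<^sup>r\<close>, and \<open>b\<^sub>r = fps_nth F r\<close>.\<close>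

definition B_piece :: "'k::field fps \<Rightarrow> 'k fps \<Rightarrow> nat \<Rightarrow> 'k pfrac set" where
  "B_piece \<alpha> \<beta> r =
     (let fr = emb (fps_shift r (f_elt \<alpha>)); gr = emb (fps_shift r (g_elt \<beta>));
          br = emb (fps_const (fps_nth (f_elt \<alpha>) r)); cr = emb (fps_const (fps_nth (g_elt \<beta>) r));
          D = ring_adjoin (scalars \<union> {emb Xs, emb Ys, emb Zs, fr, gr})
      in localize_at D (Idl\<^bsub>subring_on D\<^esub> {emb Xs, emb Ys, emb Zs, fr - br, gr - cr}))"

definition B_ring :: "'k::field fps \<Rightarrow> 'k fps \<Rightarrow> 'k pfrac set" where
  "B_ring \<alpha> \<beta> = (\<Union>r\<in>{1..}. B_piece \<alpha> \<beta> r)"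

end

theory Submission
  imports Defs
begin

text \<open>Put \<open>s = y - \<alpha>\<close> and \<open>t = z - \<beta>\<close>, so that \<open>f = s\<^sup>2\<close> and \<open>g = t\<^sup>2\<close>. Then \<open>(st)\<^sup>2 = fg\<close>, which
  makes \<open>st\<close> integral over \<open>(f, g)\<close> in every ring that contains \<open>\<alpha>\<close> and \<open>\<beta>\<close>, in particular in
  \<open>R\<^sup>*\<close> and in \<open>k[[x,y,z]]\<close>. But \<open>st\<close> is not in \<open>(f, g)\<close> even there: modulo \<open>x\<close> the elements \<open>s\<close>
  and \<open>t\<close> become \<open>y\<close> and \<open>z\<close>, and \<open>yz\<close> is not in \<open>(y\<^sup>2, z\<^sup>2)\<close> (\<open>st_notin\<close>). So neither extension
  of \<open>P\<close> is integrally closed (\<open>extension_not_integrally_closed\<close>) once the two completions of \<open>A\<close>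
  are known. What remains is to understand \<open>A\<close> itself.

  The rings are studied inside \<open>k[[x,y,z]]\<close>. Let \<open>D r\<close> be \<open>k[x,y,z,f_r,g_r]\<close>, let \<open>loc0 (D r)\<close> be
  its localization \<open>B_r\<close>, and let \<open>B\<close> be the union of these. From \<open>f_r = b_r + x f_(r+1)\<close> it
  follows that \<open>xB\<close> consists of all elements of \<open>B\<close> that \<open>x\<close> divides in \<open>k[[x,y,z]]\<close> (\<open>D_div\<close>,
  \<open>B_div\<close>), and every truncation of an element of \<open>R\<^sup>*\<close> lies in \<open>B\<close>. Hence \<open>B\<close> and \<open>R\<^sup>*\<close> agree
  modulo each power of \<open>x\<close>, and an element of order \<open>n + 1\<close> of \<open>B\<close> is a combination of \<open>x, y, z\<close>
  with coefficients of order \<open>n\<close> in \<open>B\<close> (\<open>B_split\<close>). This determines the maximal ideal of \<open>B\<close> and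
  its powers, and with them both completions (\<open>completion_setup\<close>, \<open>completion_is_T\<close>).

  The main difficulty is that \<open>B\<close> is Noetherian and equal to \<open>A\<close>. Both follow from
  \<open>relation_in_B\<close>: a relation \<open>\<Sum> a_i h_i = 0\<close> with \<open>h_i\<close> in \<open>B\<close> and \<open>a_i\<close> in \<open>R\<^sup>*\<close> agrees, modulo
  any given power of \<open>x\<close>, with a relation whose coefficients are in \<open>B\<close>. This takes the place of
  the flatness of \<open>R\<^sup>*\<close> over \<open>B\<close>, and it rests on the algebraic independence of \<open>\<alpha>\<close> and \<open>\<beta>\<close>. The
  ring \<open>W = V[y,z]\<close> with \<open>V = k(x,\<alpha>,\<beta>) \<inter> k[[x]]\<close> is Noetherian, because \<open>V\<close> is a discrete
  valuation ring, and over \<open>W\<close> a truncated relation can be corrected (\<open>relation_in_W\<close>). The ring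
  \<open>k[x,y,z,\<alpha>,\<beta>]\<close> is free over \<open>D 0 = k[x,y,z,f,g]\<close> with basis \<open>1, s, t, st\<close> (\<open>D0_independent\<close>,
  \<open>polyYZ_N_E\<close>); so a relation over \<open>W\<close> between elements of \<open>D 0\<close> splits, after clearing
  denominators, into four relations over \<open>D 0\<close>, which are recombined with \<open>s\<close> and \<open>t\<close> replaced by
  polynomials close to them (\<open>relation_in_D0\<close>). The Noetherian property is obtained from this by
  lifting generators of ideals from \<open>B/xB\<close> and \<open>B[1/x]\<close> (\<open>completion_criterion\<close>), and \<open>A = B\<close> by
  applying it to the relation \<open>1 \<cdot> p - F \<cdot> q = 0\<close> for a fraction \<open>F = p/q\<close> in \<open>R\<^sup>*\<close> (\<open>B_eq_A\<close>).

  The ideal \<open>(f, g)B\<close> is the kernel of the substitution \<open>y \<mapsto> \<alpha>\<close>, \<open>z \<mapsto> \<beta>\<close> (\<open>fg_kernel\<close>): modulo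
  \<open>(f, g)\<close> every element of \<open>D 0\<close> is a polynomial in \<open>x, y, z\<close>, on which the substitution is
  injective, again by algebraic independence, and powers of \<open>x\<close> can be cancelled modulo \<open>(f, g)\<close>
  because \<open>f\<close> and \<open>g\<close> reduce modulo \<open>x\<close> to the regular sequence \<open>y\<^sup>2, z\<^sup>2\<close> (\<open>fg_saturated\<close>). So
  \<open>P\<close> is prime, and the kernel of \<open>y \<mapsto> \<alpha>\<close> alone is a prime strictly between \<open>0\<close> and \<open>P\<close>.

  The dimensions come from Krull's height theorem (\<open>height_theorem\<close>), which bounds lengths of
  chains by numbers of generators, and from explicit chains of the same length: three for \<open>B\<close>
  (\<open>B_chain\<close>), five for each \<open>B_r\<close> (\<open>D_chain\<close>), two below \<open>P\<close> (\<open>P_chain\<close>). Equality of both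
  numbers also gives regularity (\<open>regular_local_by_chain\<close>).\<close>

section \<open>Subrings and ideals\<close>

text \<open>Rings are subsets of an ambient commutative ring, so that subrings, unions of rings, ideals
  and their extensions are all compared by inclusion.\<close>

definition is_subring :: "'a::comm_ring_1 set \<Rightarrow> bool" where
  "is_subring S \<longleftrightarrow> 1 \<in> S \<and> (\<forall>a\<in>S. \<forall>b\<in>S. a - b \<in> S \<and> a * b \<in> S)"

definition ideal_in :: "'a::comm_ring_1 set \<Rightarrow> 'a set \<Rightarrow> bool" where
  "ideal_in S I \<longleftrightarrow> I \<subseteq> S \<and> 0 \<in> I \<and> (\<forall>a\<in>I. \<forall>b\<in>I. a + b \<in> I) \<and> (\<forall>r\<in>S. \<forall>a\<in>I. r * a \<in> I)"

definition prime_in :: "'a::comm_ring_1 set \<Rightarrow> 'a set \<Rightarrow> bool" where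
  "prime_in S P \<longleftrightarrow> ideal_in S P \<and> 1 \<notin> P \<and> (\<forall>a\<in>S. \<forall>b\<in>S. a * b \<in> P \<longrightarrow> a \<in> P \<or> b \<in> P)"

text \<open>The \<open>S\<close>-span of \<open>G\<close>, built by adding one multiple of a generator at a time, so that its
  properties are proved by induction instead of by handling families of coefficients.\<close>

inductive_set genid :: "'a::comm_ring_1 set \<Rightarrow> 'a set \<Rightarrow> 'a set" for S G where
  genid_0: "0 \<in> genid S G"
| genid_step: "a \<in> genid S G \<Longrightarrow> r \<in> S \<Longrightarrow> g \<in> G \<Longrightarrow> a + r * g \<in> genid S G"

definition noeth :: "'a::comm_ring_1 set \<Rightarrow> bool" where
  "noeth S \<longleftrightarrow> (\<forall>I. ideal_in S I \<longrightarrow> (\<exists>G. finite G \<and> G \<subseteq> I \<and> I \<subseteq> genid S G))"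

lemma is_subringI:
  assumes "1 \<in> S" "\<And>a b. a \<in> S \<Longrightarrow> b \<in> S \<Longrightarrow> a + b \<in> S" "\<And>a. a \<in> S \<Longrightarrow> - a \<in> S"
    "\<And>a b. a \<in> S \<Longrightarrow> b \<in> S \<Longrightarrow> a * b \<in> S"
  shows "is_subring S"
  unfolding is_subring_def using assms by (metis diff_conv_add_uminus)

context
  fixes S :: "'a::comm_ring_1 set"
  assumes S: "is_subring S"
begin

lemma subring_one [simp, intro]: "1 \<in> S"
  using S by (simp add: is_subring_def)

lemma subring_diff [simp, intro]: "a \<in> S \<Longrightarrow> b \<in> S \<Longrightarrow> a - b \<in> S"
  using S by (simp add: is_subring_def)

lemma subring_mult [simp, intro]: "a \<in> S \<Longrightarrow> b \<in> S \<Longrightarrow> a * b \<in> S"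
  using S by (simp add: is_subring_def)

lemma subring_zero [simp, intro]: "0 \<in> S"
  using subring_diff[of 1 1] by simp

lemma subring_minus [simp, intro]: "a \<in> S \<Longrightarrow> - a \<in> S"
  using subring_diff[of 0 a] by simp

lemma subring_add [simp, intro]: "a \<in> S \<Longrightarrow> b \<in> S \<Longrightarrow> a + b \<in> S"
  using subring_diff[of a "- b"] by simp

lemma subring_power [simp, intro]: "a \<in> S \<Longrightarrow> a ^ n \<in> S"
  by (induction n) auto

lemma subring_sum [intro]: "(\<And>i. i \<in> K \<Longrightarrow> f i \<in> S) \<Longrightarrow> sum f K \<in> S"
  by (induction K rule: infinite_finite_induct) auto

lemma subring_prod [intro]: "(\<And>i. i \<in> K \<Longrightarrow> f i \<in> S) \<Longrightarrow> prod f K \<in> S"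
  by (induction K rule: infinite_finite_induct) auto

end

context
  fixes S I :: "'a::comm_ring_1 set"
  assumes I: "ideal_in S I"
begin

lemma ideal_in_subset: "I \<subseteq> S"
  using I by (simp add: ideal_in_def)

lemma ideal_in_carrier: "a \<in> I \<Longrightarrow> a \<in> S"
  using I by (auto simp: ideal_in_def)

lemma ideal_in_zero: "0 \<in> I"
  using I by (simp add: ideal_in_def)

lemma ideal_in_add: "a \<in> I \<Longrightarrow> b \<in> I \<Longrightarrow> a + b \<in> I"
  using I by (simp add: ideal_in_def)

lemma ideal_in_lmult: "r \<in> S \<Longrightarrow> a \<in> I \<Longrightarrow> r * a \<in> I"
  using I by (simp add: ideal_in_def)

lemma ideal_in_rmult: "r \<in> S \<Longrightarrow> a \<in> I \<Longrightarrow> a * r \<in> I"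
  using ideal_in_lmult[of r a] by (simp add: mult.commute)

lemma ideal_in_minus: "is_subring S \<Longrightarrow> a \<in> I \<Longrightarrow> - a \<in> I"
  using ideal_in_lmult[of "- 1" a] by simp

lemma ideal_in_diff: "is_subring S \<Longrightarrow> a \<in> I \<Longrightarrow> b \<in> I \<Longrightarrow> a - b \<in> I"
  using ideal_in_add[of a "- b"] ideal_in_minus[of b] by simp

lemma ideal_in_sum: "(\<And>i. i \<in> K \<Longrightarrow> f i \<in> I) \<Longrightarrow> sum f K \<in> I"
  by (induction K rule: infinite_finite_induct) (auto intro: ideal_in_add ideal_in_zero)

end

lemma prime_in_ideal: "prime_in S P \<Longrightarrow> ideal_in S P"
  by (simp add: prime_in_def)

lemma prime_in_mult: "prime_in S P \<Longrightarrow> a \<in> S \<Longrightarrow> b \<in> S \<Longrightarrow> a * b \<in> P \<Longrightarrow> a \<in> P \<or> b \<in> P"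
  by (simp add: prime_in_def)

lemma prime_in_power:
  assumes "is_subring S" "prime_in S P" "a \<in> S" "a ^ n \<in> P" shows "a \<in> P"
  using assms(4)
proof (induction n)
  case 0 then show ?case using assms by (simp add: prime_in_def)
next
  case (Suc n) then show ?case using assms prime_in_mult[of S P a "a ^ n"] by auto
qed

lemma genid_ideal:
  assumes S: "is_subring S" and G: "G \<subseteq> S"
  shows "ideal_in S (genid S G)"
proof -
  have "a \<in> S" if "a \<in> genid S G" for a
    using that by induction (use S G in auto)
  moreover have "b + a \<in> genid S G" if "a \<in> genid S G" "b \<in> genid S G" for a b
    using that by induction (auto simp: add.assoc[symmetric] intro: genid.intros)
  moreover have "r * a \<in> genid S G" if "a \<in> genid S G" "r \<in> S" for a r
    using that by induction
      (use S in \<open>auto simp: distrib_left mult.assoc[symmetric] intro!: genid.intros\<close>)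
  ultimately show ?thesis
    unfolding ideal_in_def by (auto intro: genid.intros)
qed

lemma genid_incl: "is_subring S \<Longrightarrow> g \<in> G \<Longrightarrow> g \<in> genid S G"
  using genid_step[OF genid_0, of 1 S g G] by auto

lemma genid_least:
  assumes "ideal_in S I" "G \<subseteq> I" shows "genid S G \<subseteq> I"
proof
  fix a assume "a \<in> genid S G" then show "a \<in> I"
    by induction (use assms in \<open>auto intro: ideal_in_add ideal_in_zero ideal_in_lmult\<close>)
qed

lemma genid_mono: "S \<subseteq> S' \<Longrightarrow> G \<subseteq> H \<Longrightarrow> genid S G \<subseteq> genid S' H"
proof
  fix a assume "a \<in> genid S G" "S \<subseteq> S'" "G \<subseteq> H" then show "a \<in> genid S' H"
    by induction (auto intro: genid.intros)
qed

text \<open>The coefficients are indexed by \<open>K\<close> rather than by the generators, because the relations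
  considered later are families in which a generator may occur more than once.\<close>

lemma genid_imageD:
  assumes S: "is_subring S" and "finite K" and "b \<in> genid S (h ` K)"
  shows "\<exists>c. (\<forall>k. c k \<in> S) \<and> b = (\<Sum>k\<in>K. c k * h k)"
  using assms(3)
proof induction
  case genid_0
  then show ?case using S by (intro exI[of _ "\<lambda>_. 0"]) auto
next
  case (genid_step a r g)
  then obtain c k where c: "\<forall>k. c k \<in> S" "a = (\<Sum>k\<in>K. c k * h k)" "k \<in> K" "g = h k" by blast
  have "(\<Sum>j\<in>K. (c(k := c k + r)) j * h j) = (\<Sum>j\<in>K. c j * h j + (if j = k then r * h k else 0))"
    by (intro sum.cong) (auto simp: algebra_simps)
  also have "\<dots> = a + r * g"
    using c assms(2) by (simp add: sum.distrib)
  finally show ?case using c S genid_step by (intro exI[of _ "c(k := c k + r)"]) auto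
qed

lemma genidD:
  assumes "is_subring S" and "finite G" and "b \<in> genid S G"
  shows "\<exists>c. (\<forall>k. c k \<in> S) \<and> b = (\<Sum>g\<in>G. c g * g)"
  using genid_imageD[of S G b "\<lambda>x. x"] assms by auto

lemma genid_sumI:
  assumes S: "is_subring S" and "G \<subseteq> S" and "\<And>k. k \<in> K \<Longrightarrow> c k \<in> S" "\<And>k. k \<in> K \<Longrightarrow> h k \<in> G"
  shows "(\<Sum>k\<in>K. c k * h k) \<in> genid S G"
  using genid_ideal[OF S assms(2)] assms(3,4) genid_incl[OF S]
  by (intro ideal_in_sum[of S]) (auto intro: ideal_in_lmult[of S])

lemma noethE:
  assumes "noeth S" and "ideal_in S I"
  obtains G where "finite G" "G \<subseteq> I" "I \<subseteq> genid S G"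
  using assms unfolding noeth_def by meson

text \<open>Otherwise one can pass to a strictly larger member of \<open>F\<close> forever; the union of such a chain
  is finitely generated and therefore equal to one of its terms.\<close>

lemma noeth_maximal:
  assumes "noeth S" and "F \<noteq> {}" and F: "\<And>I. I \<in> F \<Longrightarrow> ideal_in S I"
  shows "\<exists>M\<in>F. \<forall>I\<in>F. M \<subseteq> I \<longrightarrow> I = M"
proof (rule ccontr)
  assume "\<not> ?thesis"
  then obtain f where f: "\<And>M. M \<in> F \<Longrightarrow> f M \<in> F \<and> M \<subset> f M" by (metis psubsetI)
  obtain M0 where M0: "M0 \<in> F" using assms by blast
  define I where "I = (\<lambda>n. (f ^^ n) M0)"
  have IF: "I n \<in> F" for n by (induction n) (use M0 f in \<open>auto simp: I_def\<close>)
  have Is: "I n \<subset> I (Suc n)" for n using f[OF IF[of n]] by (simp add: I_def)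
  have mono: "I m \<subseteq> I n" if "m \<le> n" for m n
    using that Is by (induction rule: dec_induct) auto
  have id: "ideal_in S (\<Union>n. I n)"
    unfolding ideal_in_def
  proof (intro conjI ballI)
    show "(\<Union>n. I n) \<subseteq> S" using F[OF IF] by (auto dest: ideal_in_subset)
    show "0 \<in> (\<Union>n. I n)" using ideal_in_zero[OF F[OF IF]] by blast
    show "r * a \<in> (\<Union>n. I n)" if "r \<in> S" "a \<in> (\<Union>n. I n)" for r a
      using ideal_in_lmult[OF F[OF IF]] that by blast
    show "a + b \<in> (\<Union>n. I n)" if ab: "a \<in> (\<Union>n. I n)" "b \<in> (\<Union>n. I n)" for a b
    proof -
      obtain m n where "a \<in> I m" "b \<in> I n" using ab by auto
      then have "a \<in> I (max m n)" "b \<in> I (max m n)"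
        using mono[of m "max m n"] mono[of n "max m n"] by auto
      then show ?thesis using ideal_in_add[OF F[OF IF]] by blast
    qed
  qed
  obtain G where G: "finite G" "G \<subseteq> (\<Union>n. I n)" "(\<Union>n. I n) \<subseteq> genid S G"
    by (rule noethE[OF \<open>noeth S\<close> id])
  have "\<exists>n. G \<subseteq> I n" using G(1,2)
  proof (induction G)
    case (insert g G)
    then obtain m n where "g \<in> I m" "G \<subseteq> I n" by auto
    then have "insert g G \<subseteq> I (max m n)"
      using mono[of m "max m n"] mono[of n "max m n"] by auto
    then show ?case by blast
  qed auto
  then obtain n where "G \<subseteq> I n" by blast
  then have "(\<Union>n. I n) \<subseteq> I n" using G genid_least[OF F[OF IF]] by blast
  then show False using Is[of n] by blast
qed

text \<open>Some term is a combination of the earlier ones, as the ideals generated by the initial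
  segments have a maximal member.\<close>

lemma noeth_sequence:
  fixes a :: "nat \<Rightarrow> 'a::comm_ring_1"
  assumes S: "is_subring S" and N: "noeth S" and a: "\<And>n. a n \<in> S"
  shows "\<exists>n. a n \<in> genid S (a ` {..<n})"
proof -
  have id: "ideal_in S (genid S (a ` {..<n}))" for n
    using a by (intro genid_ideal S) auto
  have "\<exists>M\<in>range (\<lambda>n. genid S (a ` {..<n})). \<forall>I\<in>range (\<lambda>n. genid S (a ` {..<n})). M \<subseteq> I \<longrightarrow> I = M"
    using id by (intro noeth_maximal[OF N]) auto
  then obtain M n where M: "\<And>k. M \<subseteq> genid S (a ` {..<k}) \<Longrightarrow> genid S (a ` {..<k}) = M"
    and n: "M = genid S (a ` {..<n})" by auto
  have "genid S (a ` {..<Suc n}) = M"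
    unfolding n by (rule M[unfolded n]) (intro genid_mono, auto)
  moreover have "a n \<in> genid S (a ` {..<Suc n})"
    by (intro genid_incl S) auto
  ultimately show ?thesis using n by auto
qed

section \<open>Hilbert's basis theorem\<close>

text \<open>The ring \<open>S[u]\<close>.\<close>

definition adj :: "'a::comm_ring_1 set \<Rightarrow> 'a \<Rightarrow> 'a set" where
  "adj S u = {poly p u | p. \<forall>i. Polynomial.coeff p i \<in> S}"

lemma coeff_mult_closed:
  assumes "is_subring S" "\<forall>i. Polynomial.coeff p i \<in> S" "\<forall>i. Polynomial.coeff q i \<in> S"
  shows "Polynomial.coeff (p * q) i \<in> S"
  using assms by (auto simp: coeff_mult intro!: subring_sum)

lemma adj_subring:
  assumes S: "is_subring S" shows "is_subring (adj S u)"
proof (rule is_subringI)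
  show "1 \<in> adj S u" unfolding adj_def using S by (auto intro!: exI[of _ 1] simp: coeff_1)
next
  fix a b assume "a \<in> adj S u" "b \<in> adj S u"
  then obtain p q where pq: "a = poly p u" "b = poly q u" "\<forall>i. Polynomial.coeff p i \<in> S"
      "\<forall>i. Polynomial.coeff q i \<in> S" unfolding adj_def by blast
  show "a + b \<in> adj S u" unfolding adj_def using S pq by (auto intro!: exI[of _ "p + q"])
  show "a * b \<in> adj S u" unfolding adj_def using S pq
    by (auto intro!: exI[of _ "p * q"] coeff_mult_closed)
next
  fix a assume "a \<in> adj S u"
  then obtain p where pq: "a = poly p u" "\<forall>i. Polynomial.coeff p i \<in> S"
     unfolding adj_def by blast
  show "- a \<in> adj S u" unfolding adj_def using S pq by (auto intro!: exI[of _ "- p"])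
qed

lemma adj_base: "is_subring S \<Longrightarrow> S \<subseteq> adj S u"
proof
  fix a assume "is_subring S" "a \<in> S"
  then show "a \<in> adj S u"
    unfolding adj_def by (intro CollectI exI[of _ "[:a:]"]) (auto simp: coeff_pCons split: nat.split)
qed

lemma adj_gen: "is_subring S \<Longrightarrow> u \<in> adj S u"
  unfolding adj_def by (intro CollectI exI[of _ "[:0, 1:]"]) (auto simp: coeff_pCons split: nat.split)

lemma poly_in_subring:
  assumes "is_subring T" "u \<in> T" "\<And>i. Polynomial.coeff p i \<in> T"
  shows "poly p u \<in> T"
  using assms by (auto simp: poly_altdef)

lemma adj_least:
  assumes "is_subring T" "S \<subseteq> T" "u \<in> T" shows "adj S u \<subseteq> T"
  unfolding adj_def using assms by (auto intro!: poly_in_subring)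

lemma adj_mono: "S \<subseteq> T \<Longrightarrow> adj S u \<subseteq> adj T u"
  unfolding adj_def by blast

text \<open>If \<open>I\<close> is not finitely generated, choose polynomials \<open>p n\<close> one after the other, each of
  least degree among those whose value at \<open>u\<close> lies in \<open>I\<close> but not in the ideal generated by the
  previous values. Some leading coefficient is a combination of the earlier ones, and subtracting
  from \<open>p n\<close> the same combination of the \<open>p k\<close>, shifted to the degree of \<open>p n\<close>, yields a
  polynomial of smaller degree that was admissible in the choice of \<open>p n\<close>.\<close>

theorem noeth_adj:
  assumes S: "is_subring S" and N: "noeth S"
  shows "noeth (adj S u)"
  unfolding noeth_def
proof (intro allI impI, rule ccontr)
  let ?R = "adj S u"
  let ?over = "\<lambda>p. \<forall>i. Polynomial.coeff p i \<in> S"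
  fix I assume I: "ideal_in ?R I" and "\<not> (\<exists>G. finite G \<and> G \<subseteq> I \<and> I \<subseteq> genid ?R G)"
  then have no: "\<exists>a\<in>I. a \<notin> genid ?R G" if "finite G" "G \<subseteq> I" for G using that by blast
  have R: "is_subring ?R" by (rule adj_subring[OF S])
  let ?P = "\<lambda>G p. ?over p \<and> poly p u \<in> I \<and> poly p u \<notin> genid ?R G"
  \<comment> \<open>the choice of the next polynomial, as a function of the values \<open>G\<close> found so far\<close>
  define nxt where "nxt = (\<lambda>G. arg_min Polynomial.degree (?P G))"
  have nxt: "?P G (nxt G) \<and> (\<forall>q. ?P G q \<longrightarrow> Polynomial.degree (nxt G) \<le> Polynomial.degree q)"
    if G: "finite G" "G \<subseteq> I" for G
  proof -
    obtain a where a: "a \<in> I" "a \<notin> genid ?R G" using no[OF G] by blast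
    then obtain p where "?P G p" using ideal_in_subset[OF I] unfolding adj_def by blast
    then show ?thesis unfolding nxt_def by (rule arg_min_nat_lemma)
  qed
  define G where "G = (\<lambda>n. ((\<lambda>G. insert (poly (nxt G) u) G) ^^ n) {})"
  have G0: "G 0 = {}" and GS: "G (Suc n) = insert (poly (nxt (G n)) u) (G n)" for n
    by (simp_all add: G_def)
  have G: "finite (G n)" "G n \<subseteq> I" for n
  proof (induction n)
    case (Suc n)
    { case 1 show ?case using Suc by (simp add: GS) }
    { case 2 show ?case using Suc nxt[OF Suc] by (simp add: GS) }
  qed (simp_all add: G0)
  define p where "p = (\<lambda>n. nxt (G n))"
  have p: "?P (G n) (p n)" "\<And>q. ?P (G n) q \<Longrightarrow> Polynomial.degree (p n) \<le> Polynomial.degree q" for n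
    using nxt[OF G, of n] by (auto simp: p_def)
  have Gm: "G m \<subseteq> G n" if "m \<le> n" for m n
    using that by (induction rule: dec_induct) (auto simp: GS)
  have pG: "poly (p k) u \<in> G n" if "k < n" for k n
    using Gm[of "Suc k" n] that by (auto simp: GS p_def)
  have deg: "Polynomial.degree (p k) \<le> Polynomial.degree (p n)" if "k \<le> n" for k n
    using p(1)[of n] genid_mono[OF order_refl Gm[OF that], of ?R] by (intro p(2)) auto
  obtain n where n: "lead_coeff (p n) \<in> genid S ((\<lambda>k. lead_coeff (p k)) ` {..<n})"
    using noeth_sequence[OF S N, of "\<lambda>k. lead_coeff (p k)"] p(1) by auto
  then obtain c where c: "\<And>k. c k \<in> S" "lead_coeff (p n) = (\<Sum>k<n. c k * lead_coeff (p k))"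
    using genid_imageD[OF S, of "{..<n}" _ "\<lambda>k. lead_coeff (p k)"] by auto
  define d where "d = Polynomial.degree (p n)"
  define m where "m = (\<lambda>k. Polynomial.monom (c k) (d - Polynomial.degree (p k)))"
  define q where "q = p n - (\<Sum>k<n. m k * p k)"
  have mo: "?over (m k)" for k using c S by (auto simp: m_def)
  have qo: "?over q" using p(1) S mo
    by (auto simp: q_def coeff_sum intro!: subring_sum coeff_mult_closed subring_diff)
  have mI: "poly (m k) u \<in> ?R" for k unfolding adj_def using mo by blast
  have gid: "ideal_in ?R (genid ?R (G n))"
    using G(2)[of n] ideal_in_subset[OF I] by (intro genid_ideal R) auto
  have sg: "(\<Sum>k<n. poly (m k) u * poly (p k) u) \<in> genid ?R (G n)"
    using mI pG G(2)[of n] ideal_in_subset[OF I] by (intro genid_sumI R) auto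
  have qu: "poly q u = poly (p n) u - (\<Sum>k<n. poly (m k) u * poly (p k) u)"
    by (simp add: q_def poly_sum)
  have "poly q u \<in> I"
    unfolding qu using p(1) mI by (intro ideal_in_diff[OF I R] ideal_in_sum[OF I] ideal_in_lmult[OF I]) auto
  moreover have notin: "poly q u \<notin> genid ?R (G n)"
    using p(1)[of n] ideal_in_add[OF gid _ sg, of "poly q u"] by (auto simp: qu)
  ultimately have P: "?P (G n) q" using qo by blast
  have dq: "Polynomial.degree q \<le> d"
    unfolding q_def
  proof (intro degree_diff_le degree_sum_le)
    show "Polynomial.degree (m k * p k) \<le> d" if "k \<in> {..<n}" for k
    proof -
      have "Polynomial.degree (m k * p k) \<le> Polynomial.degree (m k) + Polynomial.degree (p k)"
        by (rule degree_mult_le)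
      also have "\<dots> \<le> (d - Polynomial.degree (p k)) + Polynomial.degree (p k)"
        by (simp add: m_def degree_monom_le)
      finally show ?thesis using deg[of k n] that by (simp add: d_def)
    qed
  qed (auto simp: d_def)
  have "Polynomial.coeff (m k * p k) d = c k * lead_coeff (p k)" if "k < n" for k
    using deg[of k n] that by (simp add: m_def coeff_monom_mult d_def)
  then have "Polynomial.coeff q d = 0"
    using c(2) by (simp add: q_def coeff_sum d_def)
  moreover have "q \<noteq> 0" using notin by (auto intro: genid.intros)
  ultimately have "Polynomial.degree q < d" using dq
    by (metis le_neq_implies_less leading_coeff_0_iff)
  then show False using p(2)[OF P] by (simp add: d_def)
qed

section \<open>Krull's height theorem\<close>

lemma noeth_maximalE:
  assumes "noeth S" and "P I" and "\<And>J. P J \<Longrightarrow> ideal_in S J"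
  obtains M where "P M" and "\<And>J. P J \<Longrightarrow> M \<subseteq> J \<Longrightarrow> J = M"
proof -
  have "\<exists>M\<in>{J. P J}. \<forall>J\<in>{J. P J}. M \<subseteq> J \<longrightarrow> J = M"
    using assms by (intro noeth_maximal) auto
  then show ?thesis using that by auto
qed

definition local_at :: "'a::comm_ring_1 set \<Rightarrow> 'a set \<Rightarrow> bool" where
  "local_at S m \<longleftrightarrow> ideal_in S m \<and> 1 \<notin> m \<and> (\<forall>a\<in>S - m. \<exists>b\<in>S. a * b = 1)"

lemma local_at_ideal_le:
  assumes "local_at S m" "ideal_in S I" "1 \<notin> I" shows "I \<subseteq> m"
proof
  fix a assume a: "a \<in> I"
  show "a \<in> m"
  proof (rule ccontr)
    assume "a \<notin> m"
    then obtain b where "b \<in> S" "a * b = 1"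
      using assms a ideal_in_carrier unfolding local_at_def by blast
    then show False using a assms ideal_in_rmult by metis
  qed
qed

lemma local_at_one_minus:
  assumes S: "is_subring S" and m: "local_at S m" and t: "t \<in> m"
  shows "\<exists>b\<in>S. (1 - t) * b = 1"
proof -
  have i: "ideal_in S m" using m by (simp add: local_at_def)
  have "1 - t \<notin> m"
    using ideal_in_add[OF i _ t, of "1 - t"] m by (auto simp: local_at_def)
  then show ?thesis using m t ideal_in_carrier[OF i] S unfolding local_at_def by auto
qed

text \<open>Additivity and multiplicativity are required on \<open>D\<close> alone, because the evaluation of \<open>S[u]\<close>
  at an element of \<open>S\<close> is a homomorphism only there.\<close>

lemma prime_in_vimage:
  assumes D: "is_subring D" and h: "\<And>a b. a \<in> D \<Longrightarrow> b \<in> D \<Longrightarrow> h (a + b) = h a + h b"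
     "\<And>a b. a \<in> D \<Longrightarrow> b \<in> D \<Longrightarrow> h (a * b) = h a * h b" "h 0 = 0" "h 1 = 1" "\<And>a. a \<in> D \<Longrightarrow> h a \<in> T"
    and Q: "prime_in T Q"
  shows "prime_in D {a \<in> D. h a \<in> Q}"
proof -
  note iQ = prime_in_ideal[OF Q]
  have "ideal_in D {a \<in> D. h a \<in> Q}"
    unfolding ideal_in_def
    using D h ideal_in_zero[OF iQ] ideal_in_add[OF iQ] ideal_in_lmult[OF iQ] by simp
  moreover have "1 \<notin> {a \<in> D. h a \<in> Q}" using Q h by (simp add: prime_in_def)
  moreover have "a \<in> {a \<in> D. h a \<in> Q} \<or> b \<in> {a \<in> D. h a \<in> Q}"
    if "a \<in> D" "b \<in> D" "a * b \<in> {a \<in> D. h a \<in> Q}" for a b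
    using that h prime_in_mult[OF Q, of "h a" "h b"] by simp
  ultimately show ?thesis unfolding prime_in_def by blast
qed

lemma prime_in_contract:
  assumes D: "is_subring D" and Q: "prime_in T Q" and "D \<subseteq> T"
  shows "prime_in D (Q \<inter> D)"
proof -
  have "prime_in D {a \<in> D. a \<in> Q}"
    by (rule prime_in_vimage[OF D _ _ _ _ _ Q]) (use assms in auto)
  moreover have "{a \<in> D. a \<in> Q} = Q \<inter> D" by blast
  ultimately show ?thesis by simp
qed

definition ideal_plus :: "'a::comm_ring_1 set \<Rightarrow> 'a set \<Rightarrow> 'a \<Rightarrow> 'a set" where
  "ideal_plus S I a = {u + r * a | u r. u \<in> I \<and> r \<in> S}"

lemma ideal_plus_ideal:
  assumes S: "is_subring S" and I: "ideal_in S I" and a: "a \<in> S"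
  shows "ideal_in S (ideal_plus S I a)" "I \<subseteq> ideal_plus S I a" "a \<in> ideal_plus S I a"
proof -
  have pI: "u + r * a \<in> ideal_plus S I a" if "u \<in> I" "r \<in> S" for u r
    using that by (auto simp: ideal_plus_def)
  show sub: "I \<subseteq> ideal_plus S I a"
    using pI[of _ 0] S by auto
  show "a \<in> ideal_plus S I a"
    using pI[of 0 1] S ideal_in_zero[OF I] by auto
  show "ideal_in S (ideal_plus S I a)"
    unfolding ideal_in_def
  proof (intro conjI ballI)
    show "ideal_plus S I a \<subseteq> S" using S a ideal_in_carrier[OF I] by (auto simp: ideal_plus_def)
    show "0 \<in> ideal_plus S I a" using sub ideal_in_zero[OF I] by blast
  next
    fix v w assume "v \<in> ideal_plus S I a" "w \<in> ideal_plus S I a"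
    then obtain u r u' r' where "v = u + r * a" "w = u' + r' * a" "u \<in> I" "u' \<in> I" "r \<in> S" "r' \<in> S"
      by (auto simp: ideal_plus_def)
    then show "v + w \<in> ideal_plus S I a"
      using pI[of "u + u'" "r + r'"] S ideal_in_add[OF I] by (simp add: algebra_simps)
  next
    fix s v assume "s \<in> S" "v \<in> ideal_plus S I a"
    then obtain u r where "v = u + r * a" "u \<in> I" "r \<in> S" "s \<in> S"
      by (auto simp: ideal_plus_def)
    then show "s * v \<in> ideal_plus S I a"
      using pI[of "s * u" "s * r"] S ideal_in_lmult[OF I] by (simp add: algebra_simps)
  qed
qed

lemma ideal_plus_mono: "I \<subseteq> J \<Longrightarrow> ideal_plus S I a \<subseteq> ideal_plus S J a"
  by (auto simp: ideal_plus_def)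

lemma ideal_plus_least:
  assumes "ideal_in S J" "I \<subseteq> J" "a \<in> J" shows "ideal_plus S I a \<subseteq> J"
  using assms ideal_in_add[OF assms(1)] ideal_in_lmult[OF assms(1)] by (auto simp: ideal_plus_def)

definition colon :: "'a::comm_ring_1 set \<Rightarrow> 'a set \<Rightarrow> 'a \<Rightarrow> 'a set" where
  "colon S I a = {r \<in> S. r * a \<in> I}"

lemma colon_ideal:
  assumes S: "is_subring S" and I: "ideal_in S I" and a: "a \<in> S"
  shows "ideal_in S (colon S I a)" "I \<subseteq> colon S I a"
  using S ideal_in_carrier[OF I] ideal_in_zero[OF I] ideal_in_add[OF I] ideal_in_lmult[OF I]
    ideal_in_rmult[OF I] a
  by (auto simp: colon_def ideal_in_def distrib_right mult.assoc)

text \<open>The ring \<open>S/I\<close> is Artinian, expressed by ideals of \<open>S\<close>.\<close>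

definition dcc_over :: "'a::comm_ring_1 set \<Rightarrow> 'a set \<Rightarrow> bool" where
  "dcc_over S I \<longleftrightarrow> (\<forall>J :: nat \<Rightarrow> 'a set. (\<forall>n. ideal_in S (J n) \<and> I \<subseteq> J n \<and> J (Suc n) \<subseteq> J n)
     \<longrightarrow> (\<exists>N. \<forall>n\<ge>N. J n = J N))"

lemma decreasing_le:
  fixes J :: "nat \<Rightarrow> 'a set"
  assumes "\<And>n. J (Suc n) \<subseteq> J n" "m \<le> n" shows "J n \<subseteq> J m"
  using assms(2) by (induction rule: dec_induct) (use assms(1) in auto)

text \<open>Noetherian induction: let \<open>M\<close> be maximal among the ideals over \<open>I\<close> for which the claim
  fails. If \<open>M\<close> is prime, then it is \<open>m\<close>, and the only ideals containing it are \<open>m\<close> and \<open>S\<close>.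
  Otherwise there are \<open>a, b\<close> outside \<open>M\<close> with \<open>ab\<close> in \<open>M\<close>. The claim holds for \<open>M + (a)\<close> and for
  \<open>(M : a)\<close>, which contains \<open>b\<close>, and a descending chain \<open>J n\<close> over \<open>M\<close> is stationary as soon as
  \<open>J n + (a)\<close> and \<open>(J n : a)\<close> are.\<close>

lemma dcc_over_single_prime:
  assumes S: "is_subring S" and N: "noeth S" and m: "local_at S m"
    and I: "ideal_in S I" and only: "\<And>Q. prime_in S Q \<Longrightarrow> I \<subseteq> Q \<Longrightarrow> Q = m"
  shows "dcc_over S I"
proof (rule ccontr)
  assume bad: "\<not> dcc_over S I"
  let ?P = "\<lambda>J. ideal_in S J \<and> I \<subseteq> J \<and> \<not> dcc_over S J"
  obtain M where M0: "?P M" and max0: "\<And>J. ?P J \<Longrightarrow> M \<subseteq> J \<Longrightarrow> J = M"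
    by (rule noeth_maximalE[OF N, of ?P I]) (use I bad in auto)
  then have M: "ideal_in S M" "I \<subseteq> M" "\<not> dcc_over S M" by auto
  have max: "dcc_over S J" if "ideal_in S J" "M \<subset> J" for J
    using max0[of J] M(2) that by auto
  obtain J where J: "\<And>n. ideal_in S (J n)" "\<And>n. M \<subseteq> J n" "\<And>n. J (Suc n) \<subseteq> J n"
    and Jns: "\<And>N. \<exists>n\<ge>N. J n \<noteq> J N"
    using M(3) unfolding dcc_over_def by (simp only: not_all not_imp not_ex) metis
  have dec: "J b \<subseteq> J a" if "a \<le> b" for a b using decreasing_le[of J] J(3) that by blast
  have whole: "K = S" if "ideal_in S K" "1 \<in> K" for K
    using that ideal_in_lmult[OF that(1)] ideal_in_carrier[OF that(1)] by (metis mult.right_neutral subsetI subset_antisym)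
  have 1: "1 \<notin> M"
  proof
    assume "1 \<in> M"
    then have "J n = S" for n using whole[OF J(1)] J(2) by blast
    then show False using Jns by blast
  qed
  show False
  proof (cases "prime_in S M")
    case True
    then have Mm: "M = m" using only M(2) by blast
    have alt: "J n = S \<or> J n = m" for n
      using local_at_ideal_le[OF m J(1)[of n]] J(2)[of n] whole[OF J(1)[of n]] Mm by blast
    show False
    proof (cases "\<exists>N. J N = m")
      case True
      then obtain N where "J N = m" by blast
      then have "J n = J N" if "n \<ge> N" for n using dec[OF that] J(2)[of n] Mm by blast
      then show False using Jns by blast
    next
      case False
      then show False using alt Jns by metis
    qed
  next
    case False
    then obtain a b where ab: "a \<in> S" "b \<in> S" "a * b \<in> M" "a \<notin> M" "b \<notin> M"
      using M(1) 1 unfolding prime_in_def by blast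
    have "M \<subset> ideal_plus S M a" using ideal_plus_ideal[OF S M(1) ab(1)] ab by blast
    then have d1: "dcc_over S (ideal_plus S M a)" using max ideal_plus_ideal(1)[OF S M(1) ab(1)] by blast
    have "b \<in> colon S M a" using ab by (simp add: colon_def mult.commute)
    then have "M \<subset> colon S M a" using colon_ideal(2)[OF S M(1) ab(1)] ab(5) by blast
    then have d2: "dcc_over S (colon S M a)" using max colon_ideal(1)[OF S M(1) ab(1)] by blast
    have "\<exists>N. \<forall>n\<ge>N. ideal_plus S (J n) a = ideal_plus S (J N) a"
    proof (rule d1[unfolded dcc_over_def, rule_format], intro conjI)
      show "ideal_in S (ideal_plus S (J n) a)" for n by (rule ideal_plus_ideal[OF S J(1) ab(1)])
      show "ideal_plus S M a \<subseteq> ideal_plus S (J n) a" for n by (rule ideal_plus_mono[OF J(2)])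
      show "ideal_plus S (J (Suc n)) a \<subseteq> ideal_plus S (J n) a" for n by (rule ideal_plus_mono[OF J(3)])
    qed
    then obtain N1 where N1: "\<And>n. n \<ge> N1 \<Longrightarrow> ideal_plus S (J n) a = ideal_plus S (J N1) a" by blast
    have "\<exists>N. \<forall>n\<ge>N. colon S (J n) a = colon S (J N) a"
    proof (rule d2[unfolded dcc_over_def, rule_format], intro conjI)
      show "ideal_in S (colon S (J n) a)" for n by (rule colon_ideal[OF S J(1) ab(1)])
      show "colon S M a \<subseteq> colon S (J n) a" for n using J(2) by (auto simp: colon_def)
      show "colon S (J (Suc n)) a \<subseteq> colon S (J n) a" for n using J(3) by (auto simp: colon_def)
    qed
    then obtain N2 where N2: "\<And>n. n \<ge> N2 \<Longrightarrow> colon S (J n) a = colon S (J N2) a" by blast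
    define N where "N = max N1 N2"
    have "J n = J N" if n: "n \<ge> N" for n
    proof
      show "J n \<subseteq> J N" using dec[OF n] .
      show "J N \<subseteq> J n"
      proof
        fix c assume c: "c \<in> J N"
        then have "c \<in> ideal_plus S (J n) a"
          using N1[of n] N1[of N] n ideal_plus_ideal(2)[OF S J(1) ab(1), of N] by (auto simp: N_def)
        then obtain u r where ur: "c = u + r * a" "u \<in> J n" "r \<in> S" by (auto simp: ideal_plus_def)
        then have "r * a \<in> J N"
          using ideal_in_diff[OF J(1)[of N] S, of c u] c dec[OF n] by auto
        then have "r \<in> colon S (J n) a"
          using N2[of n] N2[of N] n ur by (auto simp: N_def colon_def)
        then show "c \<in> J n" using ur ideal_in_add[OF J(1)[of n]] by (auto simp: colon_def)
      qed
    qed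
    then show False using Jns by blast
  qed
qed

text \<open>Nakayama's lemma for \<open>I = K + xI\<close>, with an ideal \<open>M\<close>, maximal among those that contain \<open>K\<close>
  and lie strictly inside \<open>I\<close>, in place of a set of generators. For \<open>a\<close> in \<open>I\<close> but not in \<open>M\<close>,
  maximality gives \<open>I = M + Sa\<close>; then \<open>a = k + x(u + ra)\<close>, so \<open>(1 - xr)a\<close> lies in \<open>M\<close>, and
  \<open>1 - xr\<close> is a unit.\<close>

lemma nakayama_principal:
  assumes S: "is_subring S" and N: "noeth S" and m: "local_at S m" and x: "x \<in> m"
    and I: "ideal_in S I" and K: "ideal_in S K" "K \<subseteq> I"
    and gen: "\<And>a. a \<in> I \<Longrightarrow> \<exists>k\<in>K. \<exists>b\<in>I. a = k + x * b"
  shows "I = K"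
proof (rule ccontr)
  assume "I \<noteq> K"
  let ?P = "\<lambda>J. ideal_in S J \<and> K \<subseteq> J \<and> J \<subset> I"
  obtain M where M0: "?P M" and max0: "\<And>J. ?P J \<Longrightarrow> M \<subseteq> J \<Longrightarrow> J = M"
    by (rule noeth_maximalE[OF N, of ?P K]) (use K \<open>I \<noteq> K\<close> in auto)
  then have M: "ideal_in S M" "K \<subseteq> M" "M \<subset> I" by auto
  have max: "J = I" if "ideal_in S J" "M \<subset> J" "J \<subseteq> I" for J
    using max0[of J] M(2) that by auto
  obtain a where a: "a \<in> I" "a \<notin> M" using M by blast
  have aS: "a \<in> S" using ideal_in_carrier[OF I a(1)] .
  have MI: "ideal_plus S M a = I"
  proof (rule max)
    show "ideal_in S (ideal_plus S M a)" by (rule ideal_plus_ideal(1)[OF S M(1) aS])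
    show "M \<subset> ideal_plus S M a" using ideal_plus_ideal(2,3)[OF S M(1) aS] a(2) by blast
    show "ideal_plus S M a \<subseteq> I" using M(3) a(1) by (intro ideal_plus_least[OF I]) auto
  qed
  obtain k b where kb: "k \<in> K" "b \<in> I" "a = k + x * b" using gen[OF a(1)] by blast
  obtain u r where ur: "b = u + r * a" "u \<in> M" "r \<in> S" using kb(2) MI by (auto simp: ideal_plus_def)
  have xS: "x \<in> S" and im: "ideal_in S m" using m x ideal_in_carrier by (auto simp: local_at_def)
  have eq: "(1 - x * r) * a = k + x * u" using kb(3) ur(1) by (simp add: algebra_simps)
  obtain c where c: "c \<in> S" "(1 - x * r) * c = 1"
    using local_at_one_minus[OF S m, of "x * r"] ideal_in_rmult[OF im ur(3) x] by blast
  have "a = c * ((1 - x * r) * a)" using c(2) by (metis mult.assoc mult.commute mult_1)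
  also have "\<dots> \<in> M" unfolding eq
    using M(2) kb(1) ur(2) xS c(1) by (intro ideal_in_lmult[OF M(1)] ideal_in_add[OF M(1)]) auto
  finally show False using a by blast
qed

text \<open>Krull's principal ideal theorem in \<open>S/P'\<close>: if \<open>m\<close> is the only prime over \<open>P' + (x)\<close>, then no
  prime lies strictly between \<open>P'\<close> and \<open>m\<close>. For a given \<open>y\<close> in \<open>P\<close> but not in \<open>P'\<close>, the ideal
  \<open>J n\<close> is the contraction to \<open>S\<close> of the extension of \<open>P' + (y\<^sup>n)\<close> to the localization at \<open>P\<close>.
  Modulo \<open>P' + (x)\<close> these ideals become stationary, so \<open>J n \<subseteq> J (n + 1) + (x)\<close> for some \<open>n\<close>; as
  \<open>x\<close> is not in \<open>P\<close>, the multiplier of \<open>x\<close> can be taken from \<open>J n\<close>, and Nakayama's lemma gives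
  \<open>J n = J (n + 1)\<close>. But then \<open>y\<^sup>n\<close> is in \<open>J (n + 1)\<close>, which makes \<open>y\<close> a unit modulo \<open>P'\<close> in the
  localization at \<open>P\<close>, a contradiction.\<close>

lemma principal_ideal_theorem:
  assumes S: "is_subring S" and N: "noeth S" and m: "local_at S m"
    and P': "prime_in S P'" and P: "prime_in S P" and "P' \<subset> P" "P \<subset> m"
    and x: "x \<in> m" and only: "\<And>Q. prime_in S Q \<Longrightarrow> P' \<subseteq> Q \<Longrightarrow> x \<in> Q \<Longrightarrow> Q = m"
  shows False
proof -
  note iP' = prime_in_ideal[OF P'] and iP = prime_in_ideal[OF P]
  have im: "ideal_in S m" using m by (simp add: local_at_def)
  have xS: "x \<in> S" using ideal_in_carrier[OF im x] .
  have xP: "x \<notin> P" using only[OF P] \<open>P' \<subset> P\<close> \<open>P \<subset> m\<close> by blast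
  obtain y where y: "y \<in> P" "y \<notin> P'" using \<open>P' \<subset> P\<close> by blast
  have yS: "y \<in> S" using ideal_in_carrier[OF iP y(1)] .
  define J where "J = (\<lambda>n. {a \<in> S. \<exists>s\<in>S - P. \<exists>r\<in>S. s * a - y ^ n * r \<in> P'})"
  have multP: "s * t \<in> S - P" if "s \<in> S - P" "t \<in> S - P" for s t
    using that S P unfolding prime_in_def by auto
  have oneP: "1 \<in> S - P" using S P by (auto simp: prime_in_def)
  have J: "ideal_in S (J n)" for n
    unfolding ideal_in_def
  proof (intro conjI ballI)
    show "J n \<subseteq> S" by (auto simp: J_def)
    show "0 \<in> J n" using oneP S ideal_in_zero[OF iP'] by (auto simp: J_def intro!: bexI[of _ 1] bexI[of _ 0])
  next
    fix a b assume "a \<in> J n" "b \<in> J n"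
    then obtain s r t q where *: "a \<in> S" "b \<in> S" "s \<in> S - P" "r \<in> S" "t \<in> S - P" "q \<in> S"
      "s * a - y ^ n * r \<in> P'" "t * b - y ^ n * q \<in> P'" by (auto simp: J_def)
    have "t * (s * a - y ^ n * r) + s * (t * b - y ^ n * q) \<in> P'"
      using * by (intro ideal_in_add[OF iP'] ideal_in_lmult[OF iP']) auto
    also have "t * (s * a - y ^ n * r) + s * (t * b - y ^ n * q) =
        (s * t) * (a + b) - y ^ n * (t * r + s * q)" by (simp add: algebra_simps)
    finally show "a + b \<in> J n" unfolding J_def using * S multP[of s t] by auto
  next
    fix c a assume "c \<in> S" "a \<in> J n"
    then obtain s r where *: "a \<in> S" "s \<in> S - P" "r \<in> S" "s * a - y ^ n * r \<in> P'" "c \<in> S"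
      by (auto simp: J_def)
    have "c * (s * a - y ^ n * r) \<in> P'" using * by (intro ideal_in_lmult[OF iP']) auto
    also have "c * (s * a - y ^ n * r) = s * (c * a) - y ^ n * (c * r)" by (simp add: algebra_simps)
    finally show "c * a \<in> J n" unfolding J_def using * S by auto
  qed
  have Jdec: "J (Suc n) \<subseteq> J n" for n
  proof
    fix a assume "a \<in> J (Suc n)"
    then obtain s r where *: "a \<in> S" "s \<in> S - P" "r \<in> S" "s * a - y ^ Suc n * r \<in> P'"
      by (auto simp: J_def)
    have "s * a - y ^ n * (y * r) \<in> P'" using *(4) by (simp add: algebra_simps)
    then show "a \<in> J n" unfolding J_def using * S yS by blast
  qed
  have P'J: "P' \<subseteq> J n" for n
  proof
    fix a assume a: "a \<in> P'"
    then have "1 * a - y ^ n * 0 \<in> P'" by simp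
    then show "a \<in> J n" unfolding J_def using oneP S a ideal_in_carrier[OF iP'] by blast
  qed
  have "dcc_over S (ideal_plus S P' x)"
    using ideal_plus_ideal[OF S iP' xS] only by (intro dcc_over_single_prime[OF S N m]) blast+
  then have "\<exists>k. \<forall>n\<ge>k. ideal_plus S (J n) x = ideal_plus S (J k) x"
  proof (rule dcc_over_def[THEN iffD1, THEN spec, THEN mp], intro allI conjI)
    show "ideal_in S (ideal_plus S (J n) x)" for n by (rule ideal_plus_ideal[OF S J xS])
    show "ideal_plus S P' x \<subseteq> ideal_plus S (J n) x" for n by (rule ideal_plus_mono[OF P'J])
    show "ideal_plus S (J (Suc n)) x \<subseteq> ideal_plus S (J n) x" for n by (rule ideal_plus_mono[OF Jdec])
  qed
  then obtain n where n: "ideal_plus S (J (Suc n)) x = ideal_plus S (J n) x" by (metis le_SucI order_refl)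
  have "J n = J (Suc n)"
  proof (rule nakayama_principal[OF S N m x J J Jdec])
    fix a assume a: "a \<in> J n"
    then have "a \<in> ideal_plus S (J (Suc n)) x" using n ideal_plus_ideal(2)[OF S J xS] by blast
    then obtain u r where ur: "a = u + r * x" "u \<in> J (Suc n)" "r \<in> S" by (auto simp: ideal_plus_def)
    have "r * x \<in> J n" using ideal_in_diff[OF J[of n] S a, of u] ur Jdec by auto
    then obtain s q where sq: "s \<in> S - P" "q \<in> S" "s * (r * x) - y ^ n * q \<in> P'" by (auto simp: J_def)
    then have "(s * x) * r - y ^ n * q \<in> P'" by (simp add: mult_ac)
    moreover have "s * x \<in> S - P" using multP sq(1) xP xS by blast
    ultimately have "r \<in> J n" using sq(2) ur(3) unfolding J_def by blast
    then show "\<exists>k\<in>J (Suc n). \<exists>b\<in>J n. a = k + x * b" using ur by (auto simp: mult.commute)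
  qed
  moreover have "y ^ n \<in> J n"
    unfolding J_def using S yS oneP ideal_in_zero[OF iP'] by (auto intro!: bexI[of _ 1])
  ultimately obtain s r where sr: "s \<in> S - P" "r \<in> S" "s * y ^ n - y ^ Suc n * r \<in> P'"
    by (auto simp: J_def)
  have "y ^ n * (s - y * r) \<in> P'" using sr(3) by (simp add: algebra_simps)
  moreover have "y ^ n \<notin> P'" using prime_in_power[OF S P' yS] y by blast
  moreover have "y ^ n \<in> S" "s - y * r \<in> S" using S yS sr(1,2) by auto
  ultimately have "s - y * r \<in> P'" using prime_in_mult[OF P'] by blast
  then have "s - y * r \<in> P" using \<open>P' \<subset> P\<close> by blast
  then have "s \<in> P" using ideal_in_add[OF iP, of "s - y * r" "y * r"] ideal_in_rmult[OF iP sr(2) y(1)] by simp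
  then show False using sr by blast
qed

text \<open>An ideal maximal among those that contain \<open>I\<close> and no power of \<open>a\<close> is prime.\<close>

lemma prime_avoiding_powers:
  assumes S: "is_subring S" and N: "noeth S" and I: "ideal_in S I" and a: "a \<in> S"
    and no: "\<And>n. a ^ n \<notin> I"
  shows "\<exists>P. prime_in S P \<and> I \<subseteq> P \<and> a \<notin> P"
proof -
  let ?P = "\<lambda>J. ideal_in S J \<and> I \<subseteq> J \<and> (\<forall>n. a ^ n \<notin> J)"
  obtain M where M0: "?P M" and max0: "\<And>J. ?P J \<Longrightarrow> M \<subseteq> J \<Longrightarrow> J = M"
    by (rule noeth_maximalE[OF N, of ?P I]) (use I no in auto)
  then have M: "ideal_in S M" "I \<subseteq> M" "\<And>n. a ^ n \<notin> M" by auto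
  have max: "\<exists>n. a ^ n \<in> J" if "ideal_in S J" "M \<subset> J" for J
    using max0[of J] M(2) that by auto
  have "b \<in> M \<or> c \<in> M" if bc: "b \<in> S" "c \<in> S" "b * c \<in> M" for b c
  proof (rule ccontr)
    assume "\<not> ?thesis"
    then have "M \<subset> ideal_plus S M b" "M \<subset> ideal_plus S M c"
      using ideal_plus_ideal[OF S M(1)] bc by blast+
    then obtain i j where "a ^ i \<in> ideal_plus S M b" "a ^ j \<in> ideal_plus S M c"
      using max ideal_plus_ideal(1)[OF S M(1)] bc by meson
    then obtain u r v q where *: "a ^ i = u + r * b" "a ^ j = v + q * c" "u \<in> M" "v \<in> M" "r \<in> S" "q \<in> S"
      by (auto simp: ideal_plus_def)
    have "a ^ (i + j) = (v + q * c) * u + (r * b) * v + (r * q) * (b * c)"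
      unfolding power_add *(1,2) by (simp add: algebra_simps)
    also have "\<dots> \<in> M"
    proof (intro ideal_in_add[OF M(1)])
      show "(v + q * c) * u \<in> M" "r * b * v \<in> M" "r * q * (b * c) \<in> M"
        using * bc S ideal_in_carrier[OF M(1)] by (auto intro: ideal_in_lmult[OF M(1)])
    qed
    finally show False using M(3) by blast
  qed
  then have "prime_in S M" using M(1) M(3)[of 0] by (auto simp: prime_in_def)
  then show ?thesis using M(2) M(3)[of 1] by auto
qed

subsection \<open>Localization\<close>

text \<open>The extension of the ideal \<open>P\<close> to the localization of \<open>D\<close> at \<open>M\<close>.\<close>

definition loc_ext :: "'a::field set \<Rightarrow> 'a set \<Rightarrow> 'a set \<Rightarrow> 'a set" where
  "loc_ext D M P = {a / b | a b. a \<in> P \<and> b \<in> D - M}"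

context
  fixes D M :: "'a::field set"
  assumes D: "is_subring D" and M: "prime_in D M"
begin

lemma loc_denom: "b \<in> D - M \<Longrightarrow> b \<noteq> 0"
  using M ideal_in_zero[OF prime_in_ideal[OF M]] by auto

lemma loc_denom_mult: "b \<in> D - M \<Longrightarrow> c \<in> D - M \<Longrightarrow> b * c \<in> D - M"
  using D M unfolding prime_in_def by auto

lemma loc_denom_one: "1 \<in> D - M"
  using D M by (auto simp: prime_in_def)

lemma localizeI: "a \<in> D \<Longrightarrow> b \<in> D - M \<Longrightarrow> a / b \<in> localize_at D M"
  unfolding localize_at_def by blast

lemma localize_base: "D \<subseteq> localize_at D M"
  using localizeI[OF _ loc_denom_one] by auto

lemma localize_subring: "is_subring (localize_at D M)"
proof (rule is_subringI)
  show "1 \<in> localize_at D M" using localize_base D by auto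
next
  fix v w assume "v \<in> localize_at D M" "w \<in> localize_at D M"
  then obtain a b c d where *: "v = a / b" "w = c / d" "a \<in> D" "c \<in> D" "b \<in> D - M" "d \<in> D - M"
    by (auto simp: localize_at_def)
  note nz = loc_denom[OF *(5)] loc_denom[OF *(6)]
  have "v + w = (a * d + c * b) / (b * d)" "v * w = (a * c) / (b * d)"
    using * nz by (simp_all add: field_simps)
  then show "v + w \<in> localize_at D M" "v * w \<in> localize_at D M"
    using * D loc_denom_mult[OF *(5,6)] by (auto intro!: localizeI)
next
  fix v assume "v \<in> localize_at D M"
  then obtain a b where *: "v = a / b" "a \<in> D" "b \<in> D - M"
    by (auto simp: localize_at_def)
  then show "- v \<in> localize_at D M" using localizeI[of "- a" b] D by simp
qed

lemma localize_ideal_num: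
  assumes "ideal_in (localize_at D M) I" "a / b \<in> I" "b \<in> D - M" shows "a \<in> I"
proof -
  have "b * (a / b) \<in> I" using ideal_in_lmult[OF assms(1) _ assms(2)] localize_base assms(3) by blast
  then show ?thesis using loc_denom[OF assms(3)] by simp
qed

lemma localize_noeth: assumes N: "noeth D" shows "noeth (localize_at D M)"
  unfolding noeth_def
proof (intro allI impI)
  let ?L = "localize_at D M"
  fix I assume I: "ideal_in ?L I"
  have "ideal_in D (I \<inter> D)"
    using D I ideal_in_zero[OF I] ideal_in_add[OF I] ideal_in_lmult[OF I] localize_base
    by (auto simp: ideal_in_def)
  then obtain G where G: "finite G" "G \<subseteq> I \<inter> D" "I \<inter> D \<subseteq> genid D G"
    by (rule noethE[OF N])
  have id: "ideal_in ?L (genid ?L G)" using G localize_base by (intro genid_ideal localize_subring) auto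
  have "I \<subseteq> genid ?L G"
  proof
    fix v assume v: "v \<in> I"
    then obtain a b where ab: "v = a / b" "a \<in> D" "b \<in> D - M"
      using ideal_in_carrier[OF I] by (fastforce simp: localize_at_def)
    then have "a \<in> I" using localize_ideal_num[OF I] v by blast
    then have "a \<in> genid ?L G" using G ab genid_mono[OF localize_base order_refl] by blast
    then have "(1 / b) * a \<in> genid ?L G" using ideal_in_lmult[OF id] localizeI[OF _ ab(3), of 1] D by blast
    then show "v \<in> genid ?L G" using ab by simp
  qed
  then show "\<exists>G. finite G \<and> G \<subseteq> I \<and> I \<subseteq> genid ?L G" using G by blast
qed

lemma loc_ext_contract: assumes P: "prime_in D P" "P \<subseteq> M" shows "loc_ext D M P \<inter> D = P"
proof
  show "P \<subseteq> loc_ext D M P \<inter> D"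
    using loc_denom_one ideal_in_subset[OF prime_in_ideal[OF P(1)]] by (force simp: loc_ext_def)
  show "loc_ext D M P \<inter> D \<subseteq> P"
  proof
    fix v assume "v \<in> loc_ext D M P \<inter> D"
    then obtain a b where *: "v = a / b" "a \<in> P" "b \<in> D - M" "v \<in> D" by (auto simp: loc_ext_def)
    then have "b * v \<in> P" using loc_denom[OF *(3)] by simp
    then show "v \<in> P" using prime_in_mult[OF P(1)] * P(2) by blast
  qed
qed

lemma loc_ext_ideal: assumes P: "ideal_in D P" shows "ideal_in (localize_at D M) (loc_ext D M P)"
  unfolding ideal_in_def
proof (intro conjI ballI)
  show "loc_ext D M P \<subseteq> localize_at D M"
    using ideal_in_carrier[OF P] by (auto simp: loc_ext_def localize_at_def)
  show "0 \<in> loc_ext D M P" using ideal_in_zero[OF P] loc_denom_one by (force simp: loc_ext_def)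
next
  fix v w assume "v \<in> loc_ext D M P" "w \<in> loc_ext D M P"
  then obtain a b c d where *: "v = a / b" "w = c / d" "a \<in> P" "c \<in> P" "b \<in> D - M" "d \<in> D - M"
    by (auto simp: loc_ext_def)
  note nz = loc_denom[OF *(5)] loc_denom[OF *(6)]
  have "v + w = (d * a + b * c) / (b * d)"
    using * nz by (simp add: field_simps)
  moreover have "d * a + b * c \<in> P" using * by (intro ideal_in_add[OF P] ideal_in_lmult[OF P]) auto
  ultimately show "v + w \<in> loc_ext D M P" unfolding loc_ext_def using loc_denom_mult[OF *(5,6)] by blast
next
  fix r v assume "r \<in> localize_at D M" "v \<in> loc_ext D M P"
  then obtain a b c d where *: "r = a / b" "v = c / d" "a \<in> D" "c \<in> P" "b \<in> D - M" "d \<in> D - M"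
    by (auto simp: loc_ext_def localize_at_def)
  have "r * v = (a * c) / (b * d)" using * by simp
  moreover have "a * c \<in> P" using * by (intro ideal_in_lmult[OF P]) auto
  ultimately show "r * v \<in> loc_ext D M P" unfolding loc_ext_def using loc_denom_mult[OF *(5,6)] by blast
qed

lemma loc_ext_prime: assumes P: "prime_in D P" "P \<subseteq> M" shows "prime_in (localize_at D M) (loc_ext D M P)"
proof -
  have 1: "1 \<notin> loc_ext D M P"
    using loc_ext_contract[OF P] P D by (auto simp: prime_in_def)
  have "v \<in> loc_ext D M P \<or> w \<in> loc_ext D M P"
    if vw: "v \<in> localize_at D M" "w \<in> localize_at D M" "v * w \<in> loc_ext D M P" for v w
  proof -
    obtain a b c d where *: "v = a / b" "w = c / d" "a \<in> D" "c \<in> D" "b \<in> D - M" "d \<in> D - M"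
      using vw by (auto simp: localize_at_def)
    have "(a * c) / (b * d) \<in> loc_ext D M P" using vw(3) * by simp
    then have "a * c \<in> loc_ext D M P"
      using localize_ideal_num[OF loc_ext_ideal[OF prime_in_ideal[OF P(1)]]] loc_denom_mult[OF *(5,6)] by blast
    then have "a * c \<in> P" using loc_ext_contract[OF P] * D by auto
    then have "a \<in> P \<or> c \<in> P" using prime_in_mult[OF P(1)] * by blast
    then show ?thesis using * by (auto simp: loc_ext_def)
  qed
  then show ?thesis using 1 loc_ext_ideal[OF prime_in_ideal[OF P(1)]] by (auto simp: prime_in_def)
qed

lemma localize_local: "local_at (localize_at D M) (loc_ext D M M)"
  unfolding local_at_def
proof (intro conjI ballI)
  show "ideal_in (localize_at D M) (loc_ext D M M)" "1 \<notin> loc_ext D M M"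
    using loc_ext_prime[OF M order_refl] by (auto simp: prime_in_def)
  fix v assume v: "v \<in> localize_at D M - loc_ext D M M"
  then obtain a b where *: "v = a / b" "a \<in> D" "b \<in> D - M" by (auto simp: localize_at_def)
  have a: "a \<in> D - M" using v * by (auto simp: loc_ext_def)
  show "\<exists>c\<in>localize_at D M. v * c = 1"
    using localizeI[OF _ a, of b] * loc_denom[OF a] loc_denom[OF *(3)] by (intro bexI[of _ "b / a"]) auto
qed

lemma localize_prime_contract:
  assumes Q: "prime_in (localize_at D M) Q"
  shows "prime_in D (Q \<inter> D)" "Q \<inter> D \<subseteq> M" "Q = loc_ext D M (Q \<inter> D)"
proof -
  note iQ = prime_in_ideal[OF Q]
  show "prime_in D (Q \<inter> D)" by (rule prime_in_contract[OF D Q localize_base])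
  show "Q \<inter> D \<subseteq> M"
  proof
    fix a assume a: "a \<in> Q \<inter> D"
    show "a \<in> M"
    proof (rule ccontr)
      assume "a \<notin> M"
      then have aD: "a \<in> D - M" using a by blast
      have "(1 / a) * a \<in> Q" using localizeI[OF _ aD, of 1] D a ideal_in_lmult[OF iQ] by blast
      then show False using Q loc_denom[OF aD] by (auto simp: prime_in_def)
    qed
  qed
  show "Q = loc_ext D M (Q \<inter> D)"
  proof
    show "Q \<subseteq> loc_ext D M (Q \<inter> D)"
    proof
      fix v assume v: "v \<in> Q"
      then obtain a b where *: "v = a / b" "a \<in> D" "b \<in> D - M"
        using ideal_in_carrier[OF iQ] by (fastforce simp: localize_at_def)
      then show "v \<in> loc_ext D M (Q \<inter> D)"
        using localize_ideal_num[OF iQ] v by (auto simp: loc_ext_def)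
    qed
    show "loc_ext D M (Q \<inter> D) \<subseteq> Q"
    proof
      fix v assume "v \<in> loc_ext D M (Q \<inter> D)"
      then obtain a b where *: "v = a / b" "a \<in> Q" "b \<in> D - M" by (auto simp: loc_ext_def)
      then have "(1 / b) * a \<in> Q" using localizeI[OF _ *(3), of 1] D ideal_in_lmult[OF iQ] by blast
      then show "v \<in> Q" using * by simp
    qed
  qed
qed

end

definition prime_chain_in :: "'a::comm_ring_1 set \<Rightarrow> nat \<Rightarrow> (nat \<Rightarrow> 'a set) \<Rightarrow> bool" where
  "prime_chain_in S n p \<longleftrightarrow> (\<forall>i\<le>n. prime_in S (p i)) \<and> (\<forall>i<n. p i \<subset> p (Suc i))"

lemma prime_chain_le:
  assumes "prime_chain_in S n p" "i \<le> n" shows "p i \<subseteq> p n"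
  using assms(2) by (induction rule: inc_induct) (use assms(1) in \<open>auto simp: prime_chain_in_def\<close>)

lemma loc_ext_chain:
  assumes D: "is_subring D" and M: "prime_in D M" and p: "prime_chain_in D n p" "p n \<subseteq> M"
  shows "prime_chain_in (localize_at D M) n (\<lambda>i. loc_ext D M (p i))"
proof -
  have pr: "prime_in D (p i)" "p i \<subseteq> M" if "i \<le> n" for i
    using that p prime_chain_le[OF p(1) that] by (auto simp: prime_chain_in_def)
  have "loc_ext D M (p i) \<subset> loc_ext D M (p (Suc i))" if i: "i < n" for i
  proof -
    have "p i \<subset> p (Suc i)" using p i by (auto simp: prime_chain_in_def)
    moreover have "loc_ext D M (p j) \<inter> D = p j" if "j \<le> n" for j
      by (rule loc_ext_contract[OF D M pr(1)[OF that] pr(2)[OF that]])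
    then have "loc_ext D M (p i) \<inter> D = p i" "loc_ext D M (p (Suc i)) \<inter> D = p (Suc i)"
      using i by simp_all
    moreover have "loc_ext D M (p i) \<subseteq> loc_ext D M (p (Suc i))"
      using \<open>p i \<subset> p (Suc i)\<close> unfolding loc_ext_def by blast
    ultimately show ?thesis by (metis psubsetE psubsetI order_refl)
  qed
  moreover have "prime_in (localize_at D M) (loc_ext D M (p i))" if "i \<le> n" for i
    by (rule loc_ext_prime[OF D M pr[OF that]])
  ultimately show ?thesis unfolding prime_chain_in_def by blast
qed

text \<open>Krull's height theorem, by induction on the number of generators. Given a chain of length
  \<open>k + 1\<close>, replace its term \<open>p k\<close> by a prime \<open>P\<close> that is maximal among the primes different from
  \<open>m\<close> and containing \<open>p k\<close>. Some \<open>x\<close> in \<open>G\<close> is outside \<open>P\<close>, and \<open>m\<close> is the only prime over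
  \<open>P + (x)\<close>, so every other \<open>z\<close> in \<open>G\<close> has a power \<open>y z + r x\<close> with \<open>y z\<close> in \<open>P\<close>. Among the primes
  below \<open>P\<close> only \<open>P\<close> itself contains all the \<open>y z\<close>: over such a prime \<open>Q\<close> and \<open>x\<close> there is again
  only \<open>m\<close>, and the principal ideal theorem excludes \<open>Q \<subset> P \<subset> m\<close>. So the induction hypothesis
  applies to the localization at \<open>P\<close>, with the \<open>y z\<close> as generators and a chain of length \<open>k\<close>.\<close>

theorem height_theorem:
  fixes S :: "'a::field set"
  assumes "is_subring S" "noeth S" "local_at S m" "finite G" "G \<subseteq> m"
    and "\<And>Q. prime_in S Q \<Longrightarrow> G \<subseteq> Q \<Longrightarrow> Q = m"
    and "prime_chain_in S l p"
  shows "l \<le> card G"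
  using assms
proof (induction "card G" arbitrary: S m G l p rule: less_induct)
  case less
  note S = less.prems(1) and N = less.prems(2) and m = less.prems(3) and G = less.prems(4,5)
    and only = less.prems(6) and p = less.prems(7)
  show ?case
  proof (cases l)
    case (Suc k)
    have im: "ideal_in S m" using m by (simp add: local_at_def)
    have ple: "Q \<subseteq> m" if "prime_in S Q" for Q
      using that local_at_ideal_le[OF m] by (auto simp: prime_in_def)
    have pk: "prime_in S (p k)" "p k \<subset> p l" "prime_in S (p l)"
      using p Suc by (auto simp: prime_chain_in_def)
    let ?P = "\<lambda>P. prime_in S P \<and> p k \<subseteq> P \<and> P \<noteq> m"
    have "?P (p k)" using pk ple by blast
    then obtain P where P0: "?P P" and max0: "\<And>J. ?P J \<Longrightarrow> P \<subseteq> J \<Longrightarrow> J = P"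
      by (rule noeth_maximalE[OF N, of ?P "p k"]) (auto intro: prime_in_ideal)
    then have P: "prime_in S P" "p k \<subseteq> P" "P \<noteq> m" by auto
    have max: "J = P" if "prime_in S J" "P \<subseteq> J" "J \<noteq> m" for J
      using max0[of J] P(2) that by auto
    have Pm: "P \<subset> m" using ple P by blast
    note iP = prime_in_ideal[OF P(1)]
    obtain x where x: "x \<in> G" "x \<notin> P" using only[OF P(1)] P(3) by blast
    have xm: "x \<in> m" and xS: "x \<in> S" using x G ideal_in_carrier[OF im] by auto
    have "\<exists>y r j. y \<in> P \<and> r \<in> S \<and> z ^ j = y + r * x" if z: "z \<in> G" for z
    proof (rule ccontr)
      assume no: "\<not> ?thesis"
      have zS: "z \<in> S" and zm: "z \<in> m" using z G ideal_in_carrier[OF im] by auto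
      obtain Q where Q: "prime_in S Q" "ideal_plus S P x \<subseteq> Q" "z \<notin> Q"
        using prime_avoiding_powers[OF S N ideal_plus_ideal(1)[OF S iP xS] zS] no
        by (auto simp: ideal_plus_def)
      then have "Q = m" using max[of Q] ideal_plus_ideal(2,3)[OF S iP xS] x by blast
      then show False using Q zm by blast
    qed
    then obtain y r j where y: "\<And>z. z \<in> G \<Longrightarrow> y z \<in> P \<and> r z \<in> S \<and> z ^ j z = y z + r z * x"
      by metis
    define Y where "Y = y ` (G - {x})"
    have cX: "card (G - {x}) < card G" using x G by (meson card_Diff1_less)
    have cY: "card Y \<le> card (G - {x})" unfolding Y_def using G by (intro card_image_le) auto
    let ?L = "localize_at S P"
    \<comment> \<open>the chain shortened by \<open>m\<close>, with \<open>P\<close> as its new top\<close>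
    define q where "q = (\<lambda>i. if i < k then p i else P)"
    have YP: "Y \<subseteq> P" using y by (auto simp: Y_def)
    have qch: "prime_chain_in S k q"
      unfolding prime_chain_in_def
    proof (intro conjI allI impI)
      show "prime_in S (q i)" if "i \<le> k" for i using p P(1) that Suc by (auto simp: prime_chain_in_def q_def)
      show "q i \<subset> q (Suc i)" if i: "i < k" for i
      proof -
        have "p i \<subset> p (Suc i)" using p i Suc by (auto simp: prime_chain_in_def)
        moreover have "p (Suc i) \<subseteq> q (Suc i)" using P(2) i by (cases "Suc i = k") (auto simp: q_def)
        ultimately show ?thesis using i by (auto simp: q_def)
      qed
    qed
    have "k \<le> card Y"
    proof (rule less.hyps[of Y ?L "loc_ext S P P"])
      show "card Y < card G" using cX cY by simp
      show "is_subring ?L" by (rule localize_subring[OF S P(1)])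
      show "noeth ?L" by (rule localize_noeth[OF S P(1) N])
      show "local_at ?L (loc_ext S P P)" by (rule localize_local[OF S P(1)])
      show "finite Y" using G by (simp add: Y_def)
      show "Y \<subseteq> loc_ext S P P" using YP loc_ext_contract[OF S P(1) P(1)] by blast
      show "prime_chain_in ?L k (\<lambda>i. loc_ext S P (q i))"
        by (rule loc_ext_chain[OF S P(1) qch]) (simp add: q_def)
      show "Q = loc_ext S P P" if Q: "prime_in ?L Q" "Y \<subseteq> Q" for Q
      proof -
        note Q' = localize_prime_contract[OF S P(1) Q(1)]
        have YQ: "Y \<subseteq> Q \<inter> S" using Q(2) YP ideal_in_subset[OF iP] by blast
        have "Q \<inter> S = P"
        proof (rule ccontr)
          assume "Q \<inter> S \<noteq> P"
          then have "Q \<inter> S \<subset> P" using Q'(2) by blast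
          then show False
          proof (rule principal_ideal_theorem[OF S N m Q'(1) P(1) _ Pm xm])
            fix R assume R: "prime_in S R" "Q \<inter> S \<subseteq> R" "x \<in> R"
            note iR = prime_in_ideal[OF R(1)]
            have "G \<subseteq> R"
            proof
              fix z assume z: "z \<in> G"
              show "z \<in> R"
              proof (cases "z = x")
                case False
                then have "y z \<in> Y" using z by (simp add: Y_def)
                then have "y z \<in> R" using YQ R(2) by blast
                then have "z ^ j z \<in> R"
                  using y[OF z] R(3) ideal_in_add[OF iR] ideal_in_lmult[OF iR] by auto
                then show ?thesis
                  using prime_in_power[OF S R(1)] z G ideal_in_carrier[OF im] by blast
              qed (use R in simp)
            qed
            then show "R = m" using only R by blast
          qed
        qed
        then show ?thesis using Q'(3) by simp
      qed
    qed
    then show ?thesis using Suc cX cY by linarith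
  qed simp
qed

subsection \<open>Homomorphic images\<close>

lemma genid_image:
  assumes h: "\<And>a b. a \<in> S \<Longrightarrow> b \<in> S \<Longrightarrow> h (a + b) = h a + h b"
     "\<And>a b. a \<in> S \<Longrightarrow> b \<in> S \<Longrightarrow> h (a * b) = h a * h b" "h 0 = 0"
    and S: "is_subring S" "G \<subseteq> S" and a: "a \<in> genid S G"
  shows "h a \<in> genid (h ` S) (h ` G)"
  using a
proof induction
  case genid_0 then show ?case using h by (auto intro: genid.genid_0)
next
  case (genid_step a r g)
  have "a \<in> S" using ideal_in_carrier[OF genid_ideal[OF S]] genid_step by blast
  then have "h (a + r * g) = h a + h r * h g" using genid_step S h by auto
  then show ?case using genid_step by (auto intro: genid.genid_step)
qed

lemma noeth_image:
  assumes h: "\<And>a b. a \<in> S \<Longrightarrow> b \<in> S \<Longrightarrow> h (a + b) = h a + h b"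
     "\<And>a b. a \<in> S \<Longrightarrow> b \<in> S \<Longrightarrow> h (a * b) = h a * h b" "h 0 = 0"
    and S: "is_subring S" and N: "noeth S"
  shows "noeth (h ` S)"
  unfolding noeth_def
proof (intro allI impI)
  fix I assume I: "ideal_in (h ` S) I"
  define J where "J = {a \<in> S. h a \<in> I}"
  have "ideal_in S J"
    unfolding ideal_in_def J_def
    using S h ideal_in_zero[OF I] ideal_in_add[OF I] ideal_in_lmult[OF I] by auto
  then obtain G where G: "finite G" "G \<subseteq> J" "J \<subseteq> genid S G"
    by (rule noethE[OF N])
  have GS: "G \<subseteq> S" using G by (auto simp: J_def)
  have "I \<subseteq> genid (h ` S) (h ` G)"
  proof
    fix b assume b: "b \<in> I"
    then obtain a where a: "a \<in> S" "b = h a" using ideal_in_carrier[OF I] by blast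
    then have "a \<in> genid S G" using b G by (auto simp: J_def)
    then show "b \<in> genid (h ` S) (h ` G)" using genid_image[OF h S GS] a by blast
  qed
  then show "\<exists>G. finite G \<and> G \<subseteq> I \<and> I \<subseteq> genid (h ` S) G"
    using G by (intro exI[of _ "h ` G"]) (auto simp: J_def)
qed

section \<open>Generated subrings and transcendental elements\<close>

inductive_set rgen :: "'a::comm_ring_1 set \<Rightarrow> 'a set" for H where
  rgen_one: "1 \<in> rgen H"
| rgen_incl: "h \<in> H \<Longrightarrow> h \<in> rgen H"
| rgen_minus: "a \<in> rgen H \<Longrightarrow> - a \<in> rgen H"
| rgen_add: "a \<in> rgen H \<Longrightarrow> b \<in> rgen H \<Longrightarrow> a + b \<in> rgen H"
| rgen_mult: "a \<in> rgen H \<Longrightarrow> b \<in> rgen H \<Longrightarrow> a * b \<in> rgen H"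

lemma rgen_subring: "is_subring (rgen H)"
  by (rule is_subringI) (auto intro: rgen.intros)

lemma rgen_least: assumes "is_subring T" "H \<subseteq> T" shows "rgen H \<subseteq> T"
proof
  fix a assume "a \<in> rgen H" then show "a \<in> T"
    by induction (use assms in auto)
qed

lemma rgen_mono: "H \<subseteq> H' \<Longrightarrow> rgen H \<subseteq> rgen H'"
  by (intro rgen_least rgen_subring) (auto intro: rgen_incl)

lemma rgen_id: "is_subring S \<Longrightarrow> rgen S = S"
  using rgen_least[of S S] by (auto intro: rgen_incl)

lemma rgen_insert: "rgen (insert u H) = adj (rgen H) u"
proof
  show "rgen (insert u H) \<subseteq> adj (rgen H) u"
    using adj_base[OF rgen_subring, of H u]
    by (intro rgen_least adj_subring rgen_subring) (auto intro: adj_gen rgen_subring rgen_incl)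
  show "adj (rgen H) u \<subseteq> rgen (insert u H)"
    using rgen_mono[of H "insert u H"] by (intro adj_least rgen_subring) (auto intro: rgen_incl)
qed

lemma rgen_image:
  fixes h :: "'a::comm_ring_1 \<Rightarrow> 'b::comm_ring_1"
  assumes "\<And>a b. h (a + b) = h a + h b" "\<And>a b. h (a * b) = h a * h b" "\<And>a. h (- a) = - h a" "h 1 = 1"
  shows "h ` rgen H = rgen (h ` H)"
proof
  have "h a \<in> rgen (h ` H)" if "a \<in> rgen H" for a
    using that
  proof induction
    case (rgen_minus a) show ?case unfolding assms(3) by (rule rgen.rgen_minus[OF rgen_minus(2)])
  qed (auto simp: assms(1,2,4) intro: rgen.intros)
  then show "h ` rgen H \<subseteq> rgen (h ` H)" by blast
  have im: "h c \<in> h ` rgen H" if "c \<in> rgen H" for c using that by (rule imageI)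
  show "rgen (h ` H) \<subseteq> h ` rgen H"
  proof (rule rgen_least[OF is_subringI])
    show "1 \<in> h ` rgen H" using im[OF rgen_one] assms(4) by simp
    show "h ` H \<subseteq> h ` rgen H" by (auto intro: rgen_incl)
  next
    fix a b assume "a \<in> h ` rgen H" "b \<in> h ` rgen H"
    then obtain a' b' where ab: "a = h a'" "b = h b'" "a' \<in> rgen H" "b' \<in> rgen H" by blast
    show "a + b \<in> h ` rgen H" "a * b \<in> h ` rgen H"
      using im[OF rgen_add[OF ab(3,4)]] im[OF rgen_mult[OF ab(3,4)]] ab(1,2) assms(1,2) by simp_all
  next
    fix a assume "a \<in> h ` rgen H"
    then obtain a' where a: "a = h a'" "a' \<in> rgen H" by blast
    then show "- a \<in> h ` rgen H" using im[OF rgen_minus[OF a(2)]] assms(3) by simp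
  qed
qed

lemma noeth_field:
  assumes K: "is_subring K" and inv: "\<And>a. a \<in> K \<Longrightarrow> a \<noteq> 0 \<Longrightarrow> \<exists>b\<in>K. a * b = 1"
  shows "noeth K"
  unfolding noeth_def
proof (intro allI impI)
  fix I assume I: "ideal_in K I"
  show "\<exists>G. finite G \<and> G \<subseteq> I \<and> I \<subseteq> genid K G"
  proof (cases "I \<subseteq> {0}")
    case True
    then show ?thesis by (intro exI[of _ "{}"]) (auto intro: genid.genid_0)
  next
    case False
    then obtain a where a: "a \<in> I" "a \<noteq> 0" by blast
    then obtain b where b: "b \<in> K" "a * b = 1" using inv ideal_in_carrier[OF I] by blast
    have "I \<subseteq> genid K {a}"
    proof
      fix v assume "v \<in> I"
      then have "v * b \<in> K" using K b ideal_in_carrier[OF I] by blast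
      then have "0 + (v * b) * a \<in> genid K {a}" by (intro genid.intros) auto
      moreover have "0 + (v * b) * a = v * (a * b)" by (simp add: mult_ac)
      then have "0 + (v * b) * a = v" using b(2) by simp
      ultimately show "v \<in> genid K {a}" by simp
    qed
    then show ?thesis using a by (intro exI[of _ "{a}"]) auto
  qed
qed

lemma noeth_rgen:
  assumes "is_subring K" "noeth K" "finite G"
  shows "noeth (rgen (K \<union> G))"
  using assms(3)
proof (induction G)
  case empty
  then show ?case using assms(2) rgen_id[OF assms(1)] by simp
next
  case (insert u G)
  have "rgen (K \<union> insert u G) = adj (rgen (K \<union> G)) u" by (simp add: rgen_insert)
  then show ?case using noeth_adj[OF rgen_subring insert.IH] by simp
qed

definition transc :: "'a::comm_ring_1 set \<Rightarrow> 'a \<Rightarrow> bool" where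
  "transc S u \<longleftrightarrow> (\<forall>p. (\<forall>i. Polynomial.coeff p i \<in> S) \<longrightarrow> poly p u = 0 \<longrightarrow> p = 0)"

lemma transcD: "transc S u \<Longrightarrow> (\<And>i. Polynomial.coeff p i \<in> S) \<Longrightarrow> poly p u = 0 \<Longrightarrow> p = 0"
  unfolding transc_def by blast

lemma transc_mono: "transc T u \<Longrightarrow> S \<subseteq> T \<Longrightarrow> transc S u"
  unfolding transc_def by blast

lemma coeff_pcompose_closed:
  assumes S: "is_subring S" and q: "\<And>i. Polynomial.coeff q i \<in> S" and p: "\<And>i. Polynomial.coeff p i \<in> S"
  shows "Polynomial.coeff (pcompose p q) i \<in> S"
  using p
proof (induction p arbitrary: i)
  case 0 then show ?case using S by simp
next
  case (pCons a p)
  have "a \<in> S" using pCons.prems[of 0] by simp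
  moreover have "Polynomial.coeff p i \<in> S" for i using pCons.prems[of "Suc i"] by simp
  then have "Polynomial.coeff (q * pcompose p q) i \<in> S"
    using pCons.IH q by (intro coeff_mult_closed[OF S]) auto
  ultimately show ?case
    using S by (auto simp: pcompose_pCons coeff_pCons split: nat.split)
qed

lemma transc_poly:
  fixes u :: "'a::idom"
  assumes S: "is_subring S" and u: "transc S u" and q: "\<And>i. Polynomial.coeff q i \<in> S" "Polynomial.degree q > 0"
  shows "transc S (poly q u)"
  unfolding transc_def
proof (intro allI impI)
  fix p assume p: "\<forall>i. Polynomial.coeff p i \<in> S" "poly p (poly q u) = 0"
  have "pcompose p q = 0"
    using p by (intro transcD[OF u] coeff_pcompose_closed[OF S q(1)]) (auto simp: poly_pcompose)
  then show "p = 0" using pcompose_eq_0 q(2) by blast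
qed

text \<open>The fractions of elements of \<open>S\<close> that lie in the ambient ring. For \<open>S = k[x,\<alpha>,\<beta>]\<close> inside
  \<open>k[[x]]\<close> this is \<open>k(x,\<alpha>,\<beta>) \<inter> k[[x]]\<close>.\<close>

definition frac_set :: "'a::idom set \<Rightarrow> 'a set" where
  "frac_set S = {v. \<exists>q\<in>S. q \<noteq> 0 \<and> q * v \<in> S}"

lemma frac_set_base: "is_subring S \<Longrightarrow> S \<subseteq> frac_set S"
  unfolding frac_set_def by (auto intro!: bexI[of _ 1])

lemma frac_set_subring: assumes S: "is_subring S" shows "is_subring (frac_set S)"
proof (rule is_subringI)
  show "1 \<in> frac_set S" using frac_set_base[OF S] S by auto
next
  fix a b assume "a \<in> frac_set S" "b \<in> frac_set S"
  then obtain q r where *: "q \<in> S" "q \<noteq> 0" "q * a \<in> S" "r \<in> S" "r \<noteq> 0" "r * b \<in> S"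
    unfolding frac_set_def by blast
  have "(q * r) * (a + b) = r * (q * a) + q * (r * b)" "(q * r) * (a * b) = (q * a) * (r * b)"
    by (simp_all add: algebra_simps)
  moreover have "r * (q * a) + q * (r * b) \<in> S" "(q * a) * (r * b) \<in> S" using S * by auto
  ultimately have "(q * r) * (a + b) \<in> S" "(q * r) * (a * b) \<in> S" by (simp_all only:)
  moreover have "q * r \<in> S" "q * r \<noteq> 0" using S * by auto
  ultimately show "a + b \<in> frac_set S" "a * b \<in> frac_set S"
    unfolding frac_set_def by blast+
next
  fix a assume "a \<in> frac_set S"
  then show "- a \<in> frac_set S" using S unfolding frac_set_def by auto
qed

lemma common_denominator:
  assumes S: "is_subring S" and "finite A" "A \<subseteq> frac_set S"
  shows "\<exists>q\<in>S. q \<noteq> 0 \<and> (\<forall>v\<in>A. q * v \<in> S)"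
  using assms(2,3)
proof (induction A)
  case empty
  then show ?case using S by (auto intro!: bexI[of _ 1])
next
  case (insert a A)
  then obtain q r where *: "q \<in> S" "q \<noteq> 0" "\<forall>v\<in>A. q * v \<in> S" "r \<in> S" "r \<noteq> 0" "r * a \<in> S"
    unfolding frac_set_def by blast
  have "q * r * v \<in> S" if "v \<in> insert a A" for v
  proof (cases "v = a")
    case True
    then show ?thesis using * S by (simp add: mult.assoc)
  next
    case False
    then have "r * (q * v) \<in> S" using * S that by auto
    then show ?thesis by (simp add: mult_ac)
  qed
  then show ?case using * S by (intro bexI[of _ "q * r"]) auto
qed

lemma transc_frac_set:
  assumes S: "is_subring S" and u: "transc S u" shows "transc (frac_set S) u"
  unfolding transc_def
proof (intro allI impI)
  fix p assume p: "\<forall>i. Polynomial.coeff p i \<in> frac_set S" "poly p u = 0"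
  obtain q where q: "q \<in> S" "q \<noteq> 0" "\<forall>v\<in>Polynomial.coeff p ` {..Polynomial.degree p}. q * v \<in> S"
    using common_denominator[OF S, of "Polynomial.coeff p ` {..Polynomial.degree p}"] p by auto
  have "Polynomial.coeff (Polynomial.smult q p) i \<in> S" for i
    using q(3) S by (cases "i \<le> Polynomial.degree p") (auto simp: coeff_eq_0)
  then have "Polynomial.smult q p = 0" using p by (intro transcD[OF u]) auto
  then show "p = 0" using q by simp
qed

lemma transc_image:
  assumes h: "\<And>a b. h (a + b) = h a + h b" "\<And>a b. h (a * b) = h a * h b" "h 1 = 1" "h 0 = 0" "inj h"
    and u: "transc S u" and S: "is_subring S"
  shows "transc (h ` S) (h u)"
  unfolding transc_def
proof (intro allI impI)
  fix p assume p: "\<forall>i. Polynomial.coeff p i \<in> h ` S" "poly p (h u) = 0"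
  define c where "c = (\<lambda>i. inv_into UNIV h (Polynomial.coeff p i))"
  have c: "c i \<in> S" "h (c i) = Polynomial.coeff p i" for i
    using p(1) inv_into_f_f[OF h(5)] unfolding c_def by (metis imageE UNIV_I)+
  have hp: "h (a ^ n) = h a ^ n" for a n by (induction n) (auto simp: h)
  have hs: "h (sum f K) = (\<Sum>i\<in>K. h (f i))" for f and K :: "nat set"
    by (induction K rule: infinite_finite_induct) (auto simp: h)
  define q where "q = (\<Sum>i\<le>Polynomial.degree p. Polynomial.monom (c i) i)"
  have cq: "Polynomial.coeff q i = (if i \<le> Polynomial.degree p then c i else 0)" for i
    by (simp add: q_def coeff_sum)
  have "poly q u = (\<Sum>i\<le>Polynomial.degree p. c i * u ^ i)" by (simp add: q_def poly_sum poly_monom)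
  then have "h (poly q u) = poly p (h u)"
    by (simp add: hs hp h c(2) poly_altdef[of p])
  then have "poly q u = 0" using p(2) h(4,5) by (metis injD)
  moreover have "Polynomial.coeff q i \<in> S" for i using cq c(1) S by auto
  ultimately have "q = 0" using transcD[OF u] by blast
  then have "c i = 0" if "i \<le> Polynomial.degree p" for i using cq[of i] that by simp
  then have "Polynomial.coeff p i = 0" for i
    using c(2)[of i] h(4) by (cases "i \<le> Polynomial.degree p") (auto simp: coeff_eq_0)
  then show "p = 0" by (simp add: poly_eq_iff)
qed

text \<open>The map \<open>p(u) \<mapsto> p(c)\<close> is well defined, because \<open>u\<close> is transcendental.\<close>

lemma transc_evaluation:
  assumes S: "is_subring S" and u: "transc S u" and c: "c \<in> S"
  obtains h where "\<And>a b. a \<in> adj S u \<Longrightarrow> b \<in> adj S u \<Longrightarrow> h (a + b) = h a + h b"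
    "\<And>a b. a \<in> adj S u \<Longrightarrow> b \<in> adj S u \<Longrightarrow> h (a * b) = h a * h b"
    "\<And>p. (\<And>i. Polynomial.coeff p i \<in> S) \<Longrightarrow> h (poly p u) = poly p c"
proof -
  define r where "r = (\<lambda>a. SOME p. (\<forall>i. Polynomial.coeff p i \<in> S) \<and> a = poly p u)"
  define h where "h = (\<lambda>a. poly (r a) c)"
  have uniq: "p = q" if "\<And>i. Polynomial.coeff p i \<in> S" "\<And>i. Polynomial.coeff q i \<in> S" "poly p u = poly q u" for p q
  proof -
    have "p - q = 0" by (rule transcD[OF u]) (use that S in auto)
    then show ?thesis by simp
  qed
  have h: "h (poly p u) = poly p c" if p: "\<And>i. Polynomial.coeff p i \<in> S" for p
  proof -
    have "(\<forall>i. Polynomial.coeff (r (poly p u)) i \<in> S) \<and> poly p u = poly (r (poly p u)) u"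
      unfolding r_def by (rule someI[of _ p]) (use p in auto)
    then have "r (poly p u) = p" using p by (intro uniq) auto
    then show ?thesis by (simp add: h_def)
  qed
  show ?thesis
  proof (rule that)
    show "h (poly p u) = poly p c" if "\<And>i. Polynomial.coeff p i \<in> S" for p using h that by blast
    fix a b assume "a \<in> adj S u" "b \<in> adj S u"
    then obtain p q where pq: "a = poly p u" "b = poly q u" "\<And>i. Polynomial.coeff p i \<in> S"
      "\<And>i. Polynomial.coeff q i \<in> S" unfolding adj_def by blast
    show "h (a + b) = h a + h b"
      using h[OF pq(3)] h[OF pq(4)] h[of "p + q"] pq S by simp
    show "h (a * b) = h a * h b"
      using h[OF pq(3)] h[OF pq(4)] h[of "p * q"] coeff_mult_closed[OF S, of p q] pq by simp
  qed
qed

text \<open>The preimages of the primes \<open>p j\<close> under the evaluation \<open>u \<mapsto> c\<close> form a chain of \<open>S[u]\<close>, and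
  the zero ideal can be added at the bottom because \<open>u - c\<close> is a nonzero element of all of them.
  The homomorphism \<open>e\<close> identifies the top of the chain, so that the step can be iterated along a
  tower.\<close>

lemma transc_prime_chain:
  fixes u :: "'a::idom" and e :: "'a \<Rightarrow> 'b::comm_ring_1"
  assumes S: "is_subring S" and u: "transc S u" and c: "c \<in> S"
    and e: "\<And>a b. e (a + b) = e a + e b" "\<And>a b. e (a * b) = e a * e b" "e 1 = 1" "e 0 = 0" "e u = e c"
    and p: "prime_chain_in S n p" "p n = {a \<in> S. e a = 0}"
  shows "\<exists>q. prime_chain_in (adj S u) (Suc n) q \<and> q (Suc n) = {a \<in> adj S u. e a = 0}"
proof -
  obtain h where h: "\<And>a b. a \<in> adj S u \<Longrightarrow> b \<in> adj S u \<Longrightarrow> h (a + b) = h a + h b"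
    "\<And>a b. a \<in> adj S u \<Longrightarrow> b \<in> adj S u \<Longrightarrow> h (a * b) = h a * h b"
    and hp: "\<And>p. (\<And>i. Polynomial.coeff p i \<in> S) \<Longrightarrow> h (poly p u) = poly p c"
    by (rule transc_evaluation[OF S u c]) blast
  have R: "is_subring (adj S u)" by (rule adj_subring[OF S])
  have hid: "h a = a" if "a \<in> S" for a
    using hp[of "[:a:]"] that S by (simp add: coeff_pCons split: nat.split)
  have hu: "h (u - c) = 0"
    using hp[of "[:- c, 1:]"] S c by (simp add: coeff_pCons split: nat.split)
  have hS: "h a \<in> S" if "a \<in> adj S u" for a
    using that hp S c unfolding adj_def by (auto intro!: poly_in_subring)
  have epow: "e (a ^ k) = e a ^ k" for a k by (induction k) (auto simp: e)
  have esum: "e (sum f K) = (\<Sum>i\<in>K. e (f i))" for f and K :: "nat set"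
    by (induction K rule: infinite_finite_induct) (auto simp: e)
  have eh: "e (h a) = e a" if a: "a \<in> adj S u" for a
  proof -
    obtain p where p: "a = poly p u" "\<And>i. Polynomial.coeff p i \<in> S" using a unfolding adj_def by blast
    have "e (poly p c) = e (poly p u)" by (simp add: poly_altdef esum e epow)
    then show ?thesis using hp p by simp
  qed
  define q where "q = (\<lambda>i. case i of 0 \<Rightarrow> {0} | Suc j \<Rightarrow> {a \<in> adj S u. h a \<in> p j})"
  have zero: "0 \<in> p j" if "j \<le> n" for j
    using p(1) that ideal_in_zero[OF prime_in_ideal] unfolding prime_chain_in_def by blast
  have "prime_chain_in (adj S u) (Suc n) q"
    unfolding prime_chain_in_def
  proof (intro conjI allI impI)
    fix i assume i: "i \<le> Suc n"
    show "prime_in (adj S u) (q i)"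
    proof (cases i)
      case 0
      then show ?thesis using R by (auto simp: q_def prime_in_def ideal_in_def)
    next
      case (Suc j)
      then have "prime_in S (p j)" using p(1) i by (auto simp: prime_chain_in_def)
      then have "prime_in (adj S u) {a \<in> adj S u. h a \<in> p j}"
        by (rule prime_in_vimage[OF R h, rotated -1]) (use hid hS S in auto)
      then show ?thesis by (simp add: q_def Suc)
    qed
  next
    fix i assume i: "i < Suc n"
    show "q i \<subset> q (Suc i)"
    proof (cases i)
      case 0
      have "u - c \<in> q (Suc 0)" using hu zero[of 0] adj_gen[OF S, of u] adj_base[OF S, of u] c R by (auto simp: q_def)
      moreover have "u - c \<noteq> 0"
      proof
        assume "u - c = 0"
        then have "[:- c, 1:] = (0 :: 'a poly)"
          by (intro transcD[OF u]) (use S c in \<open>auto simp: coeff_pCons split: nat.split\<close>)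
        then show False by simp
      qed
      moreover have "0 \<in> q (Suc 0)" using zero[of 0] hid[of 0] S R by (auto simp: q_def)
      ultimately have "{0} \<subset> q (Suc 0)" by blast
      moreover have "q 0 = {0}" by (simp add: q_def)
      ultimately show ?thesis using 0 by simp
    next
      case (Suc j)
      then have "p j \<subset> p (Suc j)" using p(1) i by (auto simp: prime_chain_in_def)
      then obtain a where a: "a \<in> p (Suc j)" "a \<notin> p j" "p j \<subseteq> p (Suc j)" by blast
      have "a \<in> S" using p(1) i Suc a ideal_in_carrier[OF prime_in_ideal] unfolding prime_chain_in_def
        by (metis less_Suc_eq_le Suc_leI)
      then have "a \<in> q (Suc i)" "a \<notin> q i" using a hid adj_base[OF S, of u] by (auto simp: q_def Suc)
      moreover have "q i \<subseteq> q (Suc i)" using a(3) by (auto simp: q_def Suc)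
      ultimately show ?thesis by blast
    qed
  qed
  moreover have "q (Suc n) = {a \<in> adj S u. e a = 0}"
    using p(2) hS eh by (auto simp: q_def)
  ultimately show ?thesis by blast
qed

section \<open>A Noetherian criterion\<close>

text \<open>The increasing sequence of the ideals \<open>(J : x\<^sup>n)\<close> is stationary.\<close>

lemma colon_stabilizes:
  assumes S: "is_subring S" and N: "noeth S" and J: "ideal_in S J" and x: "x \<in> S"
  shows "\<exists>c. \<forall>n. \<forall>a\<in>S. x ^ n * a \<in> J \<longrightarrow> x ^ c * a \<in> J"
proof -
  let ?C = "\<lambda>n. colon S J (x ^ n)"
  let ?P = "\<lambda>I. \<exists>n. I = ?C n"
  have id: "ideal_in S (?C n)" for n using S x by (intro colon_ideal J) auto
  obtain M where M: "?P M" and max: "\<And>I. ?P I \<Longrightarrow> M \<subseteq> I \<Longrightarrow> I = M"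
    by (rule noeth_maximalE[OF N, of ?P "?C 0"]) (use id in blast)+
  then obtain c where c: "M = ?C c" by blast
  have mono: "?C i \<subseteq> ?C j" if "i \<le> j" for i j
  proof
    fix a assume a: "a \<in> ?C i"
    have "x ^ (j - i) * (a * x ^ i) \<in> J" using a S x ideal_in_lmult[OF J, of "x ^ (j - i)" "a * x ^ i"] by (simp add: colon_def)
    moreover have "x ^ (j - i) * (a * x ^ i) = a * x ^ j"
      using that by (metis le_add_diff_inverse2 mult.left_commute power_add)
    ultimately show "a \<in> ?C j" using a by (simp add: colon_def)
  qed
  have "x ^ c * a \<in> J" if a: "a \<in> S" "x ^ n * a \<in> J" for n a
  proof -
    have "a \<in> ?C (max n c)" using a mono[of n "max n c"] by (auto simp: colon_def mult.commute)
    moreover have "?C (max n c) = M" using mono[of c "max n c"] c by (intro max) auto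
    ultimately have "a \<in> ?C c" using c by blast
    then show ?thesis by (simp add: colon_def mult.commute)
  qed
  then show ?thesis by blast
qed

text \<open>Conditions under which \<open>S\<close> is Noetherian: the ideals of \<open>S/xS\<close> and of \<open>S[1/x]\<close> are finitely
  generated (\<open>modx\<close>, \<open>locx\<close>), and relations over a ring \<open>T\<close>, which contains the limits of the
  \<open>x\<close>-adic series over \<open>S\<close>, are approximated by relations over \<open>S\<close> (\<open>approx\<close>). The last condition
  replaces the flatness of \<open>T\<close> over \<open>S\<close>.\<close>

locale completion_criterion =
  fixes S T :: "'a::idom set" and x :: 'a
  assumes S: "is_subring S" and T: "is_subring T" and ST: "S \<subseteq> T" and xS: "x \<in> S" and x0: "x \<noteq> 0"
    and sep: "\<And>a. (\<And>n. x ^ n dvd a) \<Longrightarrow> a = 0"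
    and div: "\<And>b. x * b \<in> S \<Longrightarrow> b \<in> S"
    and lim: "\<And>c :: nat \<Rightarrow> 'a. (\<And>j. c j \<in> S) \<Longrightarrow> \<exists>t\<in>T. \<forall>n. x ^ n dvd t - (\<Sum>j<n. c j * x ^ j)"
    and approx: "\<And>G a m. finite G \<Longrightarrow> G \<subseteq> S \<Longrightarrow> (\<And>g. g \<in> G \<Longrightarrow> a g \<in> T) \<Longrightarrow> (\<Sum>g\<in>G. a g * g) = 0 \<Longrightarrow>
       \<exists>s. (\<forall>g\<in>G. s g \<in> S \<and> x ^ m dvd a g - s g) \<and> (\<Sum>g\<in>G. s g * g) = 0"
    and modx: "\<And>I. ideal_in S I \<Longrightarrow> \<exists>G. finite G \<and> G \<subseteq> I \<and> (\<forall>a\<in>I. \<exists>u\<in>genid S G. \<exists>b. a = u + x * b)"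
    and locx: "\<And>I. ideal_in S I \<Longrightarrow> \<exists>G. finite G \<and> G \<subseteq> I \<and> (\<forall>a\<in>I. \<exists>n. x ^ n * a \<in> genid S G)"
begin

lemma div_power: "x ^ n * b \<in> S \<Longrightarrow> b \<in> S"
  by (induction n) (auto simp: mult.assoc dest: div)

text \<open>Generators of \<open>I\<close> modulo \<open>x\<close> together with generators of \<open>I\<close> after inverting \<open>x\<close> generate
  \<open>I\<close> if \<open>x\<close> is cancellable modulo \<open>I\<close>. Expanding \<open>q\<close> from \<open>I\<close> in powers of \<open>x\<close> yields
  \<open>q = \<Sum> t g \<cdot> g\<close> with \<open>t g\<close> in \<open>T\<close>, while \<open>x\<^sup>N q = \<Sum> b g \<cdot> g\<close> with \<open>b g\<close> in \<open>S\<close> for some \<open>N\<close>. The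
  difference of \<open>x\<^sup>N\<close> times the first equation and the second is a relation over \<open>T\<close>; if \<open>s\<close> is a
  relation over \<open>S\<close> congruent to it modulo \<open>x\<^sup>N\<close>, then \<open>x\<^sup>N\<close> divides every \<open>b g + s g\<close>.\<close>

lemma saturated_fg:
  assumes I: "ideal_in S I" and sat: "\<And>b. x * b \<in> I \<Longrightarrow> b \<in> I"
  shows "\<exists>G. finite G \<and> G \<subseteq> I \<and> I \<subseteq> genid S G"
proof -
  obtain G1 where G1: "finite G1" "G1 \<subseteq> I" "\<forall>a\<in>I. \<exists>u\<in>genid S G1. \<exists>b. a = u + x * b"
    using modx[OF I] by blast
  obtain G2 where G2: "finite G2" "G2 \<subseteq> I" "\<forall>a\<in>I. \<exists>n. x ^ n * a \<in> genid S G2"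
    using locx[OF I] by blast
  define G where "G = G1 \<union> G2"
  have G: "finite G" "G \<subseteq> I" "G \<subseteq> S" using G1 G2 ideal_in_subset[OF I] by (auto simp: G_def)
  have gI: "genid S G \<subseteq> I" by (rule genid_least[OF I G(2)])
  have "\<forall>a\<in>I. \<exists>c b. (\<forall>g. c g \<in> S) \<and> b \<in> I \<and> a = (\<Sum>g\<in>G. c g * g) + x * b"
  proof
    fix a assume a: "a \<in> I"
    obtain u b where ub: "u \<in> genid S G1" "a = u + x * b" using G1(3) a by blast
    have u: "u \<in> genid S G" using ub(1) genid_mono[of S S G1 G] by (auto simp: G_def)
    obtain c where c: "\<forall>g. c g \<in> S" "u = (\<Sum>g\<in>G. c g * g)" using genidD[OF S G(1) u] by blast
    have "x * b = a - u" using ub(2) by simp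
    then have "x * b \<in> I" using ideal_in_diff[OF I S a, of u] u gI by auto
    then have "b \<in> I" by (rule sat)
    then show "\<exists>c b. (\<forall>g. c g \<in> S) \<and> b \<in> I \<and> a = (\<Sum>g\<in>G. c g * g) + x * b" using c ub(2) by blast
  qed
  then obtain C B where CB: "\<And>a g. a \<in> I \<Longrightarrow> C a g \<in> S" "\<And>a. a \<in> I \<Longrightarrow> B a \<in> I"
    "\<And>a. a \<in> I \<Longrightarrow> a = (\<Sum>g\<in>G. C a g * g) + x * B a" by metis
  have "q \<in> genid S G" if q: "q \<in> I" for q
  proof -
    \<comment> \<open>the remainders of the \<open>x\<close>-adic expansion \<open>q = \<Sum> C (Q j) g \<cdot> x\<^sup>j \<cdot> g + x\<^sup>n Q n\<close>\<close>
    define Q where "Q = (\<lambda>n. (B ^^ n) q)"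
    have QI: "Q n \<in> I" for n by (induction n) (use q CB(2) in \<open>auto simp: Q_def\<close>)
    have QS: "Q n = (\<Sum>g\<in>G. C (Q n) g * g) + x * Q (Suc n)" for n using CB(3)[OF QI[of n]] by (simp add: Q_def)
    have exp: "q = (\<Sum>g\<in>G. (\<Sum>j<n. C (Q j) g * x ^ j) * g) + x ^ n * Q n" for n
    proof (induction n)
      case (Suc n)
      have "x ^ n * Q n = (\<Sum>g\<in>G. C (Q n) g * x ^ n * g) + x ^ Suc n * Q (Suc n)"
        by (subst QS) (simp add: algebra_simps sum_distrib_left)
      then show ?case using Suc by (simp add: distrib_right sum.distrib)
    qed (simp add: Q_def)
    have "\<forall>g. \<exists>t\<in>T. \<forall>n. x ^ n dvd t - (\<Sum>j<n. C (Q j) g * x ^ j)"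
      using CB(1)[OF QI] by (intro allI lim) auto
    then obtain t where t: "\<And>g. t g \<in> T" "\<And>g n. x ^ n dvd t g - (\<Sum>j<n. C (Q j) g * x ^ j)" by metis
    have "q - (\<Sum>g\<in>G. t g * g) = 0"
    proof (rule sep)
      fix n
      have "q - (\<Sum>g\<in>G. t g * g) = x ^ n * Q n - (\<Sum>g\<in>G. (t g - (\<Sum>j<n. C (Q j) g * x ^ j)) * g)"
        by (subst exp[of n]) (simp add: left_diff_distrib sum_subtractf)
      also have "x ^ n dvd \<dots>" by (intro dvd_diff[OF dvd_triv_left] dvd_sum dvd_mult2 t(2))
      finally show "x ^ n dvd q - (\<Sum>g\<in>G. t g * g)" .
    qed
    then have qt: "q = (\<Sum>g\<in>G. t g * g)" by simp
    obtain N where "x ^ N * q \<in> genid S G2" using G2(3) q by blast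
    then have "x ^ N * q \<in> genid S G" using genid_mono[of S S G2 G] by (auto simp: G_def)
    then obtain b where b: "\<And>g. b g \<in> S" "x ^ N * q = (\<Sum>g\<in>G. b g * g)" using genidD[OF S G(1)] by blast
    have "(\<Sum>g\<in>G. (x ^ N * t g - b g) * g) = 0"
      using b(2) qt by (simp add: left_diff_distrib sum_subtractf sum_distrib_left mult.assoc)
    moreover have "x ^ N * t g - b g \<in> T" for g
      using t(1)[of g] b(1)[of g] ST xS T by auto
    ultimately obtain s where s: "\<And>g. g \<in> G \<Longrightarrow> s g \<in> S" "\<And>g. g \<in> G \<Longrightarrow> x ^ N dvd (x ^ N * t g - b g) - s g"
       "(\<Sum>g\<in>G. s g * g) = 0"
      using approx[OF G(1,3), of "\<lambda>g. x ^ N * t g - b g" N] by blast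
    have "\<exists>e. e \<in> S \<and> b g + s g = x ^ N * e" if g: "g \<in> G" for g
    proof -
      have "x ^ N dvd x ^ N * t g - ((x ^ N * t g - b g) - s g)" by (rule dvd_diff[OF dvd_triv_left s(2)[OF g]])
      then obtain e where e: "b g + s g = x ^ N * e" by (auto simp: dvd_def)
      have "b g + s g \<in> S" using b(1) s(1)[OF g] S by auto
      then have "e \<in> S" using div_power e by metis
      then show ?thesis using e by blast
    qed
    then obtain e where e: "\<And>g. g \<in> G \<Longrightarrow> e g \<in> S" "\<And>g. g \<in> G \<Longrightarrow> b g + s g = x ^ N * e g" by metis
    have "x ^ N * q = (\<Sum>g\<in>G. (b g + s g) * g)" using b(2) s(3) by (simp add: distrib_right sum.distrib)
    also have "\<dots> = x ^ N * (\<Sum>g\<in>G. e g * g)" using e(2) by (simp add: sum_distrib_left mult.assoc)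
    finally have "q = (\<Sum>g\<in>G. e g * g)" using x0 by simp
    then show ?thesis using genid_sumI[OF S G(3), of G e "\<lambda>g. g"] e(1) by simp
  qed
  then show ?thesis using G by blast
qed

text \<open>The union of the ideals \<open>J n = (I : x\<^sup>n)\<close> is finitely generated by the previous lemma, hence
  generated by elements of some \<open>J N\<close>. Finite generation then passes from \<open>J (n + 1)\<close> to \<open>J n\<close>,
  which is generated by generators modulo \<open>x\<close> and by \<open>x J (n + 1)\<close>.\<close>

theorem noeth_S: "noeth S"
  unfolding noeth_def
proof (intro allI impI)
  fix I assume I: "ideal_in S I"
  define J where "J = (\<lambda>n. colon S I (x ^ n))"
  have J: "ideal_in S (J n)" for n unfolding J_def using S xS by (intro colon_ideal I) auto
  have JS: "b \<in> J (Suc n) \<longleftrightarrow> x * b \<in> J n" for b n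
    using div[of b] S xS by (auto simp: J_def colon_def mult_ac)
  have Jm: "J m \<subseteq> J n" if "m \<le> n" for m n
  proof -
    have "J k \<subseteq> J (Suc k)" for k using JS ideal_in_lmult[OF J xS] by blast
    then show ?thesis using lift_Suc_mono_le[of J] that by blast
  qed
  have U: "ideal_in S (\<Union>n. J n)"
    unfolding ideal_in_def
  proof (intro conjI ballI)
    show "(\<Union>n. J n) \<subseteq> S" using ideal_in_subset[OF J] by blast
    show "0 \<in> (\<Union>n. J n)" using ideal_in_zero[OF J] by blast
    show "r * a \<in> (\<Union>n. J n)" if "r \<in> S" "a \<in> (\<Union>n. J n)" for r a using that ideal_in_lmult[OF J] by blast
    fix a b assume "a \<in> (\<Union>n. J n)" "b \<in> (\<Union>n. J n)"
    then obtain m n where "a \<in> J m" "b \<in> J n" by blast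
    then have "a \<in> J (max m n)" "b \<in> J (max m n)" using Jm[of m "max m n"] Jm[of n "max m n"] by auto
    then show "a + b \<in> (\<Union>n. J n)" using ideal_in_add[OF J] by blast
  qed
  obtain G where G: "finite G" "G \<subseteq> (\<Union>n. J n)" "(\<Union>n. J n) \<subseteq> genid S G"
    using saturated_fg[OF U] JS by blast
  have "\<exists>N. G \<subseteq> J N" using G(1,2)
  proof (induction G)
    case (insert g G)
    then obtain m n where "g \<in> J m" "G \<subseteq> J n" by auto
    then have "insert g G \<subseteq> J (max m n)"
      using Jm[of m "max m n"] Jm[of n "max m n"] by auto
    then show ?case by blast
  qed auto
  then obtain N where N: "G \<subseteq> J N" by blast
  have "\<exists>H. finite H \<and> H \<subseteq> J n \<and> J n \<subseteq> genid S H" if "n \<le> N" for n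
    using that
  proof (induction rule: inc_induct)
    case base
    then show ?case using G N by blast
  next
    case (step n)
    then obtain H where H: "finite H" "H \<subseteq> J (Suc n)" "J (Suc n) \<subseteq> genid S H" by blast
    obtain G' where G': "finite G'" "G' \<subseteq> J n" "\<forall>a\<in>J n. \<exists>u\<in>genid S G'. \<exists>b. a = u + x * b"
      using modx[OF J[of n]] by blast
    define K where "K = G' \<union> (\<lambda>h. x * h) ` H"
    have xH: "(\<lambda>h. x * h) ` H \<subseteq> J n" using H(2) JS by blast
    have K: "finite K" "K \<subseteq> J n" using H(1) G' xH by (auto simp: K_def)
    have Ki: "ideal_in S (genid S K)" using K(2) ideal_in_subset[OF J] by (intro genid_ideal S) blast
    have "J n \<subseteq> genid S K"
    proof
      fix a assume a: "a \<in> J n"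
      obtain u b where ub: "u \<in> genid S G'" "a = u + x * b" using G'(3) a by blast
      have u: "u \<in> genid S K" "u \<in> J n"
        using ub(1) genid_mono[of S S G' K] genid_least[OF J G'(2)] by (auto simp: K_def)
      have "x * b = a - u" using ub(2) by simp
      then have "x * b \<in> J n" using ideal_in_diff[OF J S a u(2)] by simp
      then have b: "b \<in> genid S H" using JS H(3) by blast
      obtain c where c: "\<And>h. c h \<in> S" "b = (\<Sum>h\<in>H. c h * h)" using genidD[OF S H(1) b] by blast
      have "x * b = (\<Sum>h\<in>H. c h * (x * h))" using c(2) by (simp add: sum_distrib_left mult.left_commute)
      also have "\<dots> \<in> genid S K"
      proof (rule genid_sumI[OF S])
        show "K \<subseteq> S" using K(2) ideal_in_subset[OF J] by blast
      qed (use c(1) in \<open>auto simp: K_def\<close>)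
      finally show "a \<in> genid S K" using ub(2) u(1) ideal_in_add[OF Ki] by simp
    qed
    then show ?case using K by blast
  qed
  then have "\<exists>H. finite H \<and> H \<subseteq> J 0 \<and> J 0 \<subseteq> genid S H" by blast
  moreover have "J 0 = I" using ideal_in_subset[OF I] by (auto simp: J_def colon_def)
  ultimately show "\<exists>G. finite G \<and> G \<subseteq> I \<and> I \<subseteq> genid S G" by simp
qed

end

section \<open>The power series ring\<close>

abbreviation co :: "'k::field pser \<Rightarrow> nat \<Rightarrow> nat \<Rightarrow> nat \<Rightarrow> 'k" where
  "co F n a b \<equiv> fps_nth (fps_nth (fps_nth F n) a) b"

definition cc :: "'k::field pser \<Rightarrow> 'k" where "cc F = co F 0 0 0"

text \<open>The coefficient of \<open>y\<^sup>a z\<^sup>b\<close>, a power series in \<open>x\<close>. The representation of \<open>k[[x,y,z]]\<close> has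
  \<open>x\<close> as its outermost variable, but most of the rings below are polynomial rings in \<open>y\<close> and \<open>z\<close>
  over a ring of power series in \<open>x\<close>.\<close>

definition lam :: "nat \<Rightarrow> nat \<Rightarrow> 'k::field pser \<Rightarrow> 'k fps" where
  "lam a b F = Abs_fps (\<lambda>n. co F n a b)"

lemma pser_eqI: "(\<And>n a b. co F n a b = co G n a b) \<Longrightarrow> F = G"
  by (simp add: fps_eq_iff)

lemma cc_simps [simp]:
  "cc (F + G) = cc F + cc G" "cc (F - G) = cc F - cc G" "cc (- F) = - cc F" "cc (F * G) = cc F * cc G"
  "cc 0 = 0" "cc 1 = 1" "cc Xs = 0" "cc Ys = 0" "cc Zs = 0"
  by (simp_all add: cc_def Xs_def Ys_def Zs_def fps_mult_nth)

lemma pser_unit: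
  assumes "cc F \<noteq> 0" obtains G where "F * G = 1"
proof -
  let ?c = "fps_nth F 0"
  have "fps_nth (fps_nth ?c 0) 0 \<noteq> 0" using assms by (simp add: cc_def)
  then have "fps_nth ?c 0 * inverse (fps_nth ?c 0) = 1"
    by (metis inverse_mult_eq_1')
  then have "?c * fps_right_inverse ?c (inverse (fps_nth ?c 0)) = 1" by (rule fps_right_inverse)
  then show ?thesis using fps_right_inverse that by blast
qed

lemma lam_simps [simp]:
  "lam a b (F + G) = lam a b F + lam a b G" "lam a b (F - G) = lam a b F - lam a b G"
  "lam a b (- F) = - lam a b F" "lam a b 0 = 0"
  by (simp_all add: lam_def fps_eq_iff)

lemma lam_sum: "lam a b (sum f K) = (\<Sum>i\<in>K. lam a b (f i))"
  by (induction K rule: infinite_finite_induct) auto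

lemma lam_eqI: "(\<And>a b. lam a b F = lam a b G) \<Longrightarrow> F = G"
  by (rule pser_eqI) (simp add: lam_def fps_eq_iff)

lemma lam_mult: "lam a b (F * G) = (\<Sum>i=0..a. \<Sum>j=0..b. lam i j F * lam (a - i) (b - j) G)"
proof (rule fps_ext)
  fix n
  have "fps_nth (lam a b (F * G)) n = (\<Sum>k=0..n. \<Sum>i=0..a. \<Sum>j=0..b. co F k i j * co G (n - k) (a - i) (b - j))"
    by (simp add: lam_def fps_mult_nth fps_sum_nth)
  also have "\<dots> = (\<Sum>i=0..a. \<Sum>j=0..b. \<Sum>k=0..n. co F k i j * co G (n - k) (a - i) (b - j))"
    by (subst sum.swap) (intro sum.cong refl sum.swap)
  also have "\<dots> = fps_nth (\<Sum>i=0..a. \<Sum>j=0..b. lam i j F * lam (a - i) (b - j) G) n"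
    by (simp add: lam_def fps_mult_nth fps_sum_nth)
  finally show "fps_nth (lam a b (F * G)) n = \<dots>" .
qed

lemma lam_fps_const: "lam a b (fps_const G) = fps_const (fps_nth (fps_nth G a) b)"
  by (rule fps_ext) (simp add: lam_def)

lemma co_in_x: "co (in_x v) n a b = (if a = 0 \<and> b = 0 then fps_nth v n else 0)"
  by (simp add: in_x_def)

lemma lam_in_x: "lam a b (in_x v) = (if a = 0 \<and> b = 0 then v else 0)"
  by (auto simp: lam_def co_in_x fps_eq_iff)

lemma lam_in_x_mult [simp]: "lam a b (in_x v * F) = v * lam a b F"
proof (rule fps_ext)
  fix n
  have "fps_nth (in_x v * F) n = (\<Sum>k=0..n. fps_const (fps_const (fps_nth v k)) * fps_nth F (n - k))"
    unfolding fps_mult_nth[of "in_x v" F] by (simp add: in_x_def)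
  then show "fps_nth (lam a b (in_x v * F)) n = fps_nth (v * lam a b F) n"
    by (simp add: lam_def fps_sum_nth fps_mult_nth[of v])
qed

lemma in_x_add: "in_x (v + w) = in_x v + in_x w"
  and in_x_diff: "in_x (v - w) = in_x v - in_x w"
  and in_x_minus: "in_x (- v) = - in_x v"
  and in_x_mult: "in_x (v * w) = in_x v * in_x w"
  and in_x_0: "in_x 0 = 0" and in_x_1: "in_x 1 = 1" and in_x_X: "in_x fps_X = Xs"
proof -
  show "in_x (v + w) = in_x v + in_x w" by (rule lam_eqI) (simp add: lam_in_x)
  show "in_x (v - w) = in_x v - in_x w" by (rule lam_eqI) (simp add: lam_in_x)
  show "in_x (- v) = - in_x v" by (rule lam_eqI) (simp add: lam_in_x)
  show "in_x (v * w) = in_x v * in_x w" by (rule lam_eqI) (simp add: lam_in_x)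
  show "in_x 0 = 0" by (rule lam_eqI) (simp add: lam_in_x)
  show "in_x 1 = 1" by (rule pser_eqI) (simp add: co_in_x)
  show "in_x fps_X = Xs" by (rule pser_eqI) (simp add: co_in_x Xs_def)
qed

lemma in_x_inj: "in_x v = in_x w \<Longrightarrow> v = w"
  by (drule arg_cong[of _ _ "lam 0 0"]) (simp add: lam_in_x)

lemma in_x_power: "in_x (v ^ n) = in_x v ^ n"
  by (induction n) (auto simp: in_x_mult in_x_1)

lemma in_x_const: "in_x (fps_const c) = fps_const (fps_const (fps_const c))"
  by (rule pser_eqI) (simp add: co_in_x)

lemma lam_Xs_mult [simp]: "lam a b (Xs * F) = fps_X * lam a b F"
  using lam_in_x_mult[of a b fps_X F] by (simp add: in_x_X)

lemma lam_monomial: "lam a b (in_x v * (Ys ^ i * Zs ^ j)) = (if a = i \<and> b = j then v else 0)"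
proof -
  have "Ys ^ i * Zs ^ j = (fps_const (fps_X ^ i * fps_const (fps_X ^ j)) :: 'a pser)"
    by (simp add: Ys_def Zs_def)
  then have "lam a b (Ys ^ i * Zs ^ j) = (if a = i \<and> b = j then 1 else 0 :: 'a fps)"
    by (simp add: lam_fps_const fps_X_power_mult_nth)
  then show ?thesis by simp
qed

lemma Xs_power_dvd_iff: "Xs ^ m dvd F \<longleftrightarrow> (\<forall>n<m. fps_nth F n = 0)"
proof
  assume "Xs ^ m dvd F"
  then show "\<forall>n<m. fps_nth F n = 0" by (auto simp: dvd_def Xs_def fps_X_power_mult_nth)
next
  assume "\<forall>n<m. fps_nth F n = 0"
  then have "F = Xs ^ m * fps_shift m F" by (auto simp: fps_eq_iff Xs_def fps_X_power_mult_nth)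
  then show "Xs ^ m dvd F" by (metis dvd_triv_left)
qed

lemma Xs_separated: "(\<And>m. Xs ^ m dvd F) \<Longrightarrow> F = 0"
  unfolding Xs_power_dvd_iff by (metis fps_eq_iff fps_zero_nth lessI)

lemma Xs_nonzero [simp]: "Xs \<noteq> (0 :: 'k::field pser)"
  by (simp add: Xs_def)

lemma Xs_shift: "F = fps_const (fps_nth F 0) + Xs * fps_shift 1 F"
  by (auto simp: fps_eq_iff Xs_def)

lemma fps_trunc:
  fixes F :: "'a::comm_ring_1 fps"
  shows "fps_X ^ m dvd F - (\<Sum>n<m. fps_X ^ n * fps_const (fps_nth F n))"
proof -
  let ?R = "F - (\<Sum>n<m. fps_X ^ n * fps_const (fps_nth F n))"
  have "fps_nth ?R k = 0" if k: "k < m" for k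
  proof -
    have "(\<Sum>n<m. fps_nth (fps_X ^ n * fps_const (fps_nth F n)) k) = (\<Sum>n<m. if n = k then fps_nth F k else 0)"
      by (intro sum.cong) (auto simp: fps_X_power_mult_nth)
    then show ?thesis using k by (simp add: fps_sum_nth)
  qed
  then have "?R = fps_X ^ m * fps_shift m ?R"
    by (intro fps_ext) (simp add: fps_X_power_mult_nth del: fps_sub_nth)
  then show ?thesis by (metis dvd_triv_left)
qed

lemma Xs_trunc: "Xs ^ m dvd F - (\<Sum>n<m. Xs ^ n * fps_const (fps_nth F n))"
  using fps_trunc[of m F] by (simp add: Xs_def)

lemma fps_const_sum': "fps_const (sum f K) = (\<Sum>i\<in>K. fps_const (f i))"
  by (rule fps_ext) (simp add: fps_sum_nth)

section \<open>Polynomials in two variables over a subring of the power series in x\<close>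

text \<open>The ring \<open>V[y,z]\<close>.\<close>

definition polyYZ :: "'k::field fps set \<Rightarrow> 'k pser set" where
  "polyYZ V = {F. (\<forall>a b. lam a b F \<in> V) \<and> finite {(a, b). lam a b F \<noteq> 0}}"

lemma polyYZ_subring:
  assumes V: "is_subring V" shows "is_subring (polyYZ V)"
proof (rule is_subringI)
  have "{(a, b). lam a b (1 :: 'a pser) \<noteq> 0} \<subseteq> {(0, 0)}"
    by (auto simp: lam_in_x in_x_1[symmetric] split: if_splits)
  then show "1 \<in> polyYZ V" using V
    by (auto simp: polyYZ_def in_x_1[symmetric] lam_in_x intro: finite_subset)
next
  fix F G assume FG: "F \<in> polyYZ V" "G \<in> polyYZ V"
  then have fin: "finite {(a, b). lam a b F \<noteq> 0}" "finite {(a, b). lam a b G \<noteq> 0}" by (auto simp: polyYZ_def)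
  have "{(a, b). lam a b (F + G) \<noteq> 0} \<subseteq> {(a, b). lam a b F \<noteq> 0} \<union> {(a, b). lam a b G \<noteq> 0}" by auto
  then show "F + G \<in> polyYZ V" using FG V finite_subset[OF _ finite_UnI[OF fin]] by (auto simp: polyYZ_def)
  have "{(a, b). lam a b (F * G) \<noteq> 0} \<subseteq>
     (\<lambda>((i, j), (k, l)). (i + k, j + l)) ` ({(a, b). lam a b F \<noteq> 0} \<times> {(a, b). lam a b G \<noteq> 0})"
  proof clarify
    fix a b assume "lam a b (F * G) \<noteq> 0"
    then obtain i j where "i \<le> a" "j \<le> b" "lam i j F * lam (a - i) (b - j) G \<noteq> 0"
      unfolding lam_mult by (meson atLeastAtMost_iff sum.not_neutral_contains_not_neutral)
    then show "(a, b) \<in> (\<lambda>((i, j), (k, l)). (i + k, j + l)) ` ({(a, b). lam a b F \<noteq> 0} \<times> {(a, b). lam a b G \<noteq> 0})"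
      by (intro image_eqI[of _ _ "((i, j), (a - i, b - j))"]) auto
  qed
  then have "finite {(a, b). lam a b (F * G) \<noteq> 0}" using fin by (meson finite_SigmaI finite_imageI finite_subset)
  moreover have "lam a b (F * G) \<in> V" for a b
    unfolding lam_mult using FG V by (intro subring_sum[OF V] subring_mult[OF V]) (auto simp: polyYZ_def)
  ultimately show "F * G \<in> polyYZ V" by (simp add: polyYZ_def)
next
  fix F assume "F \<in> polyYZ V"
  then show "- F \<in> polyYZ V" using V by (auto simp: polyYZ_def)
qed

lemma polyYZ_monomial:
  assumes "is_subring V" "v \<in> V" shows "in_x v * (Ys ^ i * Zs ^ j) \<in> polyYZ V"
proof -
  have "{(a, b). lam a b (in_x v * (Ys ^ i * Zs ^ j)) \<noteq> 0} \<subseteq> {(i, j)}"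
    by (auto simp: lam_monomial split: if_splits simp del: lam_in_x_mult)
  then have "finite {(a, b). lam a b (in_x v * (Ys ^ i * Zs ^ j)) \<noteq> 0}" by (rule finite_subset) simp
  moreover have "lam a b (in_x v * (Ys ^ i * Zs ^ j)) \<in> V" for a b
    using assms by (simp add: lam_monomial del: lam_in_x_mult)
  ultimately show ?thesis unfolding polyYZ_def by blast
qed

lemma polyYZ_in_x: "is_subring V \<Longrightarrow> v \<in> V \<Longrightarrow> in_x v \<in> polyYZ V"
  using polyYZ_monomial[of V v 0 0] by simp

lemma polyYZ_Ys: "is_subring V \<Longrightarrow> Ys \<in> polyYZ V" and polyYZ_Zs: "is_subring V \<Longrightarrow> Zs \<in> polyYZ V"
  using polyYZ_monomial[of V 1 1 0] polyYZ_monomial[of V 1 0 1] by (auto simp: in_x_1)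

lemma polyYZ_mono: "V \<subseteq> V' \<Longrightarrow> polyYZ V \<subseteq> polyYZ V'"
  by (auto simp: polyYZ_def)

lemma polyYZ_expand:
  assumes "F \<in> polyYZ V"
  shows "F = (\<Sum>(i, j)\<in>{(a, b). lam a b F \<noteq> 0}. in_x (lam i j F) * (Ys ^ i * Zs ^ j))" (is "F = (\<Sum>(i, j)\<in>?A. _ i j)")
proof (rule lam_eqI)
  fix a b
  have fin: "finite ?A" using assms by (simp add: polyYZ_def)
  have "lam a b (\<Sum>(i, j)\<in>?A. in_x (lam i j F) * (Ys ^ i * Zs ^ j)) =
      (\<Sum>p\<in>?A. if p = (a, b) then lam a b F else 0)"
    unfolding lam_sum
    by (intro sum.cong refl) (auto simp: lam_monomial simp del: lam_in_x_mult split: if_splits)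
  also have "\<dots> = lam a b F" using fin by (simp add: sum.delta)
  finally show "lam a b F = lam a b (\<Sum>(i, j)\<in>?A. in_x (lam i j F) * (Ys ^ i * Zs ^ j))" by simp
qed

lemma polyYZ_least:
  assumes T: "is_subring T" and "in_x ` V \<subseteq> T" "Ys \<in> T" "Zs \<in> T" shows "polyYZ V \<subseteq> T"
proof
  fix F assume F: "F \<in> polyYZ V"
  show "F \<in> T"
  proof (subst polyYZ_expand[OF F], rule subring_sum[OF T])
    fix p assume "p \<in> {(a, b). lam a b F \<noteq> 0}"
    moreover have "in_x (lam i j F) * (Ys ^ i * Zs ^ j) \<in> T" for i j
      using F assms by (intro subring_mult[OF T] subring_power[OF T]) (auto simp: polyYZ_def)
    ultimately show "(case p of (i, j) \<Rightarrow> in_x (lam i j F) * (Ys ^ i * Zs ^ j)) \<in> T" by (cases p) simp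
  qed
qed

lemma polyYZ_rgen: assumes V: "is_subring V" shows "polyYZ V = rgen (in_x ` V \<union> {Ys, Zs})"
proof
  show "polyYZ V \<subseteq> rgen (in_x ` V \<union> {Ys, Zs})"
    by (intro polyYZ_least rgen_subring) (auto intro: rgen_incl)
  show "rgen (in_x ` V \<union> {Ys, Zs}) \<subseteq> polyYZ V"
    using V by (intro rgen_least polyYZ_subring) (auto intro: polyYZ_in_x polyYZ_Ys polyYZ_Zs)
qed

lemma in_x_image_subring: assumes V: "is_subring V" shows "is_subring (in_x ` V)"
  unfolding is_subring_def
proof (intro conjI ballI)
  show "1 \<in> in_x ` V" using V in_x_1 by (metis imageI subring_one)
  fix a b assume "a \<in> in_x ` V" "b \<in> in_x ` V"
  then obtain v w where "a = in_x v" "b = in_x w" "v \<in> V" "w \<in> V" by blast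
  then show "a - b \<in> in_x ` V" "a * b \<in> in_x ` V"
    using V by (auto simp: in_x_diff[symmetric] in_x_mult[symmetric])
qed

lemma polyYZ_noeth: assumes V: "is_subring V" and N: "noeth V" shows "noeth (polyYZ V)"
proof -
  have "noeth (in_x ` V)" by (rule noeth_image[OF _ _ _ V N]) (auto simp: in_x_add in_x_mult in_x_0)
  then show ?thesis using noeth_rgen[OF in_x_image_subring[OF V], of "{Ys, Zs}"] polyYZ_rgen[OF V] by simp
qed

text \<open>In an equation \<open>p(u) = 0\<close> with coefficients in \<open>V[y,z]\<close>, the coefficient of every monomial
  \<open>y\<^sup>a z\<^sup>b\<close> is an equation for \<open>u\<close> over \<open>V\<close>.\<close>

lemma polyYZ_transc:
  assumes V: "is_subring V" and u: "transc V u" shows "transc (polyYZ V) (in_x u)"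
  unfolding transc_def
proof (intro allI impI)
  fix p assume p: "\<forall>i. Polynomial.coeff p i \<in> polyYZ V" "poly p (in_x u) = 0"
  have "lam a b (Polynomial.coeff p i) = 0" for a b i
  proof -
    define q where "q = (\<Sum>i\<le>Polynomial.degree p. Polynomial.monom (lam a b (Polynomial.coeff p i)) i)"
    have cq: "Polynomial.coeff q j = (if j \<le> Polynomial.degree p then lam a b (Polynomial.coeff p j) else 0)" for j
      by (simp add: q_def coeff_sum)
    have "poly q u = lam a b (poly p (in_x u))"
      by (simp add: q_def poly_sum poly_monom poly_altdef[of p] lam_sum in_x_power[symmetric] mult.commute[of _ "in_x _"])
        (simp add: mult.commute)
    then have "q = 0" using p V cq by (intro transcD[OF u]) (auto simp: polyYZ_def)
    then show ?thesis using cq[of i] by (cases "i \<le> Polynomial.degree p") (auto simp: coeff_eq_0)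
  qed
  then have "Polynomial.coeff p i = 0" for i by (intro lam_eqI) simp
  then show "p = 0" by (simp add: poly_eq_iff)
qed

lemma polyYZ_div:
  assumes V: "\<And>v. fps_X * v \<in> V \<Longrightarrow> v \<in> V" and F: "Xs * F \<in> polyYZ V" shows "F \<in> polyYZ V"
  using F V by (simp add: polyYZ_def)

lemma polyYZ_div_power:
  assumes V: "\<And>v. fps_X * v \<in> V \<Longrightarrow> v \<in> V" shows "Xs ^ m * F \<in> polyYZ V \<Longrightarrow> F \<in> polyYZ V"
proof (induction m)
  case (Suc m)
  have "Xs * (Xs ^ m * F) \<in> polyYZ V" using Suc.prems by (simp add: mult.assoc)
  then show ?case using polyYZ_div[OF V] Suc.IH by blast
qed simp

abbreviation kk :: "'k::field fps set" where "kk \<equiv> range fps_const"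

lemma kk_subring: "is_subring (kk :: 'k::field fps set)"
  unfolding is_subring_def by (auto simp: image_iff intro: exI[of _ 1])

lemma noeth_kk: "noeth (kk :: 'k::field fps set)"
proof (rule noeth_field[OF kk_subring])
  fix a :: "'k fps" assume "a \<in> kk" "a \<noteq> 0"
  then obtain c where "a = fps_const c" "c \<noteq> 0" by auto
  then show "\<exists>b\<in>kk. a * b = 1" by (intro bexI[of _ "fps_const (inverse c)"]) auto
qed

abbreviation kyz :: "'k::field pser set" where "kyz \<equiv> polyYZ kk"

lemma kyz_subring: "is_subring kyz" by (rule polyYZ_subring[OF kk_subring])

lemma polyYZ_coeff: assumes "F \<in> polyYZ V" shows "fps_const (fps_nth F n) \<in> kyz"
proof -
  have l: "lam a b (fps_const (fps_nth F n)) = fps_const (fps_nth (lam a b F) n)" for a b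
    by (rule fps_ext) (simp add: lam_def)
  have "{(a, b). lam a b (fps_const (fps_nth F n)) \<noteq> 0} \<subseteq> {(a, b). lam a b F \<noteq> 0}"
    unfolding l by auto
  then show ?thesis using assms by (auto simp: polyYZ_def l intro: finite_subset)
qed

lemma kyz_const: assumes "F \<in> kyz" shows "F = fps_const (fps_nth F 0)"
proof (rule lam_eqI)
  fix a b
  obtain c where "lam a b F = fps_const c" using assms by (auto simp: polyYZ_def)
  moreover have "lam a b (fps_const (fps_nth F 0)) = fps_const (fps_nth (lam a b F) 0)"
    by (rule fps_ext) (simp add: lam_def)
  ultimately show "lam a b F = lam a b (fps_const (fps_nth F 0))" by simp
qed

section \<open>Localization inside the power series ring\<close>

text \<open>The localization of \<open>D\<close> at the elements with nonzero constant term. These are units of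
  \<open>k[[x,y,z]]\<close>, so the localization is again a subset of this ring.\<close>

definition loc0 :: "'k::field pser set \<Rightarrow> 'k pser set" where
  "loc0 D = {F. \<exists>w\<in>D. cc w \<noteq> 0 \<and> w * F \<in> D}"

lemma loc0_base: "is_subring D \<Longrightarrow> D \<subseteq> loc0 D"
  unfolding loc0_def by (auto intro!: bexI[of _ 1])

lemma loc0_mono: "D \<subseteq> D' \<Longrightarrow> loc0 D \<subseteq> loc0 D'"
  unfolding loc0_def by blast

lemma loc0_subring: assumes D: "is_subring D" shows "is_subring (loc0 D)"
proof (rule is_subringI)
  show "1 \<in> loc0 D" using loc0_base[OF D] D by auto
next
  fix a b assume "a \<in> loc0 D" "b \<in> loc0 D"
  then obtain q r where *: "q \<in> D" "cc q \<noteq> 0" "q * a \<in> D" "r \<in> D" "cc r \<noteq> 0" "r * b \<in> D"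
    unfolding loc0_def by blast
  have "(q * r) * (a + b) = r * (q * a) + q * (r * b)" "(q * r) * (a * b) = (q * a) * (r * b)"
    by (simp_all add: algebra_simps)
  moreover have "r * (q * a) + q * (r * b) \<in> D" "(q * a) * (r * b) \<in> D" using D * by auto
  ultimately have "(q * r) * (a + b) \<in> D" "(q * r) * (a * b) \<in> D" by (simp_all only:)
  moreover have "q * r \<in> D" "cc (q * r) \<noteq> 0" using D * by auto
  ultimately show "a + b \<in> loc0 D" "a * b \<in> loc0 D" unfolding loc0_def by blast+
next
  fix a assume "a \<in> loc0 D"
  then show "- a \<in> loc0 D" using D unfolding loc0_def by auto
qed

lemma loc0_unit:
  assumes F: "F \<in> loc0 D" "cc F \<noteq> 0" "F * G = 1" shows "G \<in> loc0 D"
proof -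
  obtain w where w: "w \<in> D" "cc w \<noteq> 0" "w * F \<in> D" using F by (auto simp: loc0_def)
  have "(w * F) * G = w" using F(3) by (simp add: mult.assoc)
  then have "(w * F) * G \<in> D" using w(1) by (simp only:)
  moreover have "cc (w * F) \<noteq> 0" using w(2) F(2) by simp
  ultimately show ?thesis using w(3) unfolding loc0_def by blast
qed

text \<open>The ring \<open>R\<^sup>* = k[y,z]_(y,z)[[x]]\<close> as a subset of \<open>k[[x,y,z]]\<close>.\<close>

definition Rst :: "'k::field pser set" where
  "Rst = {F. \<forall>n. fps_const (fps_nth F n) \<in> loc0 kyz}"

lemma Rst_subring: "is_subring (Rst :: 'k::field pser set)"
proof (rule is_subringI)
  have L: "is_subring (loc0 kyz :: 'k pser set)" by (rule loc0_subring[OF kyz_subring])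
  have "fps_const (fps_nth 1 n) \<in> (loc0 kyz :: 'k pser set)" for n
    using L by (cases n) simp_all
  then show "1 \<in> (Rst :: 'k pser set)" by (simp only: Rst_def mem_Collect_eq) blast
  show "- a \<in> Rst" if "a \<in> Rst" for a :: "'k pser"
    using that L by (auto simp: Rst_def fps_const_neg[symmetric] simp del: fps_const_neg)
  fix a b :: "'k pser" assume "a \<in> Rst" "b \<in> Rst"
  then have ab: "fps_const (fps_nth a n) \<in> loc0 kyz" "fps_const (fps_nth b n) \<in> loc0 kyz" for n
    by (auto simp: Rst_def)
  show "a + b \<in> Rst"
    using ab L by (auto simp: Rst_def fps_const_add[symmetric] simp del: fps_const_add)
  have "fps_const (fps_nth (a * b) n) \<in> loc0 kyz" for n
    unfolding fps_mult_nth fps_const_sum' fps_const_mult[symmetric]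
    using ab by (intro subring_sum[OF L] subring_mult[OF L])
  then show "a * b \<in> Rst" by (simp add: Rst_def)
qed

lemma loc0_kyz_const: assumes "F \<in> loc0 kyz" shows "F = fps_const (fps_nth F 0)"
proof -
  obtain w where w: "w \<in> kyz" "cc w \<noteq> 0" "w * F \<in> kyz" using assms by (auto simp: loc0_def)
  have "w * F = fps_const (fps_nth (w * F) 0)" by (rule kyz_const[OF w(3)])
  also have "\<dots> = fps_const (fps_nth w 0) * fps_const (fps_nth F 0)" by simp
  also have "\<dots> = w * fps_const (fps_nth F 0)" using kyz_const[OF w(1)] by simp
  finally show ?thesis using w(2) by auto
qed

text \<open>The coefficients of the inverse are computed recursively, with division only by the
  coefficient of \<open>x\<^sup>0\<close>, which is a unit of \<open>k[y,z]_(y,z)\<close>.\<close>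

lemma Rst_unit:
  assumes F: "F \<in> Rst" "cc F \<noteq> 0" "F * G = 1" shows "G \<in> (Rst :: 'k::field pser set)"
proof -
  have L: "is_subring (loc0 kyz :: 'k pser set)" by (rule loc0_subring[OF kyz_subring])
  have Fn: "fps_const (fps_nth F n) \<in> loc0 kyz" for n using F by (simp add: Rst_def)
  have c0: "cc (fps_const (fps_nth F 0)) \<noteq> 0" using F(2) by (simp add: cc_def)
  obtain U where U: "fps_const (fps_nth F 0) * U = 1" using pser_unit[OF c0] by blast
  have UL: "U \<in> loc0 kyz" by (rule loc0_unit[OF Fn c0 U])
  have "fps_const (fps_nth G n) \<in> loc0 kyz" for n
  proof (induction n rule: less_induct)
    case (less n)
    have "fps_nth (1 :: 'k pser) n = fps_nth F 0 * fps_nth G n + (\<Sum>i=Suc 0..n. fps_nth F i * fps_nth G (n - i))"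
      unfolding F(3)[symmetric] fps_mult_nth by (simp add: sum.atLeast_Suc_atMost)
    then have "fps_const (fps_nth F 0) * fps_const (fps_nth G n) = fps_const (fps_nth 1 n) -
         (\<Sum>i=Suc 0..n. fps_const (fps_nth F i) * fps_const (fps_nth G (n - i)))"
      by (simp add: fps_const_sum'[symmetric])
    also have "\<dots> \<in> loc0 kyz"
    proof (intro subring_diff[OF L] subring_sum[OF L] subring_mult[OF L] Fn less.IH)
      show "fps_const (fps_nth 1 n) \<in> (loc0 kyz :: 'k pser set)"
        using L by (cases n) auto
    qed auto
    finally have "U * (fps_const (fps_nth F 0) * fps_const (fps_nth G n)) \<in> loc0 kyz" using L UL by blast
    moreover have "U * (fps_const (fps_nth F 0) * fps_const (fps_nth G n)) = (fps_const (fps_nth F 0) * U) * fps_const (fps_nth G n)"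
      by (simp only: mult_ac)
    ultimately show ?case using U by simp
  qed
  then show ?thesis by (simp add: Rst_def)
qed

lemma polyYZ_Rst: "polyYZ V \<subseteq> Rst"
  using polyYZ_coeff loc0_base[OF kyz_subring] unfolding Rst_def by blast

lemma in_x_Rst: "in_x v \<in> Rst"
  using polyYZ_in_x[of UNIV v] polyYZ_Rst by (auto simp: is_subring_def)

lemma Xs_Rst: "Xs \<in> Rst" using in_x_Rst[of fps_X] by (simp add: in_x_X)

text \<open>Truncate \<open>F\<close> and clear the finitely many denominators of its coefficients.\<close>

lemma Rst_approx:
  fixes F :: "'k::field pser"
  assumes F: "F \<in> Rst" and V: "is_subring V" "kk \<subseteq> V" "fps_X \<in> V"
  shows "\<exists>d\<in>kyz. cc d \<noteq> 0 \<and> (\<exists>e\<in>polyYZ V. Xs ^ m dvd d * F - e)"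
proof -
  have "\<forall>n. \<exists>w\<in>kyz. cc w \<noteq> 0 \<and> w * fps_const (fps_nth F n) \<in> kyz" using F by (simp add: Rst_def loc0_def)
  then obtain w where w: "\<And>n. w n \<in> kyz" "\<And>n. cc (w n) \<noteq> 0" "\<And>n. w n * fps_const (fps_nth F n) \<in> kyz" by metis
  have cp: "cc (prod w K) = (\<Prod>n\<in>K. cc (w n))" for K by (induction K rule: infinite_finite_induct) auto
  define d where "d = (\<Prod>n<m. w n)"
  have d: "d \<in> kyz" "cc d \<noteq> 0" using w(1,2) by (auto simp: d_def cp intro: subring_prod[OF kyz_subring])
  have dF: "d * fps_const (fps_nth F n) \<in> polyYZ V" if "n < m" for n
  proof -
    have "d = w n * (\<Prod>n\<in>{..<m} - {n}. w n)" unfolding d_def using that by (intro prod.remove) auto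
    then have "d * fps_const (fps_nth F n) = (\<Prod>n\<in>{..<m} - {n}. w n) * (w n * fps_const (fps_nth F n))"
      by (simp add: mult_ac)
    also have "\<dots> \<in> kyz" by (rule subring_mult[OF kyz_subring subring_prod[OF kyz_subring w(1)] w(3)])
    finally show ?thesis using polyYZ_mono[OF V(2)] by blast
  qed
  have Xs: "Xs \<in> polyYZ V" using polyYZ_in_x[OF V(1,3)] by (simp add: in_x_X)
  have "(\<Sum>n<m. Xs ^ n * (d * fps_const (fps_nth F n))) \<in> polyYZ V"
    using dF Xs polyYZ_subring[OF V(1)] by (auto intro!: subring_sum)
  moreover have "d * F - (\<Sum>n<m. Xs ^ n * (d * fps_const (fps_nth F n))) =
       d * (F - (\<Sum>n<m. Xs ^ n * fps_const (fps_nth F n)))"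
    by (simp add: right_diff_distrib sum_distrib_left mult_ac)
  then have "Xs ^ m dvd d * F - (\<Sum>n<m. Xs ^ n * (d * fps_const (fps_nth F n)))"
    using Xs_trunc[of m F] by (simp add: dvd_mult)
  ultimately show ?thesis using d by blast
qed

section \<open>Operations that preserve transcendence\<close>

lemma transc_diff:
  fixes u :: "'a::idom"
  assumes S: "is_subring S" and u: "transc S u" and c: "c \<in> S"
  shows "transc S (u - c)" "transc S (c - u)"
proof -
  have "transc S (poly [:- c, 1:] u)" "transc S (poly [:c, - 1:] u)"
    by (rule transc_poly[OF S u]; use S c in \<open>auto simp: coeff_pCons split: nat.split\<close>)+
  then show "transc S (u - c)" "transc S (c - u)" by simp_all
qed

lemma transc_square:
  fixes u :: "'a::idom"
  assumes S: "is_subring S" and u: "transc S u"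
  shows "transc S (u\<^sup>2)"
proof -
  have "transc S (poly [:0, 0, 1:] u)"
    by (rule transc_poly[OF S u]; use S in \<open>auto simp: coeff_pCons split: nat.split\<close>)
  then show ?thesis by (simp add: power2_eq_square)
qed

text \<open>Multiplying an equation for \<open>v\<close> of degree \<open>n\<close> by \<open>x\<^sup>n\<close> yields one for \<open>x v\<close>.\<close>

lemma transc_unscale:
  fixes v :: "'a::idom"
  assumes S: "is_subring S" and u: "transc S (x * v)" and x: "x \<in> S" "x \<noteq> 0"
  shows "transc S v"
  unfolding transc_def
proof (intro allI impI)
  fix p assume p: "\<forall>i. Polynomial.coeff p i \<in> S" "poly p v = 0"
  define n where "n = Polynomial.degree p"
  define q where "q = (\<Sum>i\<le>n. Polynomial.monom (Polynomial.coeff p i * x ^ (n - i)) i)"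
  have cq: "Polynomial.coeff q j = (if j \<le> n then Polynomial.coeff p j * x ^ (n - j) else 0)" for j
    by (simp add: q_def coeff_sum)
  have "poly q (x * v) = (\<Sum>i\<le>n. x ^ n * (Polynomial.coeff p i * v ^ i))"
    unfolding q_def poly_sum poly_monom
  proof (intro sum.cong refl)
    fix i assume "i \<in> {..n}"
    then have "x ^ n = x ^ (n - i) * x ^ i" by (simp add: power_add[symmetric])
    then show "Polynomial.coeff p i * x ^ (n - i) * (x * v) ^ i = x ^ n * (Polynomial.coeff p i * v ^ i)"
      by (simp add: power_mult_distrib mult_ac)
  qed
  also have "\<dots> = x ^ n * poly p v" by (simp add: poly_altdef n_def sum_distrib_left)
  finally have "q = 0" using p S x by (intro transcD[OF u]) (auto simp: cq)
  then have "Polynomial.coeff p j = 0" for j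
    using cq[of j] x by (cases "j \<le> n") (auto simp: n_def coeff_eq_0)
  then show "p = 0" by (simp add: poly_eq_iff)
qed

lemma transc_fps_X: "transc (range fps_const) (fps_X :: 'a::comm_ring_1 fps)"
  unfolding transc_def
proof (intro allI impI)
  fix p :: "'a fps poly" assume p: "\<forall>i. Polynomial.coeff p i \<in> range fps_const" "poly p fps_X = 0"
  then have "\<forall>i. \<exists>d. Polynomial.coeff p i = fps_const d" by blast
  then obtain d where d: "\<And>i. Polynomial.coeff p i = fps_const (d i)" by metis
  have "d j = 0" if j: "j \<le> Polynomial.degree p" for j
  proof -
    have "0 = fps_nth (\<Sum>i\<le>Polynomial.degree p. fps_const (d i) * fps_X ^ i) j"
      using p(2) by (simp add: poly_altdef d)
    also have "\<dots> = (\<Sum>i\<le>Polynomial.degree p. if i = j then d j else 0)"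
      unfolding fps_sum_nth by (intro sum.cong) auto
    finally show ?thesis using j by simp
  qed
  then have "Polynomial.coeff p j = 0" for j
    using d[of j] by (cases "j \<le> Polynomial.degree p") (simp, simp only: coeff_eq_0 not_le)
  then show "p = 0" by (simp add: poly_eq_iff)
qed

text \<open>With \<open>a = p(u\<^sup>2)\<close> and \<open>b = q(u\<^sup>2)\<close>, the even powers of \<open>u\<close> in the first summand cannot
  cancel the odd powers in the second.\<close>

lemma square_independent:
  fixes u :: "'a::idom"
  assumes S: "is_subring S" and u: "transc S u" and ab: "a \<in> adj S (u\<^sup>2)" "b \<in> adj S (u\<^sup>2)" "a + b * u = 0"
  shows "a = 0 \<and> b = 0"
proof -
  obtain p q where p: "\<And>i. Polynomial.coeff p i \<in> S" "a = poly p (u\<^sup>2)"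
    and q: "\<And>i. Polynomial.coeff q i \<in> S" "b = poly q (u\<^sup>2)" using ab(1,2) unfolding adj_def by blast
  let ?s = "[:0, 0, 1:] :: 'a poly"
  have cs: "Polynomial.coeff ?s i \<in> S" for i using S by (auto simp: coeff_pCons split: nat.split)
  have c1: "Polynomial.coeff [:0, 1:] i \<in> S" for i using S by (auto simp: coeff_pCons split: nat.split)
  define P where "P = pcompose p ?s"
  define Q where "Q = pcompose q ?s"
  have PQ: "Polynomial.coeff P i \<in> S" "Polynomial.coeff Q i \<in> S" for i
    unfolding P_def Q_def using p(1) q(1) cs by (auto intro!: coeff_pcompose_closed[OF S])
  have "P + [:0, 1:] * Q = 0"
  proof (rule transcD[OF u])
    show "Polynomial.coeff (P + [:0, 1:] * Q) i \<in> S" for i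
      using PQ coeff_mult_closed[OF S, of "[:0, 1:]" Q] c1 S by auto
    show "poly (P + [:0, 1:] * Q) u = 0"
      using ab(3) p(2) q(2) by (simp add: P_def Q_def poly_pcompose power2_eq_square mult.commute)
  qed
  then have eq: "P = - ([:0, 1:] * Q)" by (simp only: eq_neg_iff_add_eq_0)
  have "q = 0"
  proof (rule ccontr)
    assume "q \<noteq> 0"
    then have Q0: "Q \<noteq> 0" using pcompose_eq_0[of q ?s] by (auto simp: Q_def)
    have "Polynomial.degree P = Polynomial.degree ([:0, 1:] * Q)" unfolding eq by simp
    also have "\<dots> = 1 + Polynomial.degree Q" using Q0 by (subst degree_mult_eq) auto
    finally have "Polynomial.degree p * 2 = 1 + Polynomial.degree q * 2"
      by (simp add: P_def Q_def degree_pcompose)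
    then show False by presburger
  qed
  then have "P = 0" using eq by (simp add: Q_def)
  then have "p = 0" using pcompose_eq_0[of p ?s] by (auto simp: P_def)
  then show ?thesis using \<open>q = 0\<close> p(2) q(2) by simp
qed

section \<open>Polynomial rings over k and the union B of their localizations\<close>

abbreviation kx :: "'k::field fps set" where "kx \<equiv> adj kk fps_X"

lemma kx_subring: "is_subring kx" by (rule adj_subring[OF kk_subring])

lemma kk_kx: "kk \<subseteq> kx" by (rule adj_base[OF kk_subring])

lemma X_kx: "fps_X \<in> kx" by (rule adj_gen[OF kk_subring])

abbreviation kxyz :: "'k::field pser set" where "kxyz \<equiv> polyYZ kx"

lemma kxyz_subring: "is_subring kxyz" by (rule polyYZ_subring[OF kx_subring])

lemma Xs_kxyz: "Xs \<in> kxyz"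
  using polyYZ_in_x[OF kx_subring X_kx] by (simp add: in_x_X)

lemma in_x_trunc: "\<exists>v\<in>kx. Xs ^ m dvd in_x \<gamma> - in_x v"
proof (intro bexI)
  let ?v = "\<Sum>n<m. fps_X ^ n * fps_const (fps_nth \<gamma> n)"
  obtain w where "\<gamma> - ?v = fps_X ^ m * w" using fps_trunc[of m \<gamma>] by (auto simp: dvd_def)
  then have "in_x \<gamma> - in_x ?v = Xs ^ m * in_x w"
    by (metis in_x_X in_x_diff in_x_mult in_x_power)
  then show "Xs ^ m dvd in_x \<gamma> - in_x ?v" by simp
  show "?v \<in> kx" using kk_kx X_kx kx_subring by (intro subring_sum subring_mult subring_power) auto
qed

text \<open>A quotient in \<open>k[[x]]\<close> of two elements of \<open>frac_set N\<close> is again in \<open>frac_set N\<close>. Hence a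
  nonzero ideal is generated by any of its elements of least order, which divides all others in
  \<open>k[[x]]\<close>.\<close>

lemma frac_set_noeth:
  fixes N :: "'k::field fps set"
  assumes N: "is_subring N" shows "noeth (frac_set N)"
  unfolding noeth_def
proof (intro allI impI)
  let ?V = "frac_set N"
  have V: "is_subring ?V" by (rule frac_set_subring[OF N])
  fix I assume I: "ideal_in ?V I"
  show "\<exists>G. finite G \<and> G \<subseteq> I \<and> I \<subseteq> genid ?V G"
  proof (cases "I \<subseteq> {0}")
    case True
    then show ?thesis by (intro exI[of _ "{}"]) (auto intro: genid.genid_0)
  next
    case False
    then obtain a0 where "a0 \<in> I \<and> a0 \<noteq> 0" by blast
    then obtain a where a: "a \<in> I \<and> a \<noteq> 0" "\<And>b. b \<in> I \<and> b \<noteq> 0 \<Longrightarrow> subdegree a \<le> subdegree b"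
      using ex_has_least_nat[of "\<lambda>a. a \<in> I \<and> a \<noteq> 0" a0 subdegree] by blast
    have "I \<subseteq> genid ?V {a}"
    proof
      fix b assume b: "b \<in> I"
      have "a dvd b"
        using a b by (cases "b = 0") (auto simp: fps_dvd_iff)
      then obtain c where c: "b = a * c" by (auto simp: dvd_def)
      obtain q r where qr: "q \<in> N" "q \<noteq> 0" "q * a \<in> N" "r \<in> N" "r \<noteq> 0" "r * b \<in> N"
        using ideal_in_carrier[OF I b] ideal_in_carrier[OF I, of a] a(1) unfolding frac_set_def by blast
      have "(r * (q * a)) * c = q * (r * b)" using c by (simp add: mult_ac)
      moreover have "q * (r * b) \<in> N" "r * (q * a) \<in> N" "r * (q * a) \<noteq> 0" using qr N a(1) by auto
      ultimately have "c \<in> ?V" unfolding frac_set_def by (metis (mono_tags, lifting) mem_Collect_eq)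
      then have "0 + c * a \<in> genid ?V {a}" by (intro genid.intros) auto
      then show "b \<in> genid ?V {a}" using c by (simp add: mult.commute)
    qed
    then show ?thesis using a(1) by (intro exI[of _ "{a}"]) auto
  qed
qed

text \<open>The independence of \<open>\<alpha>\<close> and \<open>\<beta>\<close> is used in the form that \<open>\<alpha>\<close> is transcendental over \<open>k[x]\<close>
  and \<open>\<beta>\<close> over \<open>k[x,\<alpha>]\<close>.\<close>

locale independent_series =
  fixes \<alpha> \<beta> :: "'k::field fps"
  assumes \<alpha>0: "fps_nth \<alpha> 0 = 0" and \<beta>0: "fps_nth \<beta> 0 = 0"
    and transc_\<alpha>: "transc kx \<alpha>" and transc_\<beta>: "transc (adj kx \<alpha>) \<beta>"
begin

definition "s = Ys - in_x \<alpha>"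
definition "t = Zs - in_x \<beta>"

abbreviation "f \<equiv> f_elt \<alpha>"
abbreviation "g \<equiv> g_elt \<beta>"

lemma f_eq: "f = s\<^sup>2" and g_eq: "g = t\<^sup>2"
  by (simp_all add: f_elt_def g_elt_def s_def t_def)

text \<open>The ring \<open>k[x,y,z,f_r,g_r]\<close>; for \<open>r = 0\<close> it is \<open>k[x,y,z,f,g]\<close>.\<close>

definition "D r = adj (adj kxyz (fps_shift r f)) (fps_shift r g)"

text \<open>The ring \<open>k[x,\<alpha>,\<beta>]\<close>; below, \<open>M\<close> is \<open>k[x,\<alpha>][y,z]\<close>.\<close>

definition "N = adj (adj kx \<alpha>) \<beta>"

abbreviation "M \<equiv> polyYZ (adj kx \<alpha>)"

lemma kxa_subring: "is_subring (adj kx \<alpha>)" by (rule adj_subring[OF kx_subring])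

lemma N_subring: "is_subring N" unfolding N_def by (rule adj_subring[OF kxa_subring])

lemma M_subring: "is_subring M" by (rule polyYZ_subring[OF kxa_subring])

lemma kxyz_M: "kxyz \<subseteq> M" by (rule polyYZ_mono[OF adj_base[OF kx_subring]])

lemma s_M: "s \<in> M"
  unfolding s_def by (intro subring_diff[OF M_subring] polyYZ_in_x[OF kxa_subring] polyYZ_Ys[OF kxa_subring]
    adj_gen[OF kx_subring])

lemma f_M: "f \<in> M" unfolding f_eq by (intro subring_power[OF M_subring] s_M)

lemma transc_s: "transc kxyz s"
  unfolding s_def by (intro transc_diff(2)[OF kxyz_subring] polyYZ_transc[OF kx_subring transc_\<alpha>] polyYZ_Ys[OF kx_subring])

lemma transc_t: "transc M t"
  unfolding t_def by (intro transc_diff(2)[OF M_subring] polyYZ_transc[OF kxa_subring transc_\<beta>] polyYZ_Zs[OF kxa_subring])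

lemma transc_f: "transc kxyz f" unfolding f_eq by (rule transc_square[OF kxyz_subring transc_s])

lemma transc_g: "transc M g" unfolding g_eq by (rule transc_square[OF M_subring transc_t])

lemma fg_UNIV: "f \<in> polyYZ UNIV" "g \<in> polyYZ UNIV"
proof -
  have U: "is_subring (UNIV :: 'k fps set)" by (simp add: is_subring_def)
  have "Ys - in_x \<alpha> \<in> polyYZ UNIV" "Zs - in_x \<beta> \<in> polyYZ UNIV"
    by (intro subring_diff[OF polyYZ_subring[OF U]] polyYZ_in_x[OF U] polyYZ_Ys[OF U] polyYZ_Zs[OF U]; simp)+
  then show "f \<in> polyYZ UNIV" "g \<in> polyYZ UNIV"
    unfolding f_elt_def g_elt_def by (auto intro: subring_power[OF polyYZ_subring[OF U]])
qed

lemma coeff_fg: "fps_const (fps_nth f r) \<in> kyz" "fps_const (fps_nth g r) \<in> kyz"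
  using fg_UNIV by (auto intro: polyYZ_coeff)

lemma kyz_kxyz: "kyz \<subseteq> kxyz" by (rule polyYZ_mono[OF kk_kx])

lemma endpiece:
  fixes F :: "'k pser"
  assumes "\<And>n. fps_const (fps_nth F n) \<in> kyz"
  shows "\<exists>c\<in>kxyz. Xs ^ r * fps_shift r F = F - c"
proof (intro bexI)
  let ?c = "\<Sum>n<r. Xs ^ n * fps_const (fps_nth F n)"
  show "?c \<in> kxyz"
    using assms kyz_kxyz Xs_kxyz by (intro subring_sum[OF kxyz_subring] subring_mult[OF kxyz_subring] subring_power[OF kxyz_subring]) auto
  obtain w where w: "F - ?c = Xs ^ r * w" using Xs_trunc[of r F] by (auto simp: dvd_def)
  have "fps_shift r F = w"
  proof (rule fps_ext)
    fix n
    have "fps_nth ?c (n + r) = (\<Sum>j<r. 0)"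
      unfolding fps_sum_nth by (intro sum.cong) (auto simp: Xs_def fps_X_power_mult_nth)
    moreover have "fps_nth (F - ?c) (n + r) = fps_nth w n" unfolding w by (simp add: Xs_def fps_X_power_mult_nth)
    ultimately show "fps_nth (fps_shift r F) n = fps_nth w n" by simp
  qed
  then show "Xs ^ r * fps_shift r F = F - ?c" using w by simp
qed

lemma transc_fr: "transc kxyz (fps_shift r f)"
proof -
  obtain c where c: "c \<in> kxyz" "Xs ^ r * fps_shift r f = f - c" using endpiece[OF coeff_fg(1)] by blast
  have "transc kxyz (Xs ^ r * fps_shift r f)" unfolding c(2) by (rule transc_diff(1)[OF kxyz_subring transc_f c(1)])
  then show ?thesis by (rule transc_unscale[OF kxyz_subring _ subring_power[OF kxyz_subring Xs_kxyz]]) simp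
qed

lemma fr_frac_M: "adj kxyz (fps_shift r f) \<subseteq> frac_set M"
proof (rule adj_least[OF frac_set_subring[OF M_subring]])
  show "kxyz \<subseteq> frac_set M" using kxyz_M frac_set_base[OF M_subring] by blast
  obtain c where c: "c \<in> kxyz" "Xs ^ r * fps_shift r f = f - c" using endpiece[OF coeff_fg(1)] by blast
  have "Xs ^ r * fps_shift r f \<in> M" unfolding c(2) using c(1) kxyz_M f_M M_subring by auto
  then show "fps_shift r f \<in> frac_set M"
    unfolding frac_set_def using Xs_kxyz kxyz_M M_subring by (intro CollectI bexI[of _ "Xs ^ r"]) auto
qed

text \<open>The series \<open>g\<close> is transcendental over \<open>k[x,\<alpha>][y,z]\<close> and over its fractions, among which is
  \<open>f_r\<close>; up to a polynomial and a power of \<open>x\<close>, \<open>g_r\<close> is \<open>g\<close>.\<close>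

lemma transc_gr: "transc (adj kxyz (fps_shift r f)) (fps_shift r g)"
proof (rule transc_mono[OF _ fr_frac_M])
  have FM: "is_subring (frac_set M)" by (rule frac_set_subring[OF M_subring])
  have sub: "kxyz \<subseteq> frac_set M" using kxyz_M frac_set_base[OF M_subring] by blast
  obtain c where c: "c \<in> kxyz" "Xs ^ r * fps_shift r g = g - c" using endpiece[OF coeff_fg(2)] by blast
  have "transc (frac_set M) (Xs ^ r * fps_shift r g)"
    unfolding c(2) by (rule transc_diff(1)[OF FM transc_frac_set[OF M_subring transc_g]]) (use sub c(1) in blast)
  then show "transc (frac_set M) (fps_shift r g)"
    by (rule transc_unscale[OF FM _ subring_power[OF FM]]) (use sub Xs_kxyz in \<open>blast, simp\<close>)
qed

lemma kxyza_subring: "is_subring (adj kxyz (fps_shift r f))" by (rule adj_subring[OF kxyz_subring])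

lemma D_subring: "is_subring (D r)" unfolding D_def by (rule adj_subring[OF kxyza_subring])

lemma kxyz_D: "kxyz \<subseteq> D r"
  unfolding D_def using adj_base[OF kxyz_subring] adj_base[OF kxyza_subring] by blast

lemma Xs_D: "Xs \<in> D r" using Xs_kxyz kxyz_D by blast

lemma fr_D: "fps_shift r f \<in> D r" "fps_shift r g \<in> D r"
  unfolding D_def using adj_gen[OF kxyz_subring] adj_base[OF kxyza_subring] adj_gen[OF kxyza_subring] by blast+

lemma D_least: "is_subring S \<Longrightarrow> kxyz \<subseteq> S \<Longrightarrow> fps_shift r f \<in> S \<Longrightarrow> fps_shift r g \<in> S \<Longrightarrow> D r \<subseteq> S"
  unfolding D_def by (intro adj_least)

lemma fps_shift_step: "fps_shift r F = fps_const (fps_nth F r) + Xs * fps_shift (Suc r) F"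
  for F :: "'k pser"
  using Xs_shift[of "fps_shift r F"] fps_shift_fps_shift[of 1 r F] by simp

lemma D_Suc: "D r \<subseteq> D (Suc r)"
proof (rule D_least[OF D_subring kxyz_D])
  have "fps_const (fps_nth f r) + Xs * fps_shift (Suc r) f \<in> D (Suc r)"
     "fps_const (fps_nth g r) + Xs * fps_shift (Suc r) g \<in> D (Suc r)"
    using coeff_fg[of r] kyz_kxyz kxyz_D[of "Suc r"] Xs_D[of "Suc r"] fr_D[of "Suc r"]
    by (auto intro!: subring_add[OF D_subring] subring_mult[OF D_subring])
  then show "fps_shift r f \<in> D (Suc r)" "fps_shift r g \<in> D (Suc r)"
    by (simp_all add: fps_shift_step[of r f, symmetric] fps_shift_step[of r g, symmetric])
qed

lemma D_mono: "r \<le> r' \<Longrightarrow> D r \<subseteq> D r'"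
  by (rule lift_Suc_mono_le[of D, OF D_Suc])

lemma D_Rst: "D r \<subseteq> Rst"
proof (rule D_least[OF Rst_subring polyYZ_Rst])
  have "fps_const (fps_nth f n) \<in> loc0 kyz" "fps_const (fps_nth g n) \<in> loc0 kyz" for n
    using coeff_fg[of n] loc0_base[OF kyz_subring] by auto
  then show "fps_shift r f \<in> Rst" "fps_shift r g \<in> Rst" by (simp_all add: Rst_def)
qed

text \<open>Because of \<open>f_r = b_r + x f_(r+1)\<close> with \<open>b_r\<close> in \<open>k[y]\<close>, and similarly for \<open>g_r\<close>, every
  element of \<open>D r\<close> has the form \<open>p + x v\<close> with \<open>p\<close> in \<open>k[y,z]\<close> and \<open>v\<close> in \<open>D (r + 1)\<close>. If \<open>x\<close>
  divides it, then \<open>p = 0\<close>.\<close>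

lemma D_div: assumes "u \<in> D r" "Xs dvd u" shows "\<exists>v\<in>D (Suc r). u = Xs * v"
proof -
  \<comment> \<open>it suffices that these sums form a ring that contains the generators of \<open>D r\<close>\<close>
  let ?S = "{p + Xs * v | p v. p \<in> kyz \<and> v \<in> D (Suc r)}"
  have k: "kyz \<subseteq> D (Suc r)" using kyz_kxyz kxyz_D by blast
  have I: "p + Xs * v \<in> ?S" if "p \<in> kyz" "v \<in> D (Suc r)" for p v using that by blast
  have S: "is_subring ?S"
  proof (rule is_subringI)
    show "1 \<in> ?S" using I[of 1 0] kyz_subring D_subring by auto
  next
    fix a b assume "a \<in> ?S" "b \<in> ?S"
    then obtain p v q w where *: "a = p + Xs * v" "b = q + Xs * w" "p \<in> kyz" "q \<in> kyz" "v \<in> D (Suc r)" "w \<in> D (Suc r)" by blast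
    have "a + b = (p + q) + Xs * (v + w)" "a * b = p * q + Xs * (p * w + v * q + Xs * (v * w))"
      unfolding *(1,2) by (simp_all add: algebra_simps)
    moreover have "p * w + v * q + Xs * (v * w) \<in> D (Suc r)" "p * q \<in> kyz"
      using * k Xs_D[of "Suc r"] by (auto intro!: subring_add[OF D_subring] subring_mult[OF D_subring] subring_mult[OF kyz_subring])
    ultimately show "a + b \<in> ?S" "a * b \<in> ?S"
      using I[of "p + q" "v + w"] I[of "p * q"] * kyz_subring D_subring by (auto simp only: subring_add)
  next
    fix a assume "a \<in> ?S"
    then obtain p v where *: "a = p + Xs * v" "p \<in> kyz" "v \<in> D (Suc r)" by blast
    then show "- a \<in> ?S" using I[of "- p" "- v"] kyz_subring D_subring by auto
  qed
  have X: "Xs \<in> ?S" using I[of 0 1] kyz_subring D_subring by auto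
  have "D r \<subseteq> ?S"
  proof (rule D_least[OF S])
    have kS: "kyz \<subseteq> ?S" using I[of _ 0] D_subring by auto
    have "in_x ` kk \<subseteq> ?S" using kS polyYZ_in_x[OF kk_subring] by blast
    then have "in_x ` kx \<subseteq> ?S"
    proof -
      assume kk: "in_x ` kk \<subseteq> ?S"
      have "in_x (poly p fps_X) \<in> ?S" if "\<forall>i. Polynomial.coeff p i \<in> kk" for p
      proof -
        have "in_x (sum h K) = (\<Sum>i\<in>K. in_x (h i))" for h :: "nat \<Rightarrow> 'k fps" and K
          by (induction K rule: infinite_finite_induct) (auto simp: in_x_add in_x_0)
        then have "in_x (poly p fps_X) = (\<Sum>i\<le>Polynomial.degree p. in_x (Polynomial.coeff p i) * Xs ^ i)"
          by (simp add: poly_altdef in_x_mult in_x_power in_x_X)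
        also have "\<dots> \<in> ?S" 
          by (intro subring_sum[OF S] subring_mult[OF S] subring_power[OF S] X subsetD[OF kk] imageI) (use that in blast)
        finally show ?thesis .
      qed
      then show ?thesis unfolding adj_def by blast
    qed
    then show "kxyz \<subseteq> ?S"
      using kS polyYZ_Ys[OF kk_subring] polyYZ_Zs[OF kk_subring] by (intro polyYZ_least[OF S]) blast+
    show "fps_shift r f \<in> ?S" "fps_shift r g \<in> ?S"
      using I[OF coeff_fg(1)[of r] fr_D(1)[of "Suc r"]] I[OF coeff_fg(2)[of r] fr_D(2)[of "Suc r"]]
      by (simp_all only: fps_shift_step[of r f, symmetric] fps_shift_step[of r g, symmetric])
  qed
  then obtain p v where pv: "u = p + Xs * v" "p \<in> kyz" "v \<in> D (Suc r)" using assms(1) by blast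
  have "Xs dvd p" using assms(2) unfolding pv(1) by (metis add.commute dvd_add_right_iff dvd_triv_left)
  then have "fps_nth p 0 = 0" using Xs_power_dvd_iff[of 1 p] by simp
  then have "p = 0" using kyz_const[OF pv(2)] by simp
  then show ?thesis using pv by auto
qed

lemma D_Xs_power: assumes "u \<in> D r" shows "\<exists>n. Xs ^ n * u \<in> D 0"
proof -
  let ?S = "{u. \<exists>n. Xs ^ n * u \<in> D 0}"
  have up: "Xs ^ m * u \<in> D 0" if "Xs ^ n * u \<in> D 0" "n \<le> m" for m n u
  proof -
    have "Xs ^ m * u = Xs ^ (m - n) * (Xs ^ n * u)" using that(2) by (metis le_add_diff_inverse2 mult.assoc power_add)
    moreover have "Xs ^ (m - n) * (Xs ^ n * u) \<in> D 0"
      by (rule subring_mult[OF D_subring subring_power[OF D_subring Xs_D] that(1)])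
    ultimately show ?thesis by (simp only:)
  qed
  have S: "is_subring ?S"
  proof (rule is_subringI)
    show "1 \<in> ?S" using D_subring[of 0] by (auto intro: exI[of _ 0])
    fix a assume "a \<in> ?S" then show "- a \<in> ?S" using D_subring[of 0] by auto
  next
    fix a b assume "a \<in> ?S" "b \<in> ?S"
    then obtain m n where *: "Xs ^ m * a \<in> D 0" "Xs ^ n * b \<in> D 0" by blast
    have "Xs ^ (max m n) * (a + b) \<in> D 0"
      using up[OF *(1), of "max m n"] up[OF *(2), of "max m n"] D_subring[of 0] by (simp add: distrib_left)
    moreover have "Xs ^ (m + n) * (a * b) = (Xs ^ m * a) * (Xs ^ n * b)" by (simp add: power_add mult_ac)
    then have "Xs ^ (m + n) * (a * b) \<in> D 0" using subring_mult[OF D_subring *] by (simp only:)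
    ultimately show "a + b \<in> ?S" "a * b \<in> ?S" by blast+
  qed
  have "D r \<subseteq> ?S"
  proof (rule D_least[OF S])
    show "kxyz \<subseteq> ?S"
    proof
      fix u :: "'k pser" assume "u \<in> kxyz"
      then have "Xs ^ 0 * u \<in> D 0" using kxyz_D[of 0] by auto
      then show "u \<in> ?S" by blast
    qed
    have "f \<in> D 0" "g \<in> D 0" using fr_D[of 0] by simp_all
    moreover obtain c where c: "c \<in> kxyz" "Xs ^ r * fps_shift r f = f - c" using endpiece[OF coeff_fg(1)] by blast
    moreover obtain d where d: "d \<in> kxyz" "Xs ^ r * fps_shift r g = g - d" using endpiece[OF coeff_fg(2)] by blast
    ultimately have "Xs ^ r * fps_shift r f \<in> D 0" "Xs ^ r * fps_shift r g \<in> D 0"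
      unfolding c(2) d(2) using kxyz_D[of 0] by (auto intro: subring_diff[OF D_subring])
    then show "fps_shift r f \<in> ?S" "fps_shift r g \<in> ?S" by blast+
  qed
  then show ?thesis using assms by blast
qed

definition "B = (\<Union>r\<in>{1..}. loc0 (D r))"

lemma loc0_D_mono: "r \<le> r' \<Longrightarrow> loc0 (D r) \<subseteq> loc0 (D r')"
  by (intro loc0_mono D_mono)

lemma B_common: assumes "a \<in> B" "b \<in> B" obtains r where "r \<ge> 1" "a \<in> loc0 (D r)" "b \<in> loc0 (D r)"
proof -
  obtain r r' where "r \<ge> 1" "r' \<ge> 1" "a \<in> loc0 (D r)" "b \<in> loc0 (D r')" using assms by (auto simp: B_def)
  then show ?thesis using loc0_D_mono[of r "max r r'"] loc0_D_mono[of r' "max r r'"]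
    by (intro that[of "max r r'"]) auto
qed

lemma loc0_D_B: "loc0 (D r) \<subseteq> B"
  using loc0_D_mono[of r "Suc r"] by (auto simp: B_def)

lemma B_subring: "is_subring B"
  unfolding is_subring_def
proof (intro conjI ballI)
  show "1 \<in> B" using loc0_D_B[of 0] loc0_subring[OF D_subring[of 0]] by auto
  fix a b assume "a \<in> B" "b \<in> B"
  then obtain r where "a \<in> loc0 (D r)" "b \<in> loc0 (D r)" by (rule B_common)
  then have "a - b \<in> loc0 (D r)" "a * b \<in> loc0 (D r)" using loc0_subring[OF D_subring[of r]] by auto
  then show "a - b \<in> B" "a * b \<in> B" using loc0_D_B by blast+
qed

lemma D_B: "D r \<subseteq> B" using loc0_D_B loc0_base[OF D_subring] by blast

lemma Xs_B: "Xs \<in> B" using D_B Xs_D by blast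

lemma B_Rst: "B \<subseteq> Rst"
proof
  fix b assume "b \<in> B"
  then obtain r w where w: "w \<in> D r" "cc w \<noteq> 0" "w * b \<in> D r" by (auto simp: B_def loc0_def)
  obtain v where v: "w * v = 1" using pser_unit[OF w(2)] by blast
  have "v \<in> Rst" using Rst_unit[of w v] w v D_Rst by blast
  then have "v * (w * b) \<in> Rst" using w(3) D_Rst subring_mult[OF Rst_subring] by blast
  moreover have "v * (w * b) = b" using v by (metis mult.assoc mult.commute mult_1)
  ultimately show "b \<in> Rst" by simp
qed

text \<open>Hence \<open>xB\<close> contains every element of \<open>B\<close> that \<open>x\<close> divides in \<open>k[[x,y,z]]\<close>, which fails for
  each single \<open>D r\<close>; this is what the passage to the union achieves.\<close>

lemma B_div: assumes "Xs * b \<in> B" shows "b \<in> B"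
proof -
  obtain r w where w: "w \<in> D r" "cc w \<noteq> 0" "w * (Xs * b) \<in> D r" using assms by (auto simp: B_def loc0_def)
  have "Xs dvd w * (Xs * b)" by simp
  then obtain v where v: "v \<in> D (Suc r)" "w * (Xs * b) = Xs * v" using D_div[OF w(3)] by blast
  have "Xs * (w * b) = Xs * v" using v(2) by (simp add: mult_ac)
  then have "w * b = v" by simp
  then have "b \<in> loc0 (D (Suc r))" using v(1) w D_Suc[of r] by (auto simp: loc0_def)
  then show ?thesis using loc0_D_B by blast
qed

lemma B_div_power: "Xs ^ n * b \<in> B \<Longrightarrow> b \<in> B"
proof (induction n)
  case (Suc n)
  have "Xs * (Xs ^ n * b) \<in> B" using Suc.prems by (simp add: mult.assoc)
  then show ?case using B_div Suc.IH by blast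
qed simp

lemma B_unit: assumes "b \<in> B" "cc b \<noteq> 0" "b * v = 1" shows "v \<in> B"
  using assms loc0_unit unfolding B_def by blast

lemma loc0_kyz_B: "loc0 kyz \<subseteq> B"
  using loc0_mono[of kyz "D 0"] kyz_kxyz kxyz_D[of 0] loc0_D_B[of 0] by blast

lemma B_dense: assumes "F \<in> Rst" shows "\<exists>b\<in>B. Xs ^ m dvd F - b"
proof (intro bexI)
  show "Xs ^ m dvd F - (\<Sum>n<m. Xs ^ n * fps_const (fps_nth F n))" by (rule Xs_trunc)
  show "(\<Sum>n<m. Xs ^ n * fps_const (fps_nth F n)) \<in> B"
    using assms loc0_kyz_B Xs_B
    by (intro subring_sum[OF B_subring] subring_mult[OF B_subring] subring_power[OF B_subring]) (auto simp: Rst_def)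
qed

text \<open>A power of \<open>x\<close> moves the numerator and the denominator of an element of \<open>B\<close> from \<open>D r\<close> to
  \<open>D 0\<close>.\<close>

lemma B_clear: assumes "b \<in> B"
  obtains n w where "w \<in> B" "cc w \<noteq> 0" "Xs ^ n * w \<in> D 0" "Xs ^ n * w * b \<in> D 0"
proof -
  obtain r w where w: "w \<in> D r" "cc w \<noteq> 0" "w * b \<in> D r" using assms by (auto simp: B_def loc0_def)
  obtain n m where n: "Xs ^ n * w \<in> D 0" and m: "Xs ^ m * (w * b) \<in> D 0" using D_Xs_power w by meson
  have eq: "Xs ^ (n + m) * w = Xs ^ m * (Xs ^ n * w)" "Xs ^ (n + m) * w * b = Xs ^ n * (Xs ^ m * (w * b))"
    by (simp_all add: power_add mult_ac)
  have "Xs ^ (n + m) * w \<in> D 0" unfolding eq(1)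
    by (rule subring_mult[OF D_subring subring_power[OF D_subring Xs_D] n])
  moreover have "Xs ^ (n + m) * w * b \<in> D 0" unfolding eq(2)
    by (rule subring_mult[OF D_subring subring_power[OF D_subring Xs_D] m])
  moreover note w
  ultimately have "Xs ^ (n + m) * w \<in> D 0" "Xs ^ (n + m) * w * b \<in> D 0" by blast+
  then show ?thesis using that w D_B by blast
qed

lemma B_frac: "B \<subseteq> frac_set (D 0)"
proof
  fix b assume "b \<in> B"
  then obtain n w where w: "cc w \<noteq> 0" "Xs ^ n * w \<in> D 0" "Xs ^ n * w * b \<in> D 0" by (rule B_clear)
  then have "Xs ^ n * w \<noteq> 0" by auto
  then show "b \<in> frac_set (D 0)" using w unfolding frac_set_def by blast
qed

end

section \<open>Approximation of linear relations\<close>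

lemma dvd_diff_swap: "a dvd b - c \<Longrightarrow> a dvd c - b" for a :: "'a::comm_ring_1"
  by (metis dvd_minus_iff minus_diff_eq)

lemma loc0_noeth: assumes D: "is_subring D" and N: "noeth D" shows "noeth (loc0 D)"
  unfolding noeth_def
proof (intro allI impI)
  fix I assume I: "ideal_in (loc0 D) I"
  note L = loc0_subring[OF D] and DL = loc0_base[OF D]
  have "ideal_in D (I \<inter> D)"
    using D DL ideal_in_zero[OF I] ideal_in_add[OF I] ideal_in_lmult[OF I] unfolding ideal_in_def by blast
  then obtain G where G: "finite G" "G \<subseteq> I \<inter> D" "I \<inter> D \<subseteq> genid D G" by (rule noethE[OF N])
  have id: "ideal_in (loc0 D) (genid (loc0 D) G)" using G(2) DL by (intro genid_ideal L) blast
  have "I \<subseteq> genid (loc0 D) G"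
  proof
    fix F assume F: "F \<in> I"
    then obtain w where w: "w \<in> D" "cc w \<noteq> 0" "w * F \<in> D"
      using ideal_in_carrier[OF I F] by (auto simp: loc0_def)
    obtain v where v: "w * v = 1" using pser_unit[OF w(2)] by blast
    have vL: "v \<in> loc0 D" using loc0_unit[OF _ w(2) v] w(1) DL by blast
    have "w * F \<in> I \<inter> D" using w ideal_in_lmult[OF I _ F] DL by blast
    then have "w * F \<in> genid (loc0 D) G" using G(3) genid_mono[OF DL order_refl] by blast
    then have "v * (w * F) \<in> genid (loc0 D) G" using ideal_in_lmult[OF id vL] by blast
    moreover have "v * (w * F) = F" using v by (metis mult.assoc mult.commute mult_1)
    ultimately show "F \<in> genid (loc0 D) G" by simp
  qed
  then show "\<exists>G. finite G \<and> G \<subseteq> I \<and> I \<subseteq> genid (loc0 D) G" using G by blast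
qed

lemma noeth_kx: "noeth (kx :: 'k::field fps set)"
  by (rule noeth_adj[OF kk_subring noeth_kk])

context independent_series
begin

text \<open>The ring \<open>V[y,z]\<close> with \<open>V = k(x,\<alpha>,\<beta>) \<inter> k[[x]]\<close>: it contains \<open>D 0\<close>, \<open>s\<close> and \<open>t\<close>, it is
  Noetherian, and \<open>x\<close> can be cancelled in it.\<close>

definition "W = polyYZ (frac_set N)"

lemma W_subring: "is_subring W"
  unfolding W_def by (rule polyYZ_subring[OF frac_set_subring[OF N_subring]])

lemma W_noeth: "noeth W"
  unfolding W_def by (rule polyYZ_noeth[OF frac_set_subring[OF N_subring] frac_set_noeth[OF N_subring]])

lemma kx_N: "kx \<subseteq> N" unfolding N_def using adj_base[OF kx_subring] adj_base[OF kxa_subring] by blast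

lemma \<alpha>_N: "\<alpha> \<in> N" and \<beta>_N: "\<beta> \<in> N"
  unfolding N_def using adj_base[OF kxa_subring] adj_gen[OF kx_subring] adj_gen[OF kxa_subring] by blast+

lemma N_frac: "N \<subseteq> frac_set N" by (rule frac_set_base[OF N_subring])

lemma kxyz_W: "kxyz \<subseteq> W" unfolding W_def using polyYZ_mono kx_N N_frac by blast

lemma st_W: "s \<in> W" "t \<in> W"
proof -
  note F = frac_set_subring[OF N_subring]
  have "in_x \<alpha> \<in> W" "in_x \<beta> \<in> W" unfolding W_def using \<alpha>_N \<beta>_N N_frac by (auto intro: polyYZ_in_x[OF F])
  moreover have "Ys \<in> W" "Zs \<in> W" unfolding W_def by (rule polyYZ_Ys[OF F], rule polyYZ_Zs[OF F])
  ultimately show "s \<in> W" "t \<in> W" unfolding s_def t_def by (auto intro: subring_diff[OF W_subring])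
qed

lemma D0_W: "D 0 \<subseteq> W"
  by (rule D_least[OF W_subring kxyz_W]) (simp_all add: f_eq g_eq subring_power[OF W_subring] st_W)

lemma W_div: "Xs ^ m * F \<in> W \<Longrightarrow> F \<in> W"
  unfolding W_def
proof (rule polyYZ_div_power)
  fix v assume "fps_X * v \<in> frac_set N"
  then obtain q where q: "q \<in> N" "q \<noteq> 0" "q * (fps_X * v) \<in> N" unfolding frac_set_def by blast
  have "fps_X \<in> N" using X_kx kx_N by blast
  then have "q * fps_X \<in> N" "q * fps_X \<noteq> 0" "q * fps_X * v \<in> N"
    using q N_subring by (auto simp: mult.assoc)
  then show "v \<in> frac_set N" unfolding frac_set_def by blast
qed

lemma D0_eq: "D 0 = adj (adj kxyz (s\<^sup>2)) (t\<^sup>2)" by (simp add: D_def f_eq g_eq)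

lemma kxyzf_M: "adj kxyz (s\<^sup>2) \<subseteq> M"
  by (rule adj_least[OF M_subring kxyz_M]) (intro subring_power[OF M_subring] s_M)

lemma D0_independent_s:
  assumes "a \<in> D 0" "b \<in> D 0" "a + b * s = 0" shows "a = 0 \<and> b = 0"
proof -
  obtain p q where p: "\<And>i. Polynomial.coeff p i \<in> adj kxyz (s\<^sup>2)" "a = poly p (t\<^sup>2)"
    and q: "\<And>i. Polynomial.coeff q i \<in> adj kxyz (s\<^sup>2)" "b = poly q (t\<^sup>2)"
    using assms(1,2) unfolding D0_eq adj_def[of _ "t\<^sup>2"] by blast
  have "p + Polynomial.smult s q = 0"
  proof (rule transcD[OF transc_square[OF M_subring transc_t]])
    show "Polynomial.coeff (p + Polynomial.smult s q) i \<in> M" for i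
      using p(1)[of i] q(1)[of i] kxyzf_M s_M by (auto intro!: subring_add[OF M_subring] subring_mult[OF M_subring])
    show "poly (p + Polynomial.smult s q) (t\<^sup>2) = 0" using assms(3) p(2) q(2) by (simp add: mult.commute)
  qed
  then have "Polynomial.coeff p i + Polynomial.coeff q i * s = 0" for i
    by (metis coeff_0 coeff_add coeff_smult mult.commute)
  then have "Polynomial.coeff p i = 0 \<and> Polynomial.coeff q i = 0" for i
    by (rule square_independent[OF kxyz_subring transc_s p(1) q(1)])
  then have "p = 0" "q = 0" by (simp_all add: poly_eq_iff)
  then show ?thesis using p q by simp
qed

text \<open>The elements \<open>1, t\<close> are independent over \<open>k[x,\<alpha>][y,z,g]\<close>, which contains \<open>D 0\<close> and \<open>s\<close>; the
  elements \<open>1, s\<close> are independent over \<open>D 0\<close>.\<close>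

lemma D0_independent:
  assumes "a \<in> D 0" "b \<in> D 0" "c \<in> D 0" "d \<in> D 0" and eq: "a + b * s + c * t + d * (s * t) = 0"
  shows "a = 0" "b = 0" "c = 0" "d = 0"
proof -
  have R: "is_subring (adj M (t\<^sup>2))" by (rule adj_subring[OF M_subring])
  have DR: "D 0 \<subseteq> adj M (t\<^sup>2)" unfolding D0_eq by (rule adj_mono[OF kxyzf_M])
  have sR: "s \<in> adj M (t\<^sup>2)" using adj_base[OF M_subring] s_M by blast
  have "a + b * s \<in> adj M (t\<^sup>2)" "c + d * s \<in> adj M (t\<^sup>2)"
    using assms DR sR by (auto intro!: subring_add[OF R] subring_mult[OF R])
  moreover have "(a + b * s) + (c + d * s) * t = 0" using eq by (simp add: algebra_simps)
  ultimately have "a + b * s = 0 \<and> c + d * s = 0" by (rule square_independent[OF M_subring transc_t])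
  then show "a = 0" "b = 0" "c = 0" "d = 0" using D0_independent_s assms by blast+
qed

text \<open>The module with generators \<open>1, s, t, st\<close> over \<open>D 0\<close>. It is a ring because \<open>s\<^sup>2 = f\<close> and
  \<open>t\<^sup>2 = g\<close>, and it contains \<open>\<alpha> = y - s\<close> and \<open>\<beta> = z - t\<close>.\<close>

definition "E = {a + b * s + c * t + d * (s * t) | a b c d. a \<in> D 0 \<and> b \<in> D 0 \<and> c \<in> D 0 \<and> d \<in> D 0}"

lemma EI: "a \<in> D 0 \<Longrightarrow> b \<in> D 0 \<Longrightarrow> c \<in> D 0 \<Longrightarrow> d \<in> D 0 \<Longrightarrow> a + b * s + c * t + d * (s * t) \<in> E"
  unfolding E_def by blast

lemma E_subring: "is_subring E"
proof (rule is_subringI)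
  note T = D_subring[of 0]
  show "1 \<in> E" using EI[of 1 0 0 0] T by auto
  fix v assume "v \<in> E"
  then obtain a b c d where v: "v = a + b * s + c * t + d * (s * t)" "a \<in> D 0" "b \<in> D 0" "c \<in> D 0" "d \<in> D 0"
    unfolding E_def by blast
  have "- v = (- a) + (- b) * s + (- c) * t + (- d) * (s * t)" using v(1) by simp
  then show "- v \<in> E" using EI[of "- a" "- b" "- c" "- d"] v T by simp
  fix w assume "w \<in> E"
  then obtain a' b' c' d' where w: "w = a' + b' * s + c' * t + d' * (s * t)" "a' \<in> D 0" "b' \<in> D 0" "c' \<in> D 0" "d' \<in> D 0"
    unfolding E_def by blast
  have "v + w = (a + a') + (b + b') * s + (c + c') * t + (d + d') * (s * t)"
    unfolding v(1) w(1) by (simp add: algebra_simps)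
  moreover have "(a + a') + (b + b') * s + (c + c') * t + (d + d') * (s * t) \<in> E"
    using v(2-) w(2-) by (intro EI subring_add[OF T])
  ultimately show "v + w \<in> E" by (simp only:)
  define u where "u = (a * a' + b * b' * f + c * c' * g + d * d' * f * g)
      + (a * b' + b * a' + (c * d' + d * c') * g) * s
      + (a * c' + c * a' + (b * d' + d * b') * f) * t
      + (a * d' + d * a' + b * c' + c * b') * (s * t)"
  have "f \<in> D 0" "g \<in> D 0" using fr_D[of 0] by simp_all
  then have "u \<in> E" unfolding u_def using v(2-) w(2-)
    by (intro EI subring_add[OF T] subring_mult[OF T])
  moreover have "v * w = u"
    unfolding v(1) w(1) u_def f_eq g_eq by (simp add: algebra_simps power2_eq_square)
  ultimately show "v * w \<in> E" by simp
qed

lemma polyYZ_N_E: "polyYZ N \<subseteq> E"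
proof (rule polyYZ_least[OF E_subring])
  note T = D_subring[of 0]
  have T_E: "D 0 \<subseteq> E" using EI[of _ 0 0 0] T by auto
  then have kE: "kxyz \<subseteq> E" using kxyz_D by blast
  show yz: "Ys \<in> E" "Zs \<in> E" using kE polyYZ_Ys[OF kx_subring] polyYZ_Zs[OF kx_subring] by blast+
  have "s \<in> E" "t \<in> E" using EI[of 0 1 0 0] EI[of 0 0 1 0] T by auto
  then have "Ys - s \<in> E" "Zs - t \<in> E" using yz E_subring by blast+
  then have ab: "in_x \<alpha> \<in> E" "in_x \<beta> \<in> E" by (simp_all add: s_def t_def)
  have S: "is_subring {v. in_x v \<in> E}"
    using E_subring unfolding is_subring_def[of "Collect _"] by (simp add: in_x_1 in_x_diff in_x_mult)
  have "N \<subseteq> {v. in_x v \<in> E}"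
    unfolding N_def
  proof (rule adj_least[OF S adj_least[OF S]])
    show "kx \<subseteq> {v. in_x v \<in> E}" using subsetD[OF kE polyYZ_in_x[OF kx_subring]] by auto
  qed (use ab in simp_all)
  then show "in_x ` N \<subseteq> E" by blast
qed

lemma st_approx: "\<exists>p\<in>kxyz. Xs ^ m dvd s - p" "\<exists>p\<in>kxyz. Xs ^ m dvd t - p"
proof -
  obtain v where "v \<in> kx" "Xs ^ m dvd in_x \<alpha> - in_x v" using in_x_trunc[of m \<alpha>] by blast
  moreover have "s - (Ys - in_x v) = - (in_x \<alpha> - in_x v)" by (simp add: s_def)
  ultimately have "Ys - in_x v \<in> kxyz" "Xs ^ m dvd s - (Ys - in_x v)"
    using subring_diff[OF kxyz_subring polyYZ_Ys[OF kx_subring] polyYZ_in_x[OF kx_subring, of v]]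
    by (simp_all only: dvd_minus_iff)
  then show "\<exists>p\<in>kxyz. Xs ^ m dvd s - p" by blast
  obtain v where "v \<in> kx" "Xs ^ m dvd in_x \<beta> - in_x v" using in_x_trunc[of m \<beta>] by blast
  moreover have "t - (Zs - in_x v) = - (in_x \<beta> - in_x v)" by (simp add: t_def)
  ultimately have "Zs - in_x v \<in> kxyz" "Xs ^ m dvd t - (Zs - in_x v)"
    using subring_diff[OF kxyz_subring polyYZ_Zs[OF kx_subring] polyYZ_in_x[OF kx_subring, of v]]
    by (simp_all only: dvd_minus_iff)
  then show "\<exists>p\<in>kxyz. Xs ^ m dvd t - p" by blast
qed

text \<open>Finitely many truncations have a common denominator, the product of their denominators.\<close>

lemma approx_polynomial:
  assumes I: "finite I" and a: "\<And>i. i \<in> I \<Longrightarrow> a i \<in> Rst"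
  shows "\<exists>d\<in>kyz. cc d \<noteq> 0 \<and> (\<exists>e. \<forall>i\<in>I. e i \<in> kxyz \<and> Xs ^ m dvd d * a i - e i)"
  using assms
proof (induction I)
  case empty
  then show ?case using kyz_subring by (intro bexI[of _ 1]) auto
next
  case (insert j I)
  then obtain d e where d: "d \<in> kyz" "cc d \<noteq> 0" and e: "\<And>i. i \<in> I \<Longrightarrow> e i \<in> kxyz \<and> Xs ^ m dvd d * a i - e i"
    by blast
  obtain d' e' where d': "d' \<in> kyz" "cc d' \<noteq> 0" "e' \<in> kxyz" "Xs ^ m dvd d' * a j - e'"
    using Rst_approx[OF insert.prems[of j] kx_subring kk_kx X_kx, where m = m] by blast
  define e'' where "e'' = (\<lambda>i. if i = j then d * e' else d' * e i)"
  have dk: "d \<in> kxyz" "d' \<in> kxyz" using d d' kyz_kxyz by blast+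
  have "e'' i \<in> kxyz \<and> Xs ^ m dvd d * d' * a i - e'' i" if i: "i \<in> insert j I" for i
  proof (cases "i = j")
    case True
    have "d * d' * a i - e'' i = d * (d' * a j - e')" using True by (simp add: e''_def algebra_simps)
    then show ?thesis using True d' dk kxyz_subring by (auto simp: e''_def)
  next
    case False
    then have ei: "e i \<in> kxyz" "Xs ^ m dvd d * a i - e i" using e[of i] i by auto
    have "d * d' * a i - e'' i = d' * (d * a i - e i)" using False by (simp add: e''_def algebra_simps)
    then show ?thesis using False ei dk kxyz_subring by (auto simp: e''_def)
  qed
  moreover have "d * d' \<in> kyz" "cc (d * d') \<noteq> 0" using d d' kyz_subring by auto
  ultimately show ?case by blast
qed

text \<open>Truncate the coefficients \<open>a i\<close> at \<open>x\<close> to the power \<open>m + c\<close>; the sum is then \<open>x\<^sup>m x\<^sup>c b\<close> for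
  some \<open>b\<close> in \<open>W\<close>. If \<open>c\<close> is an exponent at which the ideals \<open>((h) : x\<^sup>n)\<close> have become stationary,
  then \<open>x\<^sup>c b\<close> is in \<open>(h)\<close>, so a correction of the truncated coefficients by multiples of \<open>x\<^sup>m\<close>
  turns the sum into \<open>0\<close>. The factor \<open>d\<close>, a unit of \<open>k[[x,y,z]]\<close>, clears the denominators of the
  truncations.\<close>

lemma relation_in_W:
  assumes I: "finite I" and h: "\<And>i. i \<in> I \<Longrightarrow> h i \<in> W" and a: "\<And>i. i \<in> I \<Longrightarrow> a i \<in> Rst"
    and rel: "(\<Sum>i\<in>I. a i * h i) = 0"
  shows "\<exists>d\<in>kyz. cc d \<noteq> 0 \<and> (\<exists>e. (\<forall>i\<in>I. e i \<in> W \<and> Xs ^ m dvd d * a i - e i) \<and> (\<Sum>i\<in>I. e i * h i) = 0)"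
proof -
  have XW: "Xs \<in> W" using Xs_kxyz kxyz_W by blast
  have J: "ideal_in W (genid W (h ` I))" using h by (intro genid_ideal W_subring) blast
  from colon_stabilizes[OF W_subring W_noeth J XW] obtain c
    where "\<forall>n. \<forall>b\<in>W. Xs ^ n * b \<in> genid W (h ` I) \<longrightarrow> Xs ^ c * b \<in> genid W (h ` I)" by (rule exE)
  then have c: "Xs ^ c * b \<in> genid W (h ` I)" if "b \<in> W" "Xs ^ n * b \<in> genid W (h ` I)" for n b
    using that by blast
  have "\<exists>d\<in>kyz. cc d \<noteq> 0 \<and> (\<exists>e. \<forall>i\<in>I. e i \<in> kxyz \<and> Xs ^ (m + c) dvd d * a i - e i)"
    by (rule approx_polynomial[OF I a])
  then obtain d where d: "d \<in> kyz" "cc d \<noteq> 0"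
    and ex: "\<exists>e. \<forall>i\<in>I. e i \<in> kxyz \<and> Xs ^ (m + c) dvd d * a i - e i" by (elim bexE conjE)
  from ex obtain e where "\<forall>i\<in>I. e i \<in> kxyz \<and> Xs ^ (m + c) dvd d * a i - e i" by (rule exE)
  then have e: "e i \<in> kxyz \<and> Xs ^ (m + c) dvd d * a i - e i" if "i \<in> I" for i using that by (rule bspec)
  have eW: "e i \<in> W" if "i \<in> I" for i using e that kxyz_W by blast
  have "(\<Sum>i\<in>I. e i * h i) = (\<Sum>i\<in>I. (e i - d * a i) * h i) + d * (\<Sum>i\<in>I. a i * h i)"
    by (simp add: left_diff_distrib sum_subtractf sum_distrib_left mult.assoc)
  also have "\<dots> = (\<Sum>i\<in>I. (e i - d * a i) * h i)" using rel by simp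
  finally have "(\<Sum>i\<in>I. e i * h i) = (\<Sum>i\<in>I. (e i - d * a i) * h i)" .
  moreover have "Xs ^ (m + c) dvd (\<Sum>i\<in>I. (e i - d * a i) * h i)"
    by (intro dvd_sum dvd_mult2 dvd_diff_swap[OF conjunct2[OF e]])
  ultimately obtain b where b: "(\<Sum>i\<in>I. e i * h i) = Xs ^ (m + c) * b" by (auto simp: dvd_def)
  have inW: "(\<Sum>i\<in>I. e i * h i) \<in> W" using eW h by (intro subring_sum[OF W_subring] subring_mult[OF W_subring])
  then have bW: "b \<in> W" using W_div b by simp
  have "(\<Sum>i\<in>I. e i * h i) \<in> genid W (h ` I)"
    using eW h by (intro genid_sumI W_subring) auto
  then have "Xs ^ c * b \<in> genid W (h ` I)" using c[OF bW] b by simp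
  then obtain e' where e': "\<And>i. e' i \<in> W" "Xs ^ c * b = (\<Sum>i\<in>I. e' i * h i)"
    using genid_imageD[OF W_subring I, of _ h] by blast
  define e'' where "e'' = (\<lambda>i. e i - Xs ^ m * e' i)"
  have "(\<Sum>i\<in>I. e'' i * h i) = Xs ^ (m + c) * b - Xs ^ m * (\<Sum>i\<in>I. e' i * h i)"
    unfolding e''_def left_diff_distrib sum_subtractf b by (simp add: sum_distrib_left mult.assoc)
  also have "\<dots> = 0" unfolding e'(2)[symmetric] by (simp add: power_add mult.assoc)
  finally have "(\<Sum>i\<in>I. e'' i * h i) = 0" .
  moreover have "e'' i \<in> W" if "i \<in> I" for i
    unfolding e''_def using eW[OF that] e'(1) XW W_subring by (intro subring_diff subring_mult subring_power)
  moreover have "Xs ^ m dvd d * a i - e'' i" if i: "i \<in> I" for i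
  proof -
    have "Xs ^ m dvd d * a i - e i" using e[OF i] by (meson dvd_trans le_add1 le_imp_power_dvd)
    then have "Xs ^ m dvd (d * a i - e i) + Xs ^ m * e' i" by simp
    also have "(d * a i - e i) + Xs ^ m * e' i = d * a i - e'' i" by (simp add: e''_def)
    finally show ?thesis .
  qed
  ultimately show ?thesis using d by blast
qed

lemma W_clear:
  assumes I: "finite I" and e: "\<And>i. i \<in> I \<Longrightarrow> e i \<in> W"
  shows "\<exists>q\<in>N. q \<noteq> 0 \<and> (\<forall>i\<in>I. in_x q * e i \<in> polyYZ N)"
proof -
  define A where "A = (\<Union>i\<in>I. (\<lambda>(a, b). lam a b (e i)) ` {(a, b). lam a b (e i) \<noteq> 0})"
  have "finite A" using I e unfolding A_def W_def polyYZ_def by (intro finite_UN_I finite_imageI) auto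
  moreover have "A \<subseteq> frac_set N" using e unfolding A_def W_def polyYZ_def by auto
  ultimately have "\<exists>q\<in>N. q \<noteq> 0 \<and> (\<forall>v\<in>A. q * v \<in> N)" by (rule common_denominator[OF N_subring])
  then obtain q where q: "q \<in> N" "q \<noteq> 0" "\<forall>v\<in>A. q * v \<in> N" by (elim bexE conjE)
  have "in_x q * e i \<in> polyYZ N" if i: "i \<in> I" for i
  proof -
    have "q * lam a b (e i) \<in> N" for a b
    proof (cases "lam a b (e i) = 0")
      case False
      then have "lam a b (e i) \<in> A" unfolding A_def using i by force
      then show ?thesis by (rule bspec[OF q(3)])
    qed (use N_subring in simp)
    moreover have "finite {(a, b). q * lam a b (e i) \<noteq> 0}"
    proof (rule finite_subset)
      show "finite {(a, b). lam a b (e i) \<noteq> 0}" using e[OF i] by (simp add: W_def polyYZ_def)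
    qed auto
    ultimately show ?thesis by (simp add: polyYZ_def)
  qed
  then show ?thesis using q(1,2) by blast
qed

text \<open>After multiplication by a common denominator \<open>q\<close> from \<open>k[x,\<alpha>,\<beta>]\<close>, the coefficients of the
  relation over \<open>W\<close> lie in \<open>E\<close>, and as the \<open>h i\<close> lie in \<open>D 0\<close>, each of the four components is a
  relation over \<open>D 0\<close>. Replacing \<open>s\<close> and \<open>t\<close> by polynomials \<open>p\<close> and \<open>r\<close> close to them combines
  these into one relation over \<open>D 0\<close>. Writing \<open>q = x\<^sup>n q0\<close> with a unit \<open>q0\<close> shows how the result
  is related to the given coefficients.\<close>

lemma relation_in_D0:
  assumes I: "finite I" and h: "\<And>i. i \<in> I \<Longrightarrow> h i \<in> D 0" and a: "\<And>i. i \<in> I \<Longrightarrow> a i \<in> Rst"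
    and rel: "(\<Sum>i\<in>I. a i * h i) = 0"
  shows "\<exists>u\<in>Rst. cc u \<noteq> 0 \<and> (\<exists>n e. (\<forall>i\<in>I. e i \<in> D 0 \<and> Xs ^ (n + m) dvd Xs ^ n * (u * a i) - e i) \<and> (\<Sum>i\<in>I. e i * h i) = 0)"
proof -
  have hW: "h i \<in> W" if "i \<in> I" for i using h[OF that] D0_W by blast
  have "\<exists>d\<in>kyz. cc d \<noteq> 0 \<and> (\<exists>e. (\<forall>i\<in>I. e i \<in> W \<and> Xs ^ m dvd d * a i - e i) \<and> (\<Sum>i\<in>I. e i * h i) = 0)"
    by (rule relation_in_W[OF I hW a rel])
  then obtain d w where d: "d \<in> kyz" "cc d \<noteq> 0" and w': "\<forall>i\<in>I. w i \<in> W \<and> Xs ^ m dvd d * a i - w i"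
      and w3: "(\<Sum>i\<in>I. w i * h i) = 0" by (elim bexE conjE exE)
  have w: "w i \<in> W" "Xs ^ m dvd d * a i - w i" if "i \<in> I" for i using bspec[OF w' that] by auto
  have "\<exists>q\<in>N. q \<noteq> 0 \<and> (\<forall>i\<in>I. in_x q * w i \<in> polyYZ N)" by (rule W_clear[OF I w(1)])
  then obtain q where q: "q \<in> N" "q \<noteq> 0" "\<forall>i\<in>I. in_x q * w i \<in> polyYZ N" by (elim bexE conjE)
  have "\<exists>A1 A2 A3 A4. A1 \<in> D 0 \<and> A2 \<in> D 0 \<and> A3 \<in> D 0 \<and> A4 \<in> D 0 \<and>
      in_x q * w i = A1 + A2 * s + A3 * t + A4 * (s * t)" if "i \<in> I" for i
  proof -
    have "in_x q * w i \<in> E" using bspec[OF q(3) that] polyYZ_N_E by (rule rev_subsetD)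
    then show ?thesis unfolding E_def by blast
  qed
  then obtain A1 A2 A3 A4 where A: "\<And>i. i \<in> I \<Longrightarrow> A1 i \<in> D 0" "\<And>i. i \<in> I \<Longrightarrow> A2 i \<in> D 0"
      "\<And>i. i \<in> I \<Longrightarrow> A3 i \<in> D 0" "\<And>i. i \<in> I \<Longrightarrow> A4 i \<in> D 0"
    and Aeq: "\<And>i. i \<in> I \<Longrightarrow> in_x q * w i = A1 i + A2 i * s + A3 i * t + A4 i * (s * t)" by metis
  let ?S = "\<lambda>A. \<Sum>i\<in>I. A i * h i"
  have SD: "?S A1 \<in> D 0" "?S A2 \<in> D 0" "?S A3 \<in> D 0" "?S A4 \<in> D 0"
    using A h by (auto intro!: subring_sum[OF D_subring] subring_mult[OF D_subring])
  have comb: "?S A1 + ?S A2 * y + ?S A3 * z + ?S A4 * (y * z) =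
      (\<Sum>i\<in>I. (A1 i + A2 i * y + A3 i * z + A4 i * (y * z)) * h i)" for y z
  proof -
    have "(A1 i + A2 i * y + A3 i * z + A4 i * (y * z)) * h i =
        A1 i * h i + (A2 i * h i) * y + (A3 i * h i) * z + (A4 i * h i) * (y * z)" for i
      by (simp add: algebra_simps)
    then show ?thesis by (simp add: sum.distrib sum_distrib_right)
  qed
  have "?S A1 + ?S A2 * s + ?S A3 * t + ?S A4 * (s * t) = (\<Sum>i\<in>I. (in_x q * w i) * h i)"
    unfolding comb by (intro sum.cong refl) (simp add: Aeq)
  also have "\<dots> = in_x q * (\<Sum>i\<in>I. w i * h i)" by (simp add: sum_distrib_left mult.assoc)
  also have "\<dots> = 0" using w3 by simp
  finally have S0: "?S A1 = 0" "?S A2 = 0" "?S A3 = 0" "?S A4 = 0" using D0_independent[OF SD] by blast+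
  \<comment> \<open>\<open>q = x\<^sup>n q0\<close> with a unit \<open>q0\<close> of \<open>k[[x]]\<close>\<close>
  define n where "n = subdegree q"
  define q0 where "q0 = fps_shift n q"
  have qn: "q = fps_X ^ n * q0"
    using fps_shift_times_fps_X_power[of n q] by (simp add: n_def q0_def mult.commute)
  have q00: "fps_nth q0 0 \<noteq> 0" using q(2) by (simp add: q0_def n_def)
  obtain p r where p: "p \<in> kxyz" "Xs ^ (n + m) dvd s - p" and r: "r \<in> kxyz" "Xs ^ (n + m) dvd t - r"
    using st_approx[of "n + m"] by blast
  have prD: "p \<in> D 0" "r \<in> D 0" using p r kxyz_D by blast+
  define e where "e = (\<lambda>i. A1 i + A2 i * p + A3 i * r + A4 i * (p * r))"
  define u where "u = in_x q0 * d"
  have "u \<in> Rst" unfolding u_def using in_x_Rst d(1) polyYZ_Rst by (intro subring_mult[OF Rst_subring]) blast+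
  moreover have "cc u \<noteq> 0" using q00 d(2) by (simp add: u_def cc_def[of "in_x q0"] co_in_x)
  moreover have "e i \<in> D 0" if "i \<in> I" for i
    unfolding e_def using A[OF that] prD by (intro subring_add[OF D_subring] subring_mult[OF D_subring])
  moreover have "(\<Sum>i\<in>I. e i * h i) = ?S A1 + ?S A2 * p + ?S A3 * r + ?S A4 * (p * r)"
    unfolding comb e_def ..
  then have "(\<Sum>i\<in>I. e i * h i) = 0" using S0 by simp
  moreover have "Xs ^ (n + m) dvd Xs ^ n * (u * a i) - e i" if i: "i \<in> I" for i
  proof -
    have "in_x q * w i - e i = A2 i * (s - p) + A3 i * (t - r) + A4 i * (s * (t - r) + r * (s - p))"
      unfolding Aeq[OF i] e_def by (simp add: algebra_simps)
    also have "Xs ^ (n + m) dvd \<dots>" using p(2) r(2) by (intro dvd_add dvd_mult)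
    finally have 1: "Xs ^ (n + m) dvd in_x q * w i - e i" .
    have "in_x q = Xs ^ n * in_x q0" by (simp add: qn in_x_mult in_x_power in_x_X)
    then have "Xs ^ n * (u * a i) - in_x q * w i = Xs ^ n * (in_x q0 * (d * a i - w i))"
      by (simp add: u_def algebra_simps)
    also have "Xs ^ (n + m) dvd \<dots>" unfolding power_add using w(2)[OF i] by (intro mult_dvd_mono dvd_mult) auto
    finally have "Xs ^ (n + m) dvd (Xs ^ n * (u * a i) - in_x q * w i) + (in_x q * w i - e i)" using 1 by (rule dvd_add)
    then show ?thesis by simp
  qed
  ultimately show ?thesis by blast
qed

text \<open>After multiplication of the \<open>h i\<close> by a common denominator, the previous lemma applies. In
  \<open>B\<close> the factor \<open>x\<^sup>n\<close> can be cancelled, and the unit \<open>u\<close> of \<open>R\<^sup>*\<close> can be cancelled approximately,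
  because \<open>B\<close> is dense in \<open>R\<^sup>*\<close>.\<close>

lemma relation_in_B:
  assumes I: "finite I" and h: "\<And>i. i \<in> I \<Longrightarrow> h i \<in> B" and a: "\<And>i. i \<in> I \<Longrightarrow> a i \<in> Rst"
    and rel: "(\<Sum>i\<in>I. a i * h i) = 0"
  shows "\<exists>e. (\<forall>i\<in>I. e i \<in> B \<and> Xs ^ m dvd a i - e i) \<and> (\<Sum>i\<in>I. e i * h i) = 0"
proof -
  have "h ` I \<subseteq> frac_set (D 0)" using h B_frac by blast
  then have "\<exists>q\<in>D 0. q \<noteq> 0 \<and> (\<forall>v\<in>h ` I. q * v \<in> D 0)"
    by (rule common_denominator[OF D_subring finite_imageI[OF I]])
  then obtain q where q: "q \<in> D 0" "q \<noteq> 0" "\<forall>v\<in>h ` I. q * v \<in> D 0" by (elim bexE conjE)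
  have rel': "(\<Sum>i\<in>I. a i * (q * h i)) = 0"
    using rel by (simp add: mult.left_commute[of _ q] sum_distrib_left[symmetric])
  have qh: "q * h i \<in> D 0" if "i \<in> I" for i using q(3) that by simp
  have "\<exists>u\<in>Rst. cc u \<noteq> 0 \<and> (\<exists>n e. (\<forall>i\<in>I. e i \<in> D 0 \<and> Xs ^ (n + m) dvd Xs ^ n * (u * a i) - e i)
      \<and> (\<Sum>i\<in>I. e i * (q * h i)) = 0)"
    by (rule relation_in_D0[OF I qh a rel'])
  then obtain u n e where u: "u \<in> Rst" "cc u \<noteq> 0"
     and e': "\<forall>i\<in>I. e i \<in> D 0 \<and> Xs ^ (n + m) dvd Xs ^ n * (u * a i) - e i"
     and e3: "(\<Sum>i\<in>I. e i * (q * h i)) = 0" by (elim bexE conjE exE)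
  have e: "e i \<in> D 0" "Xs ^ (n + m) dvd Xs ^ n * (u * a i) - e i" if "i \<in> I" for i using bspec[OF e' that] by auto
  have "\<exists>e'. e i = Xs ^ n * e' \<and> e' \<in> B \<and> Xs ^ m dvd u * a i - e'" if i: "i \<in> I" for i
  proof -
    obtain z where z: "Xs ^ n * (u * a i) - e i = Xs ^ (n + m) * z" using e(2)[OF i] by (auto simp: dvd_def)
    \<comment> \<open>the quotient of \<open>e i\<close> by \<open>x\<^sup>n\<close>, still congruent to \<open>u a i\<close> modulo \<open>x\<^sup>m\<close>\<close>
    define e' where "e' = u * a i - Xs ^ m * z"
    have ee: "e i = Xs ^ n * e'" using z by (simp add: e'_def power_add algebra_simps)
    have "Xs ^ n * e' \<in> B" using e(1)[OF i] D_B[of 0] ee by auto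
    then have "e' \<in> B" by (rule B_div_power)
    then show ?thesis using ee by (auto simp: e'_def)
  qed
  then obtain e' where e': "\<And>i. i \<in> I \<Longrightarrow> e i = Xs ^ n * e' i" "\<And>i. i \<in> I \<Longrightarrow> e' i \<in> B"
     "\<And>i. i \<in> I \<Longrightarrow> Xs ^ m dvd u * a i - e' i" by metis
  obtain v where v: "u * v = 1" using pser_unit[OF u(2)] by blast
  obtain b where b: "b \<in> B" "Xs ^ m dvd v - b" using B_dense Rst_unit[OF u v] by blast
  have "0 = Xs ^ n * q * (\<Sum>i\<in>I. e' i * h i)"
    unfolding e3[symmetric] by (simp add: e'(1) sum_distrib_left mult_ac)
  then have "(\<Sum>i\<in>I. e' i * h i) = 0" using q(2) by simp
  then have "(\<Sum>i\<in>I. (b * e' i) * h i) = 0" by (simp add: mult.assoc sum_distrib_left[symmetric])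
  moreover have "b * e' i \<in> B" if "i \<in> I" for i using b e'(2)[OF that] B_subring by auto
  moreover have "Xs ^ m dvd a i - b * e' i" if i: "i \<in> I" for i
  proof -
    have "a i - b * e' i = (u * v) * a i - b * e' i" using v by simp
    also have "\<dots> = (v - b) * (u * a i) + b * (u * a i - e' i)" by (simp add: algebra_simps)
    also have "Xs ^ m dvd \<dots>" using b(2) e'(3)[OF i] by (intro dvd_add dvd_mult dvd_mult2)
    finally show ?thesis .
  qed
  ultimately show ?thesis by (intro exI[of _ "\<lambda>i. b * e' i"]) auto
qed

section \<open>The Noetherian property of B and the equality A = B\<close>

lemma noeth_D: "noeth (D r)"
  unfolding D_def
  by (intro noeth_adj kxyza_subring kxyz_subring polyYZ_noeth[OF kx_subring noeth_kx])

lemma Rst_complete: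
  assumes c: "\<And>j. c j \<in> Rst"
  shows "\<exists>t\<in>Rst. \<forall>n. Xs ^ n dvd t - (\<Sum>j<n. c j * Xs ^ j)"
proof -
  define P where "P = (\<lambda>n. \<Sum>j<n. c j * Xs ^ j)"
  have P: "P n \<in> Rst" for n unfolding P_def
    using c Xs_Rst by (intro subring_sum[OF Rst_subring] subring_mult[OF Rst_subring] subring_power[OF Rst_subring])
  \<comment> \<open>the coefficient with index \<open>m\<close> is the same in all partial sums from \<open>P (m + 1)\<close> on\<close>
  define t where "t = Abs_fps (\<lambda>m. fps_nth (P (Suc m)) m)"
  have "t \<in> Rst" using P by (simp add: Rst_def t_def)
  moreover have "Xs ^ n dvd t - P n" for n
    unfolding Xs_power_dvd_iff
  proof (intro allI impI)
    fix m assume m: "m < n"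
    have "(\<Sum>j<n. fps_nth (c j * Xs ^ j) m) = (\<Sum>j<Suc m. fps_nth (c j * Xs ^ j) m)"
    proof (rule sum.mono_neutral_right)
      show "\<forall>j\<in>{..<n} - {..<Suc m}. fps_nth (c j * Xs ^ j) m = 0"
        by (auto simp: Xs_def mult.commute[of _ "fps_X ^ _"] fps_X_power_mult_nth)
    qed (use m in auto)
    then show "fps_nth (t - P n) m = 0" by (simp add: t_def P_def fps_sum_nth)
  qed
  ultimately show ?thesis unfolding P_def by blast
qed

text \<open>The ring \<open>B/xB\<close> is the Noetherian ring \<open>k[y,z]_(y,z)\<close>.\<close>

lemma B_mod_Xs:
  assumes J: "ideal_in B J"
  shows "\<exists>G. finite G \<and> G \<subseteq> J \<and> (\<forall>a\<in>J. \<exists>u\<in>genid B G. \<exists>b. a = u + Xs * b)"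
proof -
  let ?L = "loc0 kyz :: 'k pser set"
  have L: "is_subring ?L" by (rule loc0_subring[OF kyz_subring])
  define K where "K = {b \<in> ?L. \<exists>a\<in>J. Xs dvd a - b}"
  have "ideal_in ?L K"
    unfolding ideal_in_def
  proof (intro conjI ballI)
    show "K \<subseteq> ?L" by (auto simp: K_def)
    show "0 \<in> K" using L ideal_in_zero[OF J] by (auto simp: K_def)
  next
    fix b b' assume "b \<in> K" "b' \<in> K"
    then obtain a a' where *: "b \<in> ?L" "b' \<in> ?L" "a \<in> J" "a' \<in> J" "Xs dvd a - b" "Xs dvd a' - b'" by (auto simp: K_def)
    have "Xs dvd (a - b) + (a' - b')" using * by (intro dvd_add)
    then have "Xs dvd (a + a') - (b + b')" by (simp add: algebra_simps)
    then show "b + b' \<in> K" using * L ideal_in_add[OF J] unfolding K_def by blast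
  next
    fix r b assume "r \<in> ?L" "b \<in> K"
    then obtain a where *: "b \<in> ?L" "r \<in> ?L" "a \<in> J" "Xs dvd a - b" by (auto simp: K_def)
    have "Xs dvd r * (a - b)" using * by (intro dvd_mult)
    then have "Xs dvd r * a - r * b" by (simp add: algebra_simps)
    moreover have "r * a \<in> J" using * loc0_kyz_B ideal_in_lmult[OF J] by blast
    ultimately show "r * b \<in> K" using * L unfolding K_def by blast
  qed
  then obtain G where G: "finite G" "G \<subseteq> K" "K \<subseteq> genid ?L G"
    by (rule noethE[OF loc0_noeth[OF kyz_subring polyYZ_noeth[OF kk_subring noeth_kk]]])
  have "\<forall>b\<in>G. \<exists>a\<in>J. Xs dvd a - b" using G(2) by (auto simp: K_def)
  then obtain l where l: "\<And>b. b \<in> G \<Longrightarrow> l b \<in> J" "\<And>b. b \<in> G \<Longrightarrow> Xs dvd l b - b" by metis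
  have "\<exists>u\<in>genid B (l ` G). \<exists>b. a = u + Xs * b" if a: "a \<in> J" for a
  proof -
    have aR: "a \<in> Rst" using ideal_in_carrier[OF J a] B_Rst by blast
    define b where "b = fps_const (fps_nth a 0)"
    have ab: "Xs dvd a - b" using Xs_power_dvd_iff[of 1 "a - b"] by (simp add: b_def)
    have "b \<in> K" using a ab aR by (auto simp: K_def Rst_def b_def)
    then obtain c where c: "\<And>i. c i \<in> ?L" "b = (\<Sum>i\<in>G. c i * i)" using genidD[OF L G(1)] G(3) by blast
    define u where "u = (\<Sum>i\<in>G. c i * l i)"
    have "u \<in> genid B (l ` G)"
      unfolding u_def using c(1) loc0_kyz_B l(1) ideal_in_subset[OF J] by (intro genid_sumI B_subring) blast+
    moreover have "Xs dvd b - u"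
      unfolding c(2) u_def sum_subtractf[symmetric] right_diff_distrib[symmetric]
      by (intro dvd_sum dvd_mult dvd_diff_swap[OF l(2)])
    then have "Xs dvd (a - b) + (b - u)" using ab by (intro dvd_add)
    then obtain z where "a - u = Xs * z" by (auto simp: dvd_def)
    then have "a = u + Xs * z" by (simp add: algebra_simps)
    ultimately show ?thesis by blast
  qed
  then show ?thesis using G(1) l(1) by (intro exI[of _ "l ` G"]) auto
qed

text \<open>The ring \<open>B[1/x]\<close> is a localization of the Noetherian ring \<open>D 0\<close>.\<close>

lemma B_inverted_Xs:
  assumes J: "ideal_in B J"
  shows "\<exists>G. finite G \<and> G \<subseteq> J \<and> (\<forall>a\<in>J. \<exists>n. Xs ^ n * a \<in> genid B G)"
proof -
  have "ideal_in (D 0) (J \<inter> D 0)"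
    using D_subring[of 0] D_B[of 0] ideal_in_zero[OF J] ideal_in_add[OF J] ideal_in_lmult[OF J] unfolding ideal_in_def by blast
  then obtain G where G: "finite G" "G \<subseteq> J \<inter> D 0" "J \<inter> D 0 \<subseteq> genid (D 0) G" by (rule noethE[OF noeth_D])
  have id: "ideal_in B (genid B G)" using G(2) D_B[of 0] by (intro genid_ideal B_subring) blast
  have "\<exists>n. Xs ^ n * a \<in> genid B G" if a: "a \<in> J" for a
  proof -
    obtain n w where w: "w \<in> B" "cc w \<noteq> 0" "Xs ^ n * w \<in> D 0" "Xs ^ n * w * a \<in> D 0"
      using B_clear[OF ideal_in_carrier[OF J a]] by blast
    obtain v where v: "w * v = 1" using pser_unit[OF w(2)] by blast
    have vB: "v \<in> B" by (rule B_unit[OF w(1,2) v])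
    have "Xs ^ n * w * a \<in> J" using w(3) D_B[of 0] ideal_in_lmult[OF J _ a] by blast
    then have "Xs ^ n * w * a \<in> genid B G" using w(4) G(3) genid_mono[OF D_B order_refl] by blast
    then have "v * (Xs ^ n * w * a) \<in> genid B G" by (rule ideal_in_lmult[OF id vB])
    moreover have "v * (Xs ^ n * w * a) = (w * v) * (Xs ^ n * a)" by (simp only: mult_ac)
    ultimately show ?thesis using v by (metis mult_1)
  qed
  then show ?thesis using G by blast
qed

theorem noeth_B: "noeth B"
proof -
  interpret completion_criterion B Rst Xs
  proof
    show "\<exists>t\<in>Rst. \<forall>n. Xs ^ n dvd t - (\<Sum>j<n. c j * Xs ^ j)" if "\<And>j. c j \<in> B" for c
      using Rst_complete[of c] that B_Rst by blast
    show "\<exists>s. (\<forall>g\<in>G. s g \<in> B \<and> Xs ^ m dvd a g - s g) \<and> (\<Sum>g\<in>G. s g * g) = 0"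
      if "finite G" "G \<subseteq> B" "\<And>g. g \<in> G \<Longrightarrow> a g \<in> Rst" "(\<Sum>g\<in>G. a g * g) = 0" for G a m
      using relation_in_B[of G "\<lambda>g. g" a m] that by blast
    show "is_subring B" by (rule B_subring)
    show "is_subring Rst" by (rule Rst_subring)
    show "B \<subseteq> Rst" by (rule B_Rst)
    show "Xs \<in> B" by (rule Xs_B)
    show "a = 0" if "\<And>n. Xs ^ n dvd a" for a :: "'k pser" using that by (rule Xs_separated)
    show "b \<in> B" if "Xs * b \<in> B" for b using that by (rule B_div)
    show "\<exists>G. finite G \<and> G \<subseteq> I \<and> (\<forall>a\<in>I. \<exists>u\<in>genid B G. \<exists>b. a = u + Xs * b)" if "ideal_in B I" for I
      using that by (rule B_mod_Xs)
    show "\<exists>G. finite G \<and> G \<subseteq> I \<and> (\<forall>a\<in>I. \<exists>n. Xs ^ n * a \<in> genid B G)" if "ideal_in B I" for I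
      using that by (rule B_inverted_Xs)
  qed simp
  show ?thesis by (rule noeth_S)
qed

text \<open>For \<open>F\<close> in \<open>R\<^sup>*\<close> with \<open>qF\<close> in \<open>D 0\<close> there is a relation \<open>1 \<cdot> qF - F \<cdot> q = 0\<close>. A relation
  \<open>e1 \<cdot> qF + e2 \<cdot> q = 0\<close> over \<open>B\<close> with \<open>e1\<close> congruent to \<open>1\<close> modulo \<open>x\<close> gives \<open>F = - e2/e1\<close>, and
  \<open>e1\<close> is a unit of \<open>B\<close>.\<close>

theorem B_eq_A: "B = Rst \<inter> frac_set (D 0)"
proof
  show "B \<subseteq> Rst \<inter> frac_set (D 0)" using B_Rst B_frac by blast
  show "Rst \<inter> frac_set (D 0) \<subseteq> B"
  proof
    fix F assume "F \<in> Rst \<inter> frac_set (D 0)"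
    then obtain q where q: "F \<in> Rst" "q \<in> D 0" "q \<noteq> 0" "q * F \<in> D 0" by (auto simp: frac_set_def)
    define h where "h = (\<lambda>i::bool. if i then q * F else q)"
    define a where "a = (\<lambda>i::bool. if i then 1 else - F)"
    have "\<exists>e. (\<forall>i\<in>UNIV. e i \<in> B \<and> Xs ^ 1 dvd a i - e i) \<and> (\<Sum>i\<in>UNIV. e i * h i) = 0"
    proof (rule relation_in_B)
      show "h i \<in> B" for i using q D_B[of 0] by (auto simp: h_def)
      show "a i \<in> Rst" for i using q Rst_subring by (auto simp: a_def)
    qed (simp_all add: UNIV_bool h_def a_def mult.commute)
    then obtain e where e: "e True \<in> B" "e False \<in> B" "Xs dvd 1 - e True" "e True * (q * F) + e False * q = 0"
      by (auto simp: UNIV_bool h_def a_def add.commute)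
    obtain k where "1 - e True = Xs * k" using e(3) by (auto simp: dvd_def)
    then have "cc (1 - e True) = cc (Xs * k)" by (simp only:)
    then have c: "cc (e True) \<noteq> 0" by auto
    then obtain v where v: "e True * v = 1" using pser_unit by blast
    have vB: "v \<in> B" by (rule B_unit[OF e(1) c v])
    have "q * (e True * F + e False) = 0" using e(4) by (simp add: algebra_simps)
    then have "e True * F = - e False" using q(3) by (simp add: eq_neg_iff_add_eq_0)
    then have "(e True * v) * F = - (v * e False)" by (metis mult.commute mult.left_commute mult_minus_right)
    then have "F = - (v * e False)" using v by simp
    then show "F \<in> B" using vB e(2) B_subring by auto
  qed
qed

end

section \<open>Evaluation of power series and kernels\<close>

definition is_hom :: "('a::comm_ring_1 \<Rightarrow> 'b::comm_ring_1) \<Rightarrow> bool" where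
  "is_hom h \<longleftrightarrow> (\<forall>a b. h (a + b) = h a + h b) \<and> (\<forall>a b. h (a * b) = h a * h b) \<and> h 1 = 1"

context
  fixes h :: "'a::comm_ring_1 \<Rightarrow> 'b::comm_ring_1"
  assumes h: "is_hom h"
begin

lemma hom_add: "h (a + b) = h a + h b" and hom_mult: "h (a * b) = h a * h b" and hom_one: "h 1 = 1"
  using h by (simp_all add: is_hom_def)

lemma hom_zero: "h 0 = 0"
  using hom_add[of 0 0] by simp

lemma hom_minus: "h (- a) = - h a"
  using hom_add[of a "- a"] hom_zero by (simp add: eq_neg_iff_add_eq_0 add.commute)

lemma hom_diff: "h (a - b) = h a - h b"
  using hom_add[of a "- b"] by (simp add: hom_minus)

lemma hom_power: "h (a ^ n) = h a ^ n"
  by (induction n) (simp_all add: hom_one hom_mult)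

lemma hom_sum: "h (sum f K) = (\<Sum>i\<in>K. h (f i))"
  by (induction K rule: infinite_finite_induct) (simp_all add: hom_zero hom_add)

end

lemma hom_comp: "is_hom h \<Longrightarrow> is_hom k \<Longrightarrow> is_hom (k \<circ> h)"
  by (simp add: is_hom_def)

lemma hom_fps_const: "is_hom fps_const"
  by (simp add: is_hom_def)

lemma hom_fps_nth_0: "is_hom (\<lambda>F :: 'a::comm_ring_1 fps. fps_nth F 0)"
  by (simp add: is_hom_def)

lemma prime_kernel:
  fixes e :: "'a::comm_ring_1 \<Rightarrow> 'b::idom"
  assumes S: "is_subring S" and e: "is_hom e"
  shows "prime_in S {a \<in> S. e a = 0}"
proof -
  have "prime_in (UNIV :: 'b set) {0}" by (auto simp: prime_in_def ideal_in_def)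
  then have "prime_in S {a \<in> S. e a \<in> {0}}"
    using S hom_add[OF e] hom_mult[OF e] hom_zero[OF e] hom_one[OF e] by (intro prime_in_vimage[where T = UNIV]) auto
  then show ?thesis by simp
qed

text \<open>The substitution of \<open>c\<close> for the variable, with the coefficients mapped by \<open>h\<close>. It is meant
  for \<open>c\<close> with zero constant term, where the terms with \<open>j > n\<close> do not contribute to the
  coefficient with index \<open>n\<close>.\<close>

definition fps_eval :: "('a::comm_ring_1 \<Rightarrow> 'b::comm_ring_1 fps) \<Rightarrow> 'b fps \<Rightarrow> 'a fps \<Rightarrow> 'b fps" where
  "fps_eval h c F = Abs_fps (\<lambda>n. \<Sum>j\<le>n. fps_nth (h (fps_nth F j) * c ^ j) n)"

lemma fps_nth_mult_power:
  fixes c :: "'b::comm_ring_1 fps"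
  assumes "fps_nth c 0 = 0" "n < j" shows "fps_nth (a * c ^ j) n = 0"
proof -
  have "c = fps_X * fps_shift 1 c" using assms(1) by (auto simp: fps_eq_iff)
  then have "a * c ^ j = fps_X ^ j * (a * fps_shift 1 c ^ j)" by (metis mult.left_commute power_mult_distrib)
  then show ?thesis using assms(2) by (simp add: fps_X_power_mult_nth)
qed

lemma fps_eval_nth:
  assumes "fps_nth c 0 = 0" "n \<le> m"
  shows "fps_nth (fps_eval h c F) n = fps_nth (\<Sum>j\<le>m. h (fps_nth F j) * c ^ j) n"
proof -
  have "(\<Sum>j\<le>n. fps_nth (h (fps_nth F j) * c ^ j) n) = (\<Sum>j\<le>m. fps_nth (h (fps_nth F j) * c ^ j) n)"
    by (rule sum.mono_neutral_left) (use assms fps_nth_mult_power[OF assms(1)] in auto)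
  then show ?thesis by (simp add: fps_eval_def fps_sum_nth)
qed

lemma fps_eval_hom:
  assumes h: "is_hom h" and c: "fps_nth c 0 = 0"
  shows "is_hom (fps_eval h c)"
  unfolding is_hom_def
proof (intro conjI allI)
  show "fps_eval h c (F + G) = fps_eval h c F + fps_eval h c G" for F G
    by (rule fps_ext) (simp add: fps_eval_def hom_add[OF h] distrib_right sum.distrib)
  have "(\<Sum>j\<le>n. fps_nth (h (fps_nth 1 j) * c ^ j) n) = (\<Sum>j\<le>n. if j = 0 then fps_nth 1 n else 0)" for n
    by (intro sum.cong refl) (simp add: hom_one[OF h] hom_zero[OF h])
  then show "fps_eval h c 1 = 1"
    unfolding fps_eval_def by (intro fps_ext) (simp del: fps_one_nth)
  show "fps_eval h c (F * G) = fps_eval h c F * fps_eval h c G" for F G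
  proof (rule fps_ext)
    fix n
    define P where "P = (\<lambda>F. \<Sum>j\<le>n. h (fps_nth F j) * c ^ j)"
    define T where "T = (\<lambda>i j. fps_nth ((h (fps_nth F i) * h (fps_nth G j)) * c ^ (i + j)) n)"
    have T0: "T i j = 0" if "n < i + j" for i j
      unfolding T_def by (rule fps_nth_mult_power[OF c that])
    have "fps_nth (fps_eval h c F * fps_eval h c G) n = fps_nth (P F * P G) n"
      unfolding fps_mult_nth P_def by (intro sum.cong refl arg_cong2[of _ _ _ _ "times"] fps_eval_nth[OF c]) auto
    also have "\<dots> = (\<Sum>i\<le>n. \<Sum>j\<le>n. T i j)"
      unfolding P_def T_def by (simp add: sum_product fps_sum_nth power_add mult_ac)
    also have "\<dots> = (\<Sum>(i, j)\<in>{..n} \<times> {..n}. T i j)" by (simp add: sum.cartesian_product)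
    also have "\<dots> = (\<Sum>(i, j)\<in>{(i, j). i + j \<le> n}. T i j)"
      by (rule sum.mono_neutral_right) (use T0 in \<open>simp, force, simp add: split_beta not_le\<close>)
    also have "\<dots> = (\<Sum>k\<le>n. \<Sum>i\<le>k. T i (k - i))" by (rule sum.triangle_reindex_eq)
    also have "\<dots> = (\<Sum>k\<le>n. fps_nth (h (fps_nth (F * G) k) * c ^ k) n)"
      by (intro sum.cong refl)
        (simp add: T_def fps_mult_nth[of F G] hom_sum[OF h] hom_mult[OF h] sum_distrib_right fps_sum_nth atLeast0AtMost)
    finally show "fps_nth (fps_eval h c (F * G)) n = fps_nth (fps_eval h c F * fps_eval h c G) n"
      by (simp add: fps_eval_def)
  qed
qed

lemma fps_eval_const: assumes h: "is_hom h" shows "fps_eval h c (fps_const a) = h a"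
proof (rule fps_ext)
  fix n
  have "(\<Sum>j\<le>n. fps_nth (h (fps_nth (fps_const a) j) * c ^ j) n) = (\<Sum>j\<le>n. if j = 0 then fps_nth (h a) n else 0)"
    by (intro sum.cong refl) (simp add: hom_zero[OF h])
  then show "fps_nth (fps_eval h c (fps_const a)) n = fps_nth (h a) n" by (simp add: fps_eval_def)
qed

lemma fps_eval_X: assumes h: "is_hom h" and c: "fps_nth c 0 = 0" shows "fps_eval h c fps_X = c"
proof (rule fps_ext)
  fix n
  have "(\<Sum>j\<le>n. fps_nth (h (fps_nth fps_X j) * c ^ j) n) = (\<Sum>j\<le>n. if j = 1 then fps_nth c n else 0)"
    by (intro sum.cong refl) (simp add: hom_zero[OF h] hom_one[OF h])
  then show "fps_nth (fps_eval h c fps_X) n = fps_nth c n" using c by (cases "n = 0") (auto simp: fps_eval_def)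
qed

lemma fps_eval_coeffwise:
  assumes "\<And>n. h (fps_nth F n) = fps_const (d n)" shows "fps_eval h fps_X F = Abs_fps d"
proof (rule fps_ext)
  fix n
  have "(\<Sum>j\<le>n. fps_nth (h (fps_nth F j) * fps_X ^ j) n) = (\<Sum>j\<le>n. if j = n then d n else 0)"
    by (intro sum.cong refl) (simp add: assms)
  then show "fps_nth (fps_eval h fps_X F) n = fps_nth (Abs_fps d) n" by (simp add: fps_eval_def)
qed

text \<open>A homomorphism that is injective on \<open>S\<close> and maps \<open>u\<close> to an element transcendental over the
  image of \<open>S\<close> is injective on \<open>S[u]\<close>.\<close>

lemma adj_kernel:
  assumes e: "is_hom e" and inj: "\<And>a. a \<in> S \<Longrightarrow> e a = 0 \<Longrightarrow> a = 0" and u: "transc (e ` S) (e u)"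
    and S: "is_subring S" and a: "a \<in> adj S u" "e a = 0"
  shows "a = 0"
proof -
  obtain p where p: "a = poly p u" "\<And>i. Polynomial.coeff p i \<in> S" using a(1) unfolding adj_def by blast
  define q where "q = (\<Sum>i\<le>Polynomial.degree p. Polynomial.monom (e (Polynomial.coeff p i)) i)"
  have cq: "Polynomial.coeff q j = (if j \<le> Polynomial.degree p then e (Polynomial.coeff p j) else 0)" for j
    by (simp add: q_def coeff_sum)
  have "q = 0"
  proof (rule transcD[OF u])
    have "0 \<in> e ` S" using hom_zero[OF e] subring_zero[OF S] by (metis imageI)
    then show "Polynomial.coeff q j \<in> e ` S" for j using cq p(2) by auto
    have "poly q (e u) = e (poly p u)"
      by (simp add: q_def poly_sum poly_monom poly_altdef[of p] hom_sum[OF e] hom_mult[OF e] hom_power[OF e])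
    then show "poly q (e u) = 0" using a(2) p(1) by simp
  qed
  then have "e (Polynomial.coeff p j) = 0" if "j \<le> Polynomial.degree p" for j using cq[of j] that by simp
  then have "Polynomial.coeff p j = 0" for j
    using inj[OF p(2)] by (cases "j \<le> Polynomial.degree p") (auto simp: coeff_eq_0)
  then have "p = 0" by (simp add: poly_eq_iff)
  then show ?thesis using p by simp
qed

lemma genid_pair:
  assumes S: "is_subring S" shows "a \<in> genid S {u, v} \<longleftrightarrow> (\<exists>p\<in>S. \<exists>q\<in>S. a = p * u + q * v)"
proof
  assume "a \<in> genid S {u, v}"
  then show "\<exists>p\<in>S. \<exists>q\<in>S. a = p * u + q * v"
  proof induction
    case genid_0
    show ?case using S by (intro bexI[of _ 0]) auto
  next
    case (genid_step a r g)
    then obtain p q where pq: "p \<in> S" "q \<in> S" "a = p * u + q * v" by blast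
    from genid_step(3) consider "g = u" | "g = v" by blast
    then show ?case
    proof cases
      case 1
      have "a + r * g = (p + r) * u + q * v" using pq 1 by (simp add: algebra_simps)
      then show ?thesis using pq S genid_step(2) by blast
    next
      case 2
      have "a + r * g = p * u + (q + r) * v" using pq 2 by (simp add: algebra_simps)
      then show ?thesis using pq S genid_step(2) by blast
    qed
  qed
next
  assume "\<exists>p\<in>S. \<exists>q\<in>S. a = p * u + q * v"
  then obtain p q where pq: "p \<in> S" "q \<in> S" "a = (0 + p * u) + q * v" by auto
  show "a \<in> genid S {u, v}" unfolding pq(3) using pq(1,2) by (intro genid_step genid_0) simp_all
qed

section \<open>Order of vanishing\<close>

text \<open>Membership in the \<open>n\<close>-th power of the maximal ideal of \<open>k[[x,y,z]]\<close>.\<close>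

definition ord_ge :: "nat \<Rightarrow> 'k::field pser \<Rightarrow> bool" where
  "ord_ge n F \<longleftrightarrow> (\<forall>i a b. i + a + b < n \<longrightarrow> co F i a b = 0)"

lemma ord_ge_0 [simp]: "ord_ge 0 F" by (simp add: ord_ge_def)

lemma ord_ge_zero [simp]: "ord_ge n 0" by (simp add: ord_ge_def)

lemma ord_ge_1: "ord_ge (Suc 0) F \<longleftrightarrow> cc F = 0" by (auto simp: ord_ge_def cc_def)

lemma ord_ge_add: "ord_ge n F \<Longrightarrow> ord_ge n G \<Longrightarrow> ord_ge n (F + G)"
  and ord_ge_diff: "ord_ge n F \<Longrightarrow> ord_ge n G \<Longrightarrow> ord_ge n (F - G)" by (auto simp: ord_ge_def)

lemma ord_ge_mono: "ord_ge n F \<Longrightarrow> m \<le> n \<Longrightarrow> ord_ge m F" by (auto simp: ord_ge_def)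

lemma ord_ge_mult: assumes F: "ord_ge m F" and G: "ord_ge n G" shows "ord_ge (m + n) (F * G)"
  unfolding ord_ge_def
proof (intro allI impI)
  fix i a b assume l: "i + a + b < m + n"
  have "co F i' a' b' * co G (i - i') (a - a') (b - b') = 0" if "i' \<le> i" "a' \<le> a" "b' \<le> b" for i' a' b'
  proof (cases "i' + a' + b' < m")
    case True
    then show ?thesis using F by (simp add: ord_ge_def)
  next
    case False
    then have "(i - i') + (a - a') + (b - b') < n" using l that by linarith
    then show ?thesis using G by (simp add: ord_ge_def)
  qed
  then show "co (F * G) i a b = 0" by (simp add: fps_mult_nth fps_sum_nth sum.neutral)
qed

lemma ord_ge_lmult: "ord_ge n G \<Longrightarrow> ord_ge n (F * G)"
  using ord_ge_mult[of 0 F n G] by simp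

lemma ord_ge_separated: "(\<And>n. ord_ge n F) \<Longrightarrow> F = 0"
  by (rule pser_eqI) (auto simp: ord_ge_def)

lemma co_Ys: "co (Ys * F) n a b = (if a = 0 then 0 else co F n (a - 1) b)"
  by (simp add: Ys_def)
lemma co_Zs: "co (Zs * F) n a b = (if b = 0 then 0 else co F n a (b - 1))"
  by (simp add: Zs_def)

lemma lam_Ys: "lam a b (Ys * F) = (if a = 0 then 0 else lam (a - 1) b F)"
  by (auto simp: lam_def co_Ys fps_eq_iff)
lemma lam_Zs: "lam a b (Zs * F) = (if b = 0 then 0 else lam a (b - 1) F)"
  by (auto simp: lam_def co_Zs fps_eq_iff)

lemma polyYZ_Ys_div: assumes "Ys * F \<in> polyYZ V" shows "F \<in> polyYZ V"
proof -
  have l: "lam a b F = lam (Suc a) b (Ys * F)" for a b by (simp add: lam_Ys)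
  have "(\<lambda>(a, b). (Suc a, b)) ` {(a, b). lam a b F \<noteq> 0} \<subseteq> {(a, b). lam a b (Ys * F) \<noteq> 0}"
    by (auto simp: lam_Ys)
  then have "finite ((\<lambda>(a, b). (Suc a, b)) ` {(a, b). lam a b F \<noteq> 0})"
    using assms by (auto simp: polyYZ_def intro: finite_subset)
  then have "finite {(a, b). lam a b F \<noteq> 0}" by (rule finite_imageD) (auto simp: inj_on_def)
  then show ?thesis using assms l by (auto simp: polyYZ_def)
qed

lemma polyYZ_Zs_div: assumes "Zs * F \<in> polyYZ V" shows "F \<in> polyYZ V"
proof -
  have l: "lam a b F = lam a (Suc b) (Zs * F)" for a b by (simp add: lam_Zs)
  have "(\<lambda>(a, b). (a, Suc b)) ` {(a, b). lam a b F \<noteq> 0} \<subseteq> {(a, b). lam a b (Zs * F) \<noteq> 0}"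
    by (auto simp: lam_Zs)
  then have "finite ((\<lambda>(a, b). (a, Suc b)) ` {(a, b). lam a b F \<noteq> 0})"
    using assms by (auto simp: polyYZ_def intro: finite_subset)
  then have "finite {(a, b). lam a b F \<noteq> 0}" by (rule finite_imageD) (auto simp: inj_on_def)
  then show ?thesis using assms l by (auto simp: polyYZ_def)
qed

lemma loc0_kyz_Ys_div: assumes "Ys * F \<in> loc0 kyz" shows "F \<in> loc0 kyz"
proof -
  obtain w where w: "w \<in> kyz" "cc w \<noteq> 0" "w * (Ys * F) \<in> kyz" using assms by (auto simp: loc0_def)
  have "Ys * (w * F) \<in> kyz" using w(3) by (simp add: mult.left_commute)
  then have "w * F \<in> kyz" by (rule polyYZ_Ys_div)
  then show ?thesis using w by (auto simp: loc0_def)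
qed

text \<open>The terms of \<open>u\<close> without \<open>y\<close> are divisible by \<open>z\<close>, the others by \<open>y\<close>. Along this splitting
  the order drops by at most one.\<close>

lemma kyz_split:
  fixes u :: "'k::field pser"
  assumes u: "u \<in> kyz" "cc u = 0"
  shows "\<exists>v\<in>kyz. \<exists>w\<in>kyz. u = Ys * v + Zs * w \<and> (\<forall>n. ord_ge (Suc n) u \<longrightarrow> ord_ge n v \<and> ord_ge n w)"
proof -
  define p where "p = (fps_const (fps_const (fps_nth (fps_nth u 0) 0)) :: 'k pser)"
  define v where "v = (fps_const (fps_shift 1 (fps_nth u 0)) :: 'k pser)"
  define w where "w = (fps_const (fps_const (fps_shift 1 (fps_nth (fps_nth u 0) 0))) :: 'k pser)"
  have cv: "co v i a b = (if i = 0 then co u 0 (Suc a) b else 0)" for i a b by (simp add: v_def)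
  have cw: "co w i a b = (if i = 0 \<and> a = 0 then co u 0 0 (Suc b) else 0)" for i a b by (simp add: w_def)
  have u0: "fps_nth u (Suc i) = 0" for i using kyz_const[OF u(1)] by (metis fps_nth_fps_const nat.distinct(1))
  have pw: "p = Zs * w"
    by (rule pser_eqI) (use u(2) in \<open>simp add: co_Zs cw p_def cc_def\<close>)
  have uv: "u = Ys * v + p"
  proof (rule pser_eqI)
    fix n a b
    have "co u n a b = 0" if "n \<noteq> 0" using u0[of "n - 1"] that by simp
    then show "co u n a b = co (Ys * v + p) n a b" by (auto simp: co_Ys cv p_def)
  qed
  have "p \<in> kyz"
  proof -
    have l: "lam a b p = (if a = 0 then lam 0 b u else 0)" for a b
    proof (rule fps_ext)
      fix n
      have "co u n 0 b = 0" if "n \<noteq> 0" using u0[of "n - 1"] that by simp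
      then show "fps_nth (lam a b p) n = fps_nth (if a = 0 then lam 0 b u else 0) n" by (simp add: lam_def p_def)
    qed
    have "{(a, b). lam a b p \<noteq> 0} \<subseteq> {(a, b). lam a b u \<noteq> 0}" by (auto simp: l split: if_splits)
    then have "finite {(a, b). lam a b p \<noteq> 0}" using u(1) by (auto simp: polyYZ_def intro: finite_subset)
    moreover have "0 \<in> (kk :: 'k fps set)" by (rule subring_zero[OF kk_subring])
    ultimately show ?thesis using u(1) by (simp add: polyYZ_def l)
  qed
  have "w \<in> kyz" using \<open>p \<in> kyz\<close> pw polyYZ_Zs_div by blast
  moreover have "Ys * v = u - p" using uv by simp
  then have "v \<in> kyz" using polyYZ_Ys_div subring_diff[OF kyz_subring u(1) \<open>p \<in> kyz\<close>] by metis
  moreover have "u = Ys * v + Zs * w" using uv pw by simp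
  moreover have "ord_ge n v \<and> ord_ge n w" if "ord_ge (Suc n) u" for n
    using that by (auto simp: ord_ge_def cv cw)
  ultimately show ?thesis by blast
qed

context independent_series
begin

text \<open>Modulo \<open>x\<close>, the element \<open>b\<close> is in the maximal ideal of \<open>k[y,z]_(y,z)\<close> and can be split into
  a multiple of \<open>y\<close> and a multiple of \<open>z\<close>; the rest is \<open>x\<close> times an element of \<open>B\<close>.\<close>

lemma B_split:
  assumes b: "b \<in> B" "ord_ge (Suc n) b"
  shows "\<exists>b1\<in>B. \<exists>b2\<in>B. \<exists>b3\<in>B. ord_ge n b1 \<and> ord_ge n b2 \<and> ord_ge n b3 \<and> b = b1 * Xs + b2 * Ys + b3 * Zs"
proof -
  define c where "c = fps_const (fps_nth b 0)"
  have cL: "c \<in> loc0 kyz" using b(1) B_Rst by (auto simp: c_def Rst_def)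
  have oc: "ord_ge (Suc n) c" using b(2) by (auto simp: ord_ge_def c_def)
  obtain w where w: "w \<in> kyz" "cc w \<noteq> 0" "w * c \<in> kyz" using cL by (auto simp: loc0_def)
  obtain v where v: "w * v = 1" using pser_unit[OF w(2)] by blast
  have vL: "v \<in> loc0 kyz" using loc0_unit[OF _ w(2) v] w(1) loc0_base[OF kyz_subring] by blast
  have ou: "ord_ge (Suc n) (w * c)" by (rule ord_ge_lmult[OF oc])
  have "cc (w * c) = 0" using ord_ge_mono[OF ou, of "Suc 0"] by (simp add: ord_ge_1 del: cc_simps)
  then obtain p q where pq: "p \<in> kyz" "q \<in> kyz" "w * c = Ys * p + Zs * q" "ord_ge n p" "ord_ge n q"
    using kyz_split[OF w(3)] ou by blast
  have LB: "loc0 kyz \<subseteq> B" by (rule loc0_kyz_B)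
  have inB: "v \<in> B" "p \<in> B" "q \<in> B" using vL pq LB loc0_base[OF kyz_subring] by blast+
  have "c = v * (w * c)" using v by (metis mult.assoc mult.commute mult_1)
  also have "\<dots> = (v * p) * Ys + (v * q) * Zs" unfolding pq(3) by (simp add: algebra_simps)
  finally have c: "c = (v * p) * Ys + (v * q) * Zs" .
  have bX: "b = c + Xs * fps_shift 1 b" unfolding c_def by (rule Xs_shift)
  have "c \<in> B" using cL LB by blast
  then have "b - c \<in> B" using b(1) B_subring by blast
  moreover have "Xs * fps_shift 1 b = b - c" using bX by (metis add_diff_cancel_left')
  ultimately have sB: "fps_shift 1 b \<in> B" using B_div by metis
  have "ord_ge n (fps_shift 1 b)" using b(2) by (auto simp: ord_ge_def)
  moreover have "ord_ge n (v * p)" "ord_ge n (v * q)" using pq by (auto intro: ord_ge_lmult)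
  moreover have "b = fps_shift 1 b * Xs + (v * p) * Ys + (v * q) * Zs" using bX c by (simp add: algebra_simps)
  moreover have "v * p \<in> B" "v * q \<in> B" using inB B_subring by blast+
  ultimately show ?thesis using sB by blast
qed

lemma XYZ_B: "Xs \<in> B" "Ys \<in> B" "Zs \<in> B"
  using Xs_B D_B[of 0] kxyz_D[of 0] polyYZ_Ys[OF kx_subring] polyYZ_Zs[OF kx_subring] by blast+

lemma B_max_generated: assumes "b \<in> B" "cc b = 0" shows "b \<in> genid B {Xs, Ys, Zs}"
proof -
  have "ord_ge (Suc 0) b" using assms by (simp add: ord_ge_1)
  from B_split[OF assms(1) this] obtain b1 b2 b3
    where b: "b1 \<in> B" "b2 \<in> B" "b3 \<in> B" and "b = b1 * Xs + b2 * Ys + b3 * Zs" by blast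
  then have eq: "b = ((0 + b1 * Xs) + b2 * Ys) + b3 * Zs" by simp
  show ?thesis unfolding eq using b by (intro genid_step genid_0) simp_all
qed

subsection \<open>The prime ideal (f, g)\<close>

text \<open>The inclusion of \<open>k[[x]]\<close> in \<open>k[[z]][[x]]\<close>.\<close>

definition lift :: "'k fps \<Rightarrow> 'k fps fps" where "lift v = Abs_fps (\<lambda>n. fps_const (fps_nth v n))"

text \<open>The substitution \<open>y \<mapsto> \<alpha>\<close>, followed in \<open>ev2\<close> by \<open>z \<mapsto> \<beta>\<close>. Both fix \<open>x\<close>, the outermost
  variable.\<close>

definition ev1 :: "'k pser \<Rightarrow> 'k fps fps" where
  "ev1 = fps_eval (fps_eval fps_const (lift \<alpha>)) fps_X"

definition ev2 :: "'k fps fps \<Rightarrow> 'k fps" where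
  "ev2 = fps_eval (fps_eval fps_const \<beta>) fps_X"

definition "ev = ev2 \<circ> ev1"

lemma lift_\<alpha>_0: "fps_nth (lift \<alpha>) 0 = 0" by (simp add: lift_def \<alpha>0)

lemma ev1_hom: "is_hom ev1" and ev2_hom: "is_hom ev2" and ev_hom: "is_hom ev"
proof -
  show 1: "is_hom ev1" unfolding ev1_def
    by (intro fps_eval_hom hom_fps_const) (simp_all add: lift_\<alpha>_0)
  show 2: "is_hom ev2" unfolding ev2_def by (intro fps_eval_hom hom_fps_const) (simp_all add: \<beta>0)
  show "is_hom ev" unfolding ev_def by (rule hom_comp[OF 1 2])
qed

lemma ev1_simps: "ev1 (in_x v) = lift v" "ev1 Ys = lift \<alpha>" "ev1 Zs = fps_const fps_X"
proof -
  have h: "is_hom (fps_eval fps_const (lift \<alpha>))" by (intro fps_eval_hom hom_fps_const lift_\<alpha>_0)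
  show "ev1 (in_x v) = lift v" unfolding ev1_def lift_def
    by (rule fps_eval_coeffwise) (simp add: in_x_def fps_eval_const[OF hom_fps_const] lift_def[symmetric])
  show "ev1 Ys = lift \<alpha>"
    unfolding ev1_def Ys_def by (simp add: fps_eval_const[OF h] fps_eval_X[OF hom_fps_const lift_\<alpha>_0])
  show "ev1 Zs = fps_const fps_X"
    unfolding ev1_def Zs_def by (simp add: fps_eval_const[OF h] fps_eval_const[OF hom_fps_const])
qed

lemma ev_simps: "ev (in_x v) = v" "ev Ys = \<alpha>" "ev Zs = \<beta>"
proof -
  have h: "is_hom (fps_eval fps_const \<beta>)" by (intro fps_eval_hom hom_fps_const \<beta>0)
  have l: "ev2 (lift v) = v" for v
  proof -
    have "ev2 (lift v) = Abs_fps (fps_nth v)" unfolding ev2_def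
      by (rule fps_eval_coeffwise) (simp add: lift_def fps_eval_const[OF hom_fps_const])
    then show ?thesis by (simp add: fps_nth_inverse)
  qed
  show "ev (in_x v) = v" "ev Ys = \<alpha>" by (simp_all add: ev_def ev1_simps l)
  show "ev Zs = \<beta>"
    unfolding ev_def by (simp add: ev1_simps ev2_def fps_eval_const[OF h] fps_eval_X[OF hom_fps_const \<beta>0])
qed

lemma ev_st: "ev1 s = 0" "ev1 t \<noteq> 0" "ev s = 0" "ev t = 0"
proof -
  show "ev1 s = 0" by (simp add: s_def hom_diff[OF ev1_hom] ev1_simps)
  have "fps_nth (ev1 t) 0 = fps_X" by (simp add: t_def hom_diff[OF ev1_hom] ev1_simps lift_def \<beta>0)
  then show "ev1 t \<noteq> 0" by auto
  show "ev s = 0" "ev t = 0" by (simp_all add: s_def t_def hom_diff[OF ev_hom] ev_simps)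
qed

lemma ev_fg: "ev1 f = 0" "ev1 g \<noteq> 0" "ev f = 0" "ev g = 0"
  using ev_st by (simp_all add: f_eq g_eq hom_power[OF ev1_hom] hom_power[OF ev_hom])

lemma ev_poly_in: assumes "a \<in> adj S u" "is_subring T" "\<And>v. v \<in> S \<Longrightarrow> ev v \<in> T" "ev u \<in> T" shows "ev a \<in> T"
proof -
  obtain p where p: "a = poly p u" "\<And>i. Polynomial.coeff p i \<in> S" using assms(1) unfolding adj_def by blast
  then have "ev a = (\<Sum>i\<le>Polynomial.degree p. ev (Polynomial.coeff p i) * ev u ^ i)"
    by (simp add: poly_altdef hom_sum[OF ev_hom] hom_mult[OF ev_hom] hom_power[OF ev_hom])
  also have "\<dots> \<in> T" by (intro subring_sum[OF assms(2)] subring_mult[OF assms(2)] subring_power[OF assms(2)] assms(3)[OF p(2)] assms(4))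
  finally show ?thesis .
qed

text \<open>The images \<open>\<alpha>\<close> and \<open>\<beta>\<close> of \<open>y\<close> and \<open>z\<close> are algebraically independent over \<open>k(x)\<close>.\<close>

lemma ev_kxyz: assumes "p \<in> kxyz" "ev p = 0" shows "p = 0"
proof -
  let ?S = "in_x ` kx"
  have S: "is_subring ?S" by (rule in_x_image_subring[OF kx_subring])
  let ?S1 = "adj ?S Ys"
  have S1: "is_subring ?S1" by (rule adj_subring[OF S])
  have S2: "is_subring (adj ?S1 Zs)" by (rule adj_subring[OF S1])
  have sub: "kxyz \<subseteq> adj ?S1 Zs"
    using adj_base[OF S, of Ys] adj_base[OF S1, of Zs] adj_gen[OF S, of Ys] adj_gen[OF S1, of Zs]
    by (intro polyYZ_least[OF S2]) blast+
  have inj: "a = 0" if "a \<in> ?S" "ev a = 0" for a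
    using that by (auto simp: ev_simps in_x_0)
  have evS: "ev ` ?S = kx" by (simp add: image_image ev_simps)
  have inj1: "a = 0" if "a \<in> ?S1" "ev a = 0" for a
    by (rule adj_kernel[OF ev_hom inj _ S that]) (simp_all add: evS ev_simps transc_\<alpha>)
  have "ev ` ?S1 \<subseteq> adj kx \<alpha>"
  proof
    fix x assume "x \<in> ev ` ?S1"
    then obtain a where a: "x = ev a" "a \<in> ?S1" by blast
    have "ev a \<in> adj kx \<alpha>"
    proof (rule ev_poly_in[OF a(2) kxa_subring])
      show "ev v \<in> adj kx \<alpha>" if "v \<in> ?S" for v
      proof -
        have "ev v \<in> ev ` ?S" using that by (rule imageI)
        then have "ev v \<in> kx" by (simp only: evS)
        then show ?thesis by (rule subsetD[OF adj_base[OF kx_subring]])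
      qed
      show "ev Ys \<in> adj kx \<alpha>" unfolding ev_simps by (rule adj_gen[OF kx_subring])
    qed
    then show "x \<in> adj kx \<alpha>" using a(1) by simp
  qed
  then have "transc (ev ` ?S1) (ev Zs)" using transc_mono[OF transc_\<beta>] by (simp add: ev_simps)
  then show ?thesis using adj_kernel[OF ev_hom inj1 _ S1] sub assms by blast
qed

lemma D0_mod_fg: assumes "u \<in> D 0" shows "\<exists>p\<in>kxyz. \<exists>a\<in>D 0. \<exists>c\<in>D 0. u = p + a * f + c * g"
proof -
  define S where "S = {p + a * f + c * g | p a c. p \<in> kxyz \<and> a \<in> D 0 \<and> c \<in> D 0}"
  note T = D_subring[of 0]
  have I: "p + a * f + c * g \<in> S" if "p \<in> kxyz" "a \<in> D 0" "c \<in> D 0" for p a c using that unfolding S_def by blast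
  have fg: "f \<in> D 0" "g \<in> D 0" using fr_D[of 0] by simp_all
  have S: "is_subring S"
  proof (rule is_subringI)
    show "1 \<in> S" using I[OF subring_one[OF kxyz_subring] subring_zero[OF T] subring_zero[OF T]] by simp
    fix x assume "x \<in> S"
    then obtain p a c where x: "x = p + a * f + c * g" "p \<in> kxyz" "a \<in> D 0" "c \<in> D 0" unfolding S_def by blast
    show "- x \<in> S" using I[OF subring_minus[OF kxyz_subring x(2)] subring_minus[OF T x(3)] subring_minus[OF T x(4)]] x(1) by simp
    fix y assume "y \<in> S"
    then obtain q b d where y: "y = q + b * f + d * g" "q \<in> kxyz" "b \<in> D 0" "d \<in> D 0" unfolding S_def by blast
    have eq: "x + y = (p + q) + (a + b) * f + (c + d) * g"
      "x * y = p * q + (p * b + a * q + a * b * f + a * d * g) * f + (p * d + c * q + c * b * f + c * d * g) * g"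
      unfolding x(1) y(1) by (simp_all add: algebra_simps)
    have pq: "p \<in> D 0" "q \<in> D 0" using x y kxyz_D by blast+
    show "x + y \<in> S" unfolding eq(1) by (intro I subring_add[OF T] subring_add[OF kxyz_subring] x y)
    show "x * y \<in> S" unfolding eq(2)
      by (intro I subring_add[OF T] subring_mult[OF T] subring_mult[OF kxyz_subring] x y pq fg)
  qed
  have "D 0 \<subseteq> S"
  proof (rule D_least[OF S])
    have "p + 0 * f + 0 * g \<in> S" if "p \<in> kxyz" for p using that T by (intro I) auto
    then show "kxyz \<subseteq> S" by auto
    show "fps_shift 0 f \<in> S" "fps_shift 0 g \<in> S"
      using I[OF subring_zero[OF kxyz_subring] subring_one[OF T] subring_zero[OF T]]
        I[OF subring_zero[OF kxyz_subring] subring_zero[OF T] subring_one[OF T]] by simp_all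
  qed
  then show ?thesis using assms unfolding S_def by blast
qed

lemma fg_B: "f \<in> B" "g \<in> B" using fr_D[of 0] D_B[of 0] by auto

lemma fg_const: "fps_const (fps_nth f 0) = Ys\<^sup>2" "fps_const (fps_nth g 0) = Zs\<^sup>2"
proof -
  have "fps_const (fps_nth f 0) = (fps_const (fps_nth s 0))\<^sup>2" "fps_const (fps_nth g 0) = (fps_const (fps_nth t 0))\<^sup>2"
    by (simp_all add: f_eq g_eq power2_eq_square)
  moreover have "fps_nth s 0 = fps_X" "fps_nth t 0 = fps_const fps_X"
    by (simp_all add: s_def t_def Ys_def Zs_def in_x_def \<alpha>0 \<beta>0)
  ultimately show "fps_const (fps_nth f 0) = Ys\<^sup>2" "fps_const (fps_nth g 0) = Zs\<^sup>2"
    by (simp_all add: Ys_def Zs_def)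
qed

text \<open>The relations of the regular sequence \<open>y\<^sup>2, z\<^sup>2\<close> are the multiples of the trivial one.\<close>

lemma Ys_Zs_syzygy:
  fixes a c :: "'k pser"
  assumes "a * Ys\<^sup>2 + c * Zs\<^sup>2 = 0"
  shows "\<exists>d. c = Ys * (Ys * d) \<and> a = - (Zs\<^sup>2 * d)"
proof -
  have c0: "co c n j b = 0" if j: "j < 2" for n j b
  proof -
    have "co (Zs * (Zs * c)) n j (Suc (Suc b)) = co (- (Ys * (Ys * a))) n j (Suc (Suc b))"
      using assms by (metis (no_types, lifting) add.commute eq_neg_iff_add_eq_0 mult.assoc mult.commute power2_eq_square)
    then show ?thesis using j by (simp add: co_Zs co_Ys)
  qed
  define d where "d = Abs_fps (\<lambda>n. fps_shift 2 (fps_nth c n))"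
  have c: "c = Ys * (Ys * d)"
  proof (rule pser_eqI)
    fix n j b
    show "co c n j b = co (Ys * (Ys * d)) n j b"
      using c0[of j n b] by (cases "j < 2") (auto simp: co_Ys d_def not_less le_Suc_eq numeral_2_eq_2 dest!: le_Suc_ex)
  qed
  have "Ys\<^sup>2 * (a + Zs\<^sup>2 * d) = 0" using assms unfolding c by (simp add: algebra_simps power2_eq_square)
  moreover have "Ys \<noteq> (0 :: 'k pser)" by (simp add: Ys_def)
  ultimately have "a + Zs\<^sup>2 * d = 0" by simp
  then show ?thesis using c by (auto simp: eq_neg_iff_add_eq_0)
qed

text \<open>Reducing \<open>x b = p f + q g\<close> modulo \<open>x\<close> gives \<open>a y\<^sup>2 + c z\<^sup>2 = 0\<close>, so \<open>a = - z\<^sup>2 d\<close> and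
  \<open>c = y\<^sup>2 d\<close> for some \<open>d\<close>. Then \<open>p + g d\<close> and \<open>q - f d\<close> are divisible by \<open>x\<close>, and they can
  replace \<open>p\<close> and \<open>q\<close>.\<close>

lemma fg_saturated: assumes "Xs * b \<in> genid B {f, g}" "b \<in> B" shows "b \<in> genid B {f, g}"
proof -
  obtain p q where pq: "p \<in> B" "q \<in> B" "Xs * b = p * f + q * g" using assms(1) by (auto simp: genid_pair[OF B_subring])
  define a c where "a = fps_const (fps_nth p 0)" and "c = fps_const (fps_nth q 0)"
  have ac: "a \<in> loc0 kyz" "c \<in> loc0 kyz" using pq B_Rst by (auto simp: a_def c_def Rst_def)
  have "a * Ys\<^sup>2 + c * Zs\<^sup>2 = fps_const (fps_nth (p * f + q * g) 0)"
    unfolding fg_const[symmetric] a_def c_def by simp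
  also have "\<dots> = 0" unfolding pq(3)[symmetric] by (simp add: Xs_def)
  finally obtain d where d: "c = Ys * (Ys * d)" "a = - (Zs\<^sup>2 * d)" using Ys_Zs_syzygy by blast
  have "d \<in> loc0 kyz" using ac(2) loc0_kyz_Ys_div unfolding d(1) by blast
  then have dB: "d \<in> B" using loc0_kyz_B by blast
  have g0: "fps_const (fps_nth (p + g * d) 0) = 0"
  proof -
    have "fps_const (fps_nth (p + g * d) 0) = a + fps_const (fps_nth g 0) * fps_const (fps_nth d 0)" by (simp add: a_def)
    also have "\<dots> = 0" using loc0_kyz_const[OF \<open>d \<in> loc0 kyz\<close>] d(2) fg_const by simp
    finally show ?thesis .
  qed
  have f0: "fps_const (fps_nth (q - f * d) 0) = 0"
  proof -
    have "fps_const (fps_nth (q - f * d) 0) = c - fps_const (fps_nth f 0) * fps_const (fps_nth d 0)" by (simp add: c_def)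
    also have "\<dots> = 0" using loc0_kyz_const[OF \<open>d \<in> loc0 kyz\<close>] d(1) fg_const by (simp add: power2_eq_square mult.assoc)
    finally show ?thesis .
  qed
  have "Xs dvd p + g * d" "Xs dvd q - f * d"
    using g0 f0 Xs_power_dvd_iff[of 1 "p + g * d"] Xs_power_dvd_iff[of 1 "q - f * d"] by simp_all
  then obtain p' q' where p': "p + g * d = Xs * p'" and q': "q - f * d = Xs * q'" by (auto simp: dvd_def)
  have "Xs * p' \<in> B" "Xs * q' \<in> B"
    unfolding p'[symmetric] q'[symmetric] using pq dB fg_B B_subring by (auto intro!: subring_add subring_diff subring_mult)
  then have B': "p' \<in> B" "q' \<in> B" by (auto dest: B_div)
  have "Xs * b = (p + g * d) * f + (q - f * d) * g" unfolding pq(3) by (simp add: algebra_simps)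
  also have "\<dots> = Xs * (p' * f + q' * g)" unfolding p' q' by (simp add: algebra_simps)
  finally have "b = p' * f + q' * g" by simp
  then show ?thesis using B' by (auto simp: genid_pair[OF B_subring])
qed

text \<open>Up to a unit of \<open>B\<close> and a power of \<open>x\<close>, an element of the kernel is \<open>p + a f + c g\<close> with \<open>p\<close>
  in \<open>k[x,y,z]\<close>. The substitution kills \<open>p\<close> too, so \<open>p = 0\<close>; the unit and the power of \<open>x\<close> can be
  cancelled.\<close>

theorem fg_kernel: "genid B {f, g} = {b \<in> B. ev b = 0}"
proof
  show "genid B {f, g} \<subseteq> {b \<in> B. ev b = 0}"
    using fg_B B_subring ev_fg
    by (auto simp: genid_pair[OF B_subring] hom_add[OF ev_hom] hom_mult[OF ev_hom] intro!: subring_add subring_mult)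
  show "{b \<in> B. ev b = 0} \<subseteq> genid B {f, g}"
  proof clarify
    fix b assume b: "b \<in> B" "ev b = 0"
    have id: "ideal_in B (genid B {f, g})" using fg_B by (intro genid_ideal B_subring) blast
    obtain n w where w: "w \<in> B" "cc w \<noteq> 0" "Xs ^ n * w \<in> D 0" "Xs ^ n * w * b \<in> D 0" using B_clear[OF b(1)] by blast
    obtain p a c where p: "p \<in> kxyz" "a \<in> D 0" "c \<in> D 0" "Xs ^ n * w * b = p + a * f + c * g"
      using D0_mod_fg[OF w(4)] by blast
    have "ev (Xs ^ n * w * b) = 0" using b(2) by (simp add: hom_mult[OF ev_hom])
    then have "ev p = 0" unfolding p(4) using ev_fg by (simp add: hom_add[OF ev_hom] hom_mult[OF ev_hom])
    then have "p = 0" using ev_kxyz p(1) by blast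
    then have "Xs ^ n * w * b \<in> genid B {f, g}" using p D_B[of 0] by (auto simp: genid_pair[OF B_subring])
    moreover obtain v where v: "w * v = 1" using pser_unit[OF w(2)] by blast
    moreover have "v \<in> B" by (rule B_unit[OF w(1,2) v])
    ultimately have "v * (Xs ^ n * w * b) \<in> genid B {f, g}" using ideal_in_lmult[OF id] by blast
    moreover have "v * (Xs ^ n * w * b) = (w * v) * (Xs ^ n * b)" by (simp only: mult_ac)
    ultimately have "Xs ^ n * b \<in> genid B {f, g}" using v by simp
    then show "b \<in> genid B {f, g}"
    proof (induction n)
      case (Suc n)
      have "Xs * (Xs ^ n * b) \<in> genid B {f, g}" using Suc.prems by (simp add: mult.assoc)
      moreover have "Xs ^ n * b \<in> B" using b(1) Xs_B B_subring by auto
      ultimately show ?case using fg_saturated Suc.IH by blast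
    qed simp
  qed
qed

text \<open>The prime in the middle is the kernel of the substitution \<open>y \<mapsto> \<alpha>\<close>; it contains \<open>f\<close>, but not
  \<open>g\<close>.\<close>

lemma P_chain: "prime_chain_in B 2 (\<lambda>i. if i = 0 then {0} else if i = 1 then {b \<in> B. ev1 b = 0} else genid B {f, g})"
proof -
  have 0: "prime_in B {0}" using B_subring by (auto simp: prime_in_def ideal_in_def)
  have 1: "prime_in B {b \<in> B. ev1 b = 0}" by (rule prime_kernel[OF B_subring ev1_hom])
  have 2: "prime_in B (genid B {f, g})" unfolding fg_kernel by (rule prime_kernel[OF B_subring ev_hom])
  have "f \<noteq> 0"
  proof
    assume "f = 0"
    then have "Ys\<^sup>2 = (0 :: 'k pser)" using fg_const(1) by simp
    then show False by (simp add: Ys_def)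
  qed
  then have f0: "f \<noteq> 0" "ev1 0 = 0" by (simp_all add: hom_zero[OF ev1_hom])
  have "{0} \<subset> {b \<in> B. ev1 b = 0}" using f0 ev_fg(1) fg_B B_subring by auto
  moreover have "{b \<in> B. ev1 b = 0} \<subset> genid B {f, g}"
  proof
    show "{b \<in> B. ev1 b = 0} \<subseteq> genid B {f, g}" unfolding fg_kernel by (auto simp: ev_def hom_zero[OF ev2_hom])
    have "g \<in> genid B {f, g}" by (rule genid_incl[OF B_subring]) simp
    then show "{b \<in> B. ev1 b = 0} \<noteq> genid B {f, g}" using ev_fg(2) by blast
  qed
  ultimately show ?thesis using 0 1 2 by (auto simp: prime_chain_in_def less_Suc_eq numeral_2_eq_2)
qed

text \<open>The primes are the kernels of the substitutions of \<open>0\<close> for \<open>x\<close>, for \<open>x, y\<close> and for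
  \<open>x, y, z\<close>.\<close>

lemma B_chain: "prime_chain_in B 3 (\<lambda>i. if i = 0 then {0} else if i = 1 then {b \<in> B. fps_nth b 0 = 0}
    else if i = 2 then {b \<in> B. fps_nth (fps_nth b 0) 0 = 0} else {b \<in> B. cc b = 0})"
proof -
  have h: "is_hom (\<lambda>b :: 'k pser. fps_nth (fps_nth b 0) 0)" "is_hom (cc :: 'k pser \<Rightarrow> 'k)" by (simp_all add: is_hom_def)
  have 0: "prime_in B {0}" using B_subring by (auto simp: prime_in_def ideal_in_def)
  have 1: "prime_in B {b \<in> B. fps_nth b 0 = 0}" by (rule prime_kernel[OF B_subring hom_fps_nth_0])
  have 2: "prime_in B {b \<in> B. fps_nth (fps_nth b 0) 0 = 0}" by (rule prime_kernel[OF B_subring h(1)])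
  have 3: "prime_in B {b \<in> B. cc b = 0}" by (rule prime_kernel[OF B_subring h(2)])
  have "Xs \<in> {b \<in> B. fps_nth b 0 = 0}" "Xs \<noteq> (0 :: 'k pser)" using XYZ_B by (auto simp: Xs_def)
  moreover have "0 \<in> {b \<in> B. fps_nth b 0 = 0}" using subring_zero[OF B_subring] by simp
  ultimately have s1: "{0} \<subset> {b \<in> B. fps_nth b 0 = 0}" by blast
  have "Ys \<in> {b \<in> B. fps_nth (fps_nth b 0) 0 = 0}" "Ys \<notin> {b \<in> B. fps_nth b 0 = 0}" using XYZ_B by (auto simp: Ys_def)
  then have s2: "{b \<in> B. fps_nth b 0 = 0} \<subset> {b \<in> B. fps_nth (fps_nth b 0) 0 = 0}" by auto
  have "Zs \<in> {b \<in> B. cc b = 0}" "Zs \<notin> {b \<in> B. fps_nth (fps_nth b 0) 0 = 0}" using XYZ_B by (auto simp: Zs_def cc_def)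
  then have s3: "{b \<in> B. fps_nth (fps_nth b 0) 0 = 0} \<subset> {b \<in> B. cc b = 0}" by (auto simp: cc_def)
  show ?thesis using 0 1 2 3 s1 s2 s3
    by (auto simp: prime_chain_in_def less_Suc_eq numeral_3_eq_3 numeral_2_eq_2)
qed

lemma st_const: "fps_const (fps_nth s 0) = Ys" "fps_const (fps_nth t 0) = Zs"
  by (simp_all add: s_def t_def Ys_def Zs_def in_x_def \<alpha>0 \<beta>0)

text \<open>Modulo \<open>x\<close> such an equation reads \<open>yz = y\<^sup>2 F0 + z\<^sup>2 G0\<close>, and the monomial \<open>yz\<close> does not
  occur on the right.\<close>

lemma st_notin: "s * t \<noteq> f * F + g * G"
proof
  assume eq: "s * t = f * F + g * G"
  define F0 G0 where "F0 = fps_const (fps_nth F 0)" and "G0 = fps_const (fps_nth G 0)"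
  have "fps_const (fps_nth s 0) * fps_const (fps_nth t 0) = fps_const (fps_nth (f * F + g * G) 0)"
    unfolding eq[symmetric] by simp
  also have "\<dots> = Ys\<^sup>2 * F0 + Zs\<^sup>2 * G0" unfolding fg_const[symmetric] F0_def G0_def by simp
  finally have "Ys * (Zs * 1) = Ys * (Ys * F0) + Zs * (Zs * G0)"
    unfolding st_const by (simp only: power2_eq_square mult.assoc mult_1_right)
  then have "co (Ys * (Zs * 1)) 0 1 1 = co (Ys * (Ys * F0) + Zs * (Zs * G0)) 0 1 1" by simp
  then show False unfolding fps_add_nth co_Ys co_Zs by simp
qed

subsection \<open>The rings of dimension five\<close>

lemma kxyz_rgen: "kxyz = rgen (insert Xs (insert Ys (insert Zs (in_x ` kk))))" (is "_ = ?R")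
proof
  have R: "is_subring ?R" by (rule rgen_subring)
  have S: "is_subring {v. in_x v \<in> ?R}"
    using R
    unfolding is_subring_def[of "Collect _"] by (simp add: in_x_1 in_x_diff in_x_mult)
  have "kx \<subseteq> {v. in_x v \<in> ?R}"
  proof (rule adj_least[OF S])
    show "kk \<subseteq> {v. in_x v \<in> ?R}" by (auto intro: rgen_incl)
    show "fps_X \<in> {v. in_x v \<in> ?R}" by (auto simp: in_x_X intro: rgen_incl)
  qed
  then show "kxyz \<subseteq> ?R" by (intro polyYZ_least[OF rgen_subring]) (auto intro: rgen_incl)
  show "?R \<subseteq> kxyz"
  proof (rule rgen_least[OF kxyz_subring])
    have "in_x ` kk \<subseteq> kxyz" using kk_kx polyYZ_in_x[OF kx_subring] by blast
    then show "insert Xs (insert Ys (insert Zs (in_x ` kk))) \<subseteq> kxyz"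
      using Xs_kxyz polyYZ_Ys[OF kx_subring] polyYZ_Zs[OF kx_subring] by blast
  qed
qed

lemma D_rgen: "D r = rgen (insert (fps_shift r g) (insert (fps_shift r f) (insert Xs (insert Ys (insert Zs (in_x ` kk))))))"
  unfolding D_def kxyz_rgen by (simp only: rgen_insert)

text \<open>The five elements \<open>z, y, x, f_r, g_r\<close> are adjoined to \<open>k\<close> one by one, each transcendental
  over the previous ring, and each adds one prime to the chain.\<close>

lemma D_chain: "\<exists>p. prime_chain_in (D r) 5 p \<and> p 5 = {a \<in> D r. cc a = 0}"
proof -
  let ?S0 = "in_x ` kk :: 'k pser set"
  have S0: "is_subring ?S0" by (rule in_x_image_subring[OF kk_subring])
  let ?S1 = "adj ?S0 Zs"
  let ?S2 = "adj ?S1 Ys"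
  have S1: "is_subring ?S1" by (rule adj_subring[OF S0])
  have S2: "is_subring ?S2" by (rule adj_subring[OF S1])
  have S3: "kxyz = adj ?S2 Xs"
    unfolding kxyz_rgen by (simp only: rgen_insert rgen_id[OF S0])
  have k: "in_x (fps_const c) \<in> ?S0" for c by simp
  have ccin: "cc (in_x (fps_const c)) = c" for c :: 'k by (simp add: cc_def co_in_x)
  have const_sub: "is_subring (fps_const ` S)" if "is_subring S" for S :: "'a::comm_ring_1 set"
    unfolding is_subring_def
  proof (intro conjI ballI)
    show "1 \<in> fps_const ` S" using imageI[OF subring_one[OF that], of fps_const] by simp
    fix a b assume "a \<in> fps_const ` S" "b \<in> fps_const ` S"
    then obtain c d where cd: "a = fps_const c" "b = fps_const d" "c \<in> S" "d \<in> S" by blast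
    show "a - b \<in> fps_const ` S" "a * b \<in> fps_const ` S"
      using imageI[OF subring_diff[OF that cd(3,4)], of fps_const] imageI[OF subring_mult[OF that cd(3,4)], of fps_const]
      by (simp_all add: cd(1,2))
  qed
  have rc: "is_subring (range fps_const :: 'a::comm_ring_1 fps set)"
    by (rule const_sub) (simp add: is_subring_def)
  have inj: "inj (fps_const :: 'a::comm_ring_1 \<Rightarrow> _)" by (simp add: inj_on_def)
  have tc: "transc (fps_const ` S) (fps_const u)" if "transc S u" "is_subring S" for S and u :: "'a::comm_ring_1"
    by (rule transc_image[OF _ _ _ _ inj that]) simp_all
  have t1: "transc ?S0 Zs"
    unfolding Zs_def
    by (rule transc_mono[OF tc[OF tc[OF transc_fps_X rc] const_sub[OF rc]]]) (auto simp: in_x_const)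
  have sub1: "?S1 \<subseteq> fps_const ` range fps_const"
    by (rule adj_least[OF const_sub[OF rc]]) (auto simp: in_x_const Zs_def)
  have t2: "transc ?S1 Ys"
    unfolding Ys_def by (rule transc_mono[OF tc[OF transc_fps_X rc] sub1])
  have sub2: "?S2 \<subseteq> range fps_const"
    by (rule adj_least[OF rc]) (use sub1 in \<open>auto simp: Ys_def\<close>)
  have t3: "transc ?S2 Xs"
    unfolding Xs_def by (rule transc_mono[OF transc_fps_X sub2])
  have k1: "in_x (fps_const c) \<in> ?S1" for c by (rule subsetD[OF adj_base[OF S0] k])
  have k2: "in_x (fps_const c) \<in> ?S2" for c by (rule subsetD[OF adj_base[OF S1] k1])
  have k3: "in_x (fps_const c) \<in> kxyz" for c :: 'k unfolding S3 by (rule subsetD[OF adj_base[OF S2] k2])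
  have k4: "in_x (fps_const c) \<in> adj kxyz (fps_shift r f)" for c by (rule subsetD[OF adj_base[OF kxyz_subring] k3])
  have step: "\<exists>q. prime_chain_in (adj S u) (Suc n) q \<and> q (Suc n) = {a \<in> adj S u. cc a = 0}"
    if "is_subring S" "transc S u" "\<And>c. in_x (fps_const c) \<in> S"
      "\<exists>p. prime_chain_in S n p \<and> p n = {a \<in> S. cc a = 0}" for S n and u :: "'k pser"
    using that(4) transc_prime_chain[OF that(1,2) that(3)[of "cc u"], of cc n] ccin[of "cc u"] by auto
  have c0: "\<exists>p. prime_chain_in ?S0 0 p \<and> p 0 = {a \<in> ?S0. cc a = 0}"
  proof (intro exI conjI)
    have "{a \<in> ?S0. cc a = 0} = {0}"
    proof
      show "{a \<in> ?S0. cc a = 0} \<subseteq> {0}" by (auto simp: ccin in_x_0)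
      show "{0} \<subseteq> {a \<in> ?S0. cc a = 0}" using S0 by simp
    qed
    then show "{0} = {a \<in> ?S0. cc a = 0}" by simp
    show "prime_chain_in ?S0 0 (\<lambda>_. {0})" using S0 by (auto simp: prime_chain_in_def prime_in_def ideal_in_def)
  qed
  note c3 = step[OF S2 t3 k2 step[OF S1 t2 k1 step[OF S0 t1 k c0]], folded S3]
  note c5 = step[OF kxyza_subring transc_gr k4 step[OF kxyz_subring transc_fr k3 c3], folded D_def]
  have "Suc (Suc (Suc (Suc (Suc 0)))) = 5" by simp
  then show ?thesis using c5 by (simp only:)
qed

definition "Dgens r = {Xs, Ys, Zs, fps_shift r f - fps_const (fps_nth f r), fps_shift r g - fps_const (fps_nth g r)}"

lemma Dgens_D: "Dgens r \<subseteq> {a \<in> D r. cc a = 0}"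
proof -
  have "fps_const (fps_nth f r) \<in> D r" "fps_const (fps_nth g r) \<in> D r"
    using coeff_fg kyz_kxyz kxyz_D by blast+
  moreover have "Ys \<in> D r" "Zs \<in> D r" using kxyz_D polyYZ_Ys[OF kx_subring] polyYZ_Zs[OF kx_subring] by blast+
  ultimately have "Dgens r \<subseteq> D r" using Xs_D fr_D[of r] D_subring[of r] by (auto simp: Dgens_def)
  moreover have "cc a = 0" if "a \<in> Dgens r" for a using that by (auto simp: Dgens_def) (simp_all add: cc_def)
  ultimately show ?thesis by blast
qed

text \<open>Every generator of \<open>D r\<close> is congruent to an element of \<open>k[y,z]\<close>, and hence to a constant,
  modulo the ideal generated by \<open>Dgens r\<close>. So \<open>D r\<close> is the sum of \<open>k\<close> and this ideal.\<close>

lemma D_max_generated: "genid (D r) (Dgens r) = {a \<in> D r. cc a = 0}"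
proof
  let ?J = "genid (D r) (Dgens r)"
  have J: "ideal_in (D r) ?J" using Dgens_D by (intro genid_ideal D_subring) blast
  have incl: "a \<in> ?J" if "a \<in> Dgens r" for a by (rule genid_incl[OF D_subring that])
  have k: "in_x (fps_const c) \<in> D r" for c using kk_kx kxyz_D polyYZ_in_x[OF kx_subring] by blast
  have ccin: "cc (in_x (fps_const c)) = c" for c :: 'k by (simp add: cc_def co_in_x)
  have "prime_in (D r) {a \<in> D r. cc a = 0}" by (rule prime_kernel[OF D_subring]) (simp add: is_hom_def)
  then show Jcc: "?J \<subseteq> {a \<in> D r. cc a = 0}" using Dgens_D by (intro genid_least prime_in_ideal)
  define S where "S = {in_x (fps_const c) + j | c j. j \<in> ?J}"
  have I: "in_x (fps_const c) + j \<in> S" if "j \<in> ?J" for c j unfolding S_def using that by blast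
  have JS: "?J \<subseteq> S" using I[of _ 0] by (auto simp: in_x_0)
  have kS: "in_x (fps_const c) \<in> S" for c using I[OF ideal_in_zero[OF J]] by simp
  have S: "is_subring S"
  proof (rule is_subringI)
    show "1 \<in> S" using kS[of 1] by (simp add: in_x_1)
    fix a assume "a \<in> S"
    then obtain c i where a: "a = in_x (fps_const c) + i" "i \<in> ?J" unfolding S_def by blast
    have "- a = in_x (fps_const (- c)) + - i" using a(1) by (simp add: in_x_minus[symmetric])
    then show "- a \<in> S" using I[OF ideal_in_minus[OF J D_subring a(2)]] by simp
    fix b assume "b \<in> S"
    then obtain d j where b: "b = in_x (fps_const d) + j" "j \<in> ?J" unfolding S_def by blast
    have "a + b = in_x (fps_const (c + d)) + (i + j)" unfolding a(1) b(1)
      by (simp add: fps_const_add[symmetric] in_x_add del: fps_const_add)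
    then show "a + b \<in> S" using I[OF ideal_in_add[OF J a(2) b(2)]] by simp
    have eq: "a * b = in_x (fps_const (c * d)) + (in_x (fps_const c) * j + in_x (fps_const d) * i + i * j)"
      unfolding a(1) b(1) by (simp add: fps_const_mult[symmetric] in_x_mult algebra_simps del: fps_const_mult)
    show "a * b \<in> S" unfolding eq
      by (intro I ideal_in_add[OF J] ideal_in_lmult[OF J] k a(2) b(2) ideal_in_carrier[OF J a(2)])
  qed
  have kyzS: "kyz \<subseteq> S"
  proof (rule polyYZ_least[OF S])
    show "in_x ` kk \<subseteq> S" using kS by blast
    show "Ys \<in> S" "Zs \<in> S" using JS incl by (auto simp: Dgens_def)
  qed
  have "D r \<subseteq> S"
    unfolding D_rgen
  proof (rule rgen_least[OF S])
    have "Xs \<in> S" "Ys \<in> S" "Zs \<in> S" "fps_shift r f - fps_const (fps_nth f r) \<in> S"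
      "fps_shift r g - fps_const (fps_nth g r) \<in> S" using JS incl by (auto simp: Dgens_def)
    moreover have "fps_const (fps_nth f r) \<in> S" "fps_const (fps_nth g r) \<in> S" using coeff_fg kyzS by blast+
    ultimately show "insert (fps_shift r g) (insert (fps_shift r f) (insert Xs (insert Ys (insert Zs (in_x ` kk))))) \<subseteq> S"
      using subring_add[OF S, of "fps_shift r f - fps_const (fps_nth f r)" "fps_const (fps_nth f r)"]
        subring_add[OF S, of "fps_shift r g - fps_const (fps_nth g r)" "fps_const (fps_nth g r)"] kS by auto
  qed
  show "{a \<in> D r. cc a = 0} \<subseteq> ?J"
  proof clarify
    fix a assume "a \<in> D r" "cc a = 0"
    then obtain c j where a: "a = in_x (fps_const c) + j" "j \<in> ?J" using \<open>D r \<subseteq> S\<close> unfolding S_def by blast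
    have "cc j = 0" using Jcc a(2) by blast
    then have "c = 0" using \<open>cc a = 0\<close> a(1) by (simp add: ccin)
    then show "a \<in> ?J" using a by (simp add: in_x_0)
  qed
qed

end

section \<open>Subrings of a field as rings with carrier\<close>

lemma subring_on_simps [simp]:
  "carrier (subring_on S) = S" "x \<otimes>\<^bsub>subring_on S\<^esub> y = x * y" "\<one>\<^bsub>subring_on S\<^esub> = 1"
  "\<zero>\<^bsub>subring_on S\<^esub> = 0" "x \<oplus>\<^bsub>subring_on S\<^esub> y = x + y"
  by (simp_all add: subring_on_def ring_of_type_algebra_def)

lemma subring_on_cring:
  assumes S: "is_subring S" shows "cring (subring_on S)"
proof (rule cringI)
  show "abelian_group (subring_on S)"
    by (rule abelian_groupI) (use S in \<open>auto simp: add_ac intro!: bexI[of _ "- _"]\<close>)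
  show "comm_monoid (subring_on S)"
    by (rule comm_monoidI) (use S in \<open>auto simp: mult_ac\<close>)
qed (simp add: distrib_right)

lemma subring_on_ring: "is_subring S \<Longrightarrow> ring (subring_on S)"
  using subring_on_cring cring.axioms(1) by blast

lemma subring_on_domain:
  fixes S :: "'a::field set"
  assumes S: "is_subring S" shows "domain (subring_on S)"
proof -
  interpret cring "subring_on S" by (rule subring_on_cring[OF S])
  show ?thesis by unfold_locales auto
qed

lemma subring_on_minus:
  assumes S: "is_subring S" and x: "x \<in> S" shows "\<ominus>\<^bsub>subring_on S\<^esub> x = - x"
proof -
  interpret cring "subring_on S" by (rule subring_on_cring[OF S])
  show ?thesis by (rule minus_equality) (use S x in auto)
qed

lemma subring_on_ideal_iff:
  assumes S: "is_subring S" shows "ideal I (subring_on S) \<longleftrightarrow> ideal_in S I"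
proof
  assume "ideal I (subring_on S)"
  then interpret ideal I "subring_on S" .
  show "ideal_in S I" unfolding ideal_in_def
    using a_subset I_l_closed additive_subgroup.zero_closed[OF is_additive_subgroup]
      additive_subgroup.a_closed[OF is_additive_subgroup] by auto
next
  assume I: "ideal_in S I"
  interpret cring "subring_on S" by (rule subring_on_cring[OF S])
  show "ideal I (subring_on S)"
  proof (rule idealI[OF subring_on_ring[OF S]])
    show "subgroup I (add_monoid (subring_on S))"
    proof (rule add.subgroupI)
      show "I \<subseteq> carrier (subring_on S)" using ideal_in_subset[OF I] by simp
      show "I \<noteq> {}" using ideal_in_zero[OF I] by blast
      show "\<ominus>\<^bsub>subring_on S\<^esub> a \<in> I" if "a \<in> I" for a
        using subring_on_minus[OF S] ideal_in_carrier[OF I that] ideal_in_minus[OF I S that] by simp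
      show "a \<oplus>\<^bsub>subring_on S\<^esub> b \<in> I" if "a \<in> I" "b \<in> I" for a b
        using ideal_in_add[OF I that] by simp
    qed
    show "x \<otimes>\<^bsub>subring_on S\<^esub> a \<in> I" "a \<otimes>\<^bsub>subring_on S\<^esub> x \<in> I"
      if "a \<in> I" "x \<in> carrier (subring_on S)" for a x
      using that ideal_in_lmult[OF I] ideal_in_rmult[OF I] by simp_all
  qed
qed

lemma subring_on_genideal:
  assumes S: "is_subring S" and G: "G \<subseteq> S" shows "Idl\<^bsub>subring_on S\<^esub> G = genid S G"
proof
  interpret cring "subring_on S" by (rule subring_on_cring[OF S])
  have id: "ideal (genid S G) (subring_on S)" using subring_on_ideal_iff[OF S] genid_ideal[OF S G] by blast
  show "Idl\<^bsub>subring_on S\<^esub> G \<subseteq> genid S G"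
    by (rule genideal_minimal[OF id]) (auto intro: genid_incl[OF S])
  have "ideal_in S (Idl\<^bsub>subring_on S\<^esub> G)"
    using genideal_ideal[of G] G subring_on_ideal_iff[OF S] by simp
  then show "genid S G \<subseteq> Idl\<^bsub>subring_on S\<^esub> G"
    by (rule genid_least) (use genideal_self[of G] G in simp)
qed

lemma subring_on_primeideal_iff:
  assumes S: "is_subring S" shows "primeideal P (subring_on S) \<longleftrightarrow> prime_in S P"
proof
  assume P: "primeideal P (subring_on S)"
  then interpret primeideal P "subring_on S" .
  have id: "ideal_in S P" using subring_on_ideal_iff[OF S] is_ideal by blast
  have "1 \<notin> P"
  proof
    assume "1 \<in> P"
    then have "S \<subseteq> P" using ideal_in_lmult[OF id _ \<open>1 \<in> P\<close>] by auto
    then show False using I_notcarr ideal_in_subset[OF id] by auto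
  qed
  then show "prime_in S P" using id I_prime by (auto simp: prime_in_def)
next
  assume P: "prime_in S P"
  have id: "ideal P (subring_on S)" using subring_on_ideal_iff[OF S] prime_in_ideal[OF P] by blast
  show "primeideal P (subring_on S)"
  proof (rule primeidealI[OF id subring_on_cring[OF S]])
    show "carrier (subring_on S) \<noteq> P" using P S by (auto simp: prime_in_def)
  qed (use P in \<open>auto simp: prime_in_def\<close>)
qed

lemma subring_on_prime_chain_iff:
  "is_subring S \<Longrightarrow> prime_chain (subring_on S) n p \<longleftrightarrow> prime_chain_in S n p"
  unfolding prime_chain_def prime_chain_in_def using subring_on_primeideal_iff by blast

lemma subring_on_noetherian:
  assumes S: "is_subring S" and N: "noeth S" shows "noetherian_ring (subring_on S)"
proof (rule ring.noetherian_ringI[OF subring_on_ring[OF S]])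
  fix I assume "ideal I (subring_on S)"
  then have I: "ideal_in S I" using subring_on_ideal_iff[OF S] by blast
  obtain G where G: "finite G" "G \<subseteq> I" "I \<subseteq> genid S G" by (rule noethE[OF N I])
  have GS: "G \<subseteq> S" using G(2) ideal_in_subset[OF I] by blast
  have "I = Idl\<^bsub>subring_on S\<^esub> G"
    unfolding subring_on_genideal[OF S GS] using G(3) genid_least[OF I G(2)] by blast
  then show "\<exists>A\<subseteq>carrier (subring_on S). finite A \<and> I = Idl\<^bsub>subring_on S\<^esub> A" using GS G(1) by auto
qed

lemma subring_on_maximalideal_iff:
  assumes S: "is_subring S" and m: "local_at S m"
  shows "maximalideal M (subring_on S) \<longleftrightarrow> M = m"
proof -
  have im: "ideal_in S m" and m1: "1 \<notin> m" using m by (auto simp: local_at_def)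
  have whole: "J = S" if "ideal_in S J" "1 \<in> J" for J
    using ideal_in_lmult[OF that(1) _ that(2)] ideal_in_subset[OF that(1)] by auto
  have max: "maximalideal m (subring_on S)"
  proof (rule maximalidealI)
    show "ideal m (subring_on S)" using im subring_on_ideal_iff[OF S] by blast
    show "carrier (subring_on S) \<noteq> m" using m1 S by auto
    fix J assume "ideal J (subring_on S)" "m \<subseteq> J"
    then show "J = m \<or> J = carrier (subring_on S)"
      using whole[of J] local_at_ideal_le[OF m, of J] subring_on_ideal_iff[OF S] by auto
  qed
  show ?thesis
  proof
    assume "maximalideal M (subring_on S)"
    then interpret maximalideal M "subring_on S" .
    have iM: "ideal_in S M" using subring_on_ideal_iff[OF S] is_ideal by blast
    have "1 \<notin> M" using whole[OF iM] I_notcarr by auto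
    then have "M \<subseteq> m" by (rule local_at_ideal_le[OF m iM])
    then have "m = M \<or> m = carrier (subring_on S)"
      by (intro I_maximal) (use im subring_on_ideal_iff[OF S] ideal_in_subset[OF im] in auto)
    then show "M = m" using m1 S by auto
  qed (use max in simp)
qed

lemma subring_on_local:
  assumes S: "is_subring S" and m: "local_at S m"
  shows "local_ring (subring_on S)" "max_ideal (subring_on S) = m"
  unfolding local_ring_def max_ideal_def subring_on_maximalideal_iff[OF S m]
  using subring_on_cring[OF S] by auto

lemma enat_Sup_eq:
  assumes "n \<in> N" "\<And>l. l \<in> N \<Longrightarrow> l \<le> n" shows "(SUP l\<in>N. enat l) = enat n"
proof (rule antisym)
  show "(SUP l\<in>N. enat l) \<le> enat n" by (rule SUP_least) (simp add: assms(2))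
  show "enat n \<le> (SUP l\<in>N. enat l)" by (rule SUP_upper[OF assms(1)])
qed

text \<open>The height theorem bounds every chain by the number of elements of every generating set of
  \<open>m\<close>. With a chain of length \<open>n\<close> and a generating set of at most \<open>n\<close> elements, both the dimension
  and the least number of generators are \<open>n\<close>.\<close>

theorem regular_local_by_chain:
  fixes S :: "'a::field set"
  assumes S: "is_subring S" and N: "noeth S" and m: "local_at S m"
    and G: "finite G" "m = genid S G" "card G \<le> n" and p: "prime_chain_in S n p"
  shows "regular_local_domain (subring_on S)" "krull_dim (subring_on S) = enat n"
proof -
  have im: "ideal_in S m" using m by (simp add: local_at_def)
  have bound: "l \<le> card H" if H: "finite H" "H \<subseteq> S" "m = genid S H" and q: "prime_chain_in S l q" for H l q
  proof (rule height_theorem[OF S N m H(1) _ _ q])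
    show "H \<subseteq> m" using H(3) by (auto intro: genid_incl[OF S])
    fix Q assume Q: "prime_in S Q" "H \<subseteq> Q"
    have "m \<subseteq> Q" unfolding H(3) by (rule genid_least[OF prime_in_ideal[OF Q(1)] Q(2)])
    moreover have "Q \<subseteq> m" using Q(1) by (intro local_at_ideal_le[OF m]) (auto simp: prime_in_def)
    ultimately show "Q = m" by blast
  qed
  have "G \<subseteq> m" unfolding G(2) by (auto intro: genid_incl[OF S])
  then have GS: "G \<subseteq> S" using ideal_in_subset[OF im] by blast
  have cG: "card G = n" using bound[OF G(1) GS G(2) p] G(3) by simp
  have dim: "krull_dim (subring_on S) = enat n"
    unfolding krull_dim_def subring_on_prime_chain_iff[OF S]
    by (rule enat_Sup_eq) (use p bound[OF G(1) GS G(2)] cG in auto)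
  have "embedding_dim (subring_on S) = n"
    unfolding embedding_dim_def subring_on_local(2)[OF S m]
  proof (rule Least_equality)
    show "\<exists>H\<subseteq>carrier (subring_on S). finite H \<and> card H = n \<and> m = Idl\<^bsub>subring_on S\<^esub> H"
      using GS G cG subring_on_genideal[OF S GS] by auto
    fix l assume "\<exists>H\<subseteq>carrier (subring_on S). finite H \<and> card H = l \<and> m = Idl\<^bsub>subring_on S\<^esub> H"
    then obtain H where H: "H \<subseteq> S" "finite H" "card H = l" "m = Idl\<^bsub>subring_on S\<^esub> H" by auto
    then have "m = genid S H" using subring_on_genideal[OF S H(1)] by simp
    then show "n \<le> l" using bound[OF H(2,1) _ p] H(3) by simp
  qed
  then show "regular_local_domain (subring_on S)" "krull_dim (subring_on S) = enat n"
    using dim subring_on_domain[OF S] subring_on_noetherian[OF S N] subring_on_local(1)[OF S m]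
    by (auto simp: regular_local_domain_def regular_local_ring_def)
qed

text \<open>The height theorem applies in the localization at \<open>P\<close>, where a prime that contains \<open>G\<close>
  contracts to a prime that contains \<open>P\<close> and is contained in \<open>P\<close>.\<close>

theorem height_by_chain:
  fixes S :: "'a::field set"
  assumes S: "is_subring S" and N: "noeth S" and P: "prime_in S P"
    and G: "finite G" "P = genid S G" "card G \<le> n" and p: "prime_chain_in S n p" "p n = P"
  shows "ideal_height (subring_on S) P = enat n"
proof -
  have GP: "G \<subseteq> P" unfolding G(2) by (auto intro: genid_incl[OF S])
  let ?L = "localize_at S P"
  have bound: "l \<le> n" if q: "prime_chain_in S l q" "q l = P" for l q
  proof -
    have "l \<le> card G"
    proof (rule height_theorem[OF localize_subring[OF S P] localize_noeth[OF S P N] localize_local[OF S P] G(1)])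
      show "prime_chain_in ?L l (\<lambda>i. loc_ext S P (q i))"
        by (rule loc_ext_chain[OF S P q(1)]) (simp add: q(2))
      show "G \<subseteq> loc_ext S P P" using GP loc_ext_contract[OF S P P] by blast
      fix Q assume Q: "prime_in ?L Q" "G \<subseteq> Q"
      note Q' = localize_prime_contract[OF S P Q(1)]
      have "G \<subseteq> Q \<inter> S" using Q(2) GP ideal_in_subset[OF prime_in_ideal[OF P]] by blast
      then have "P \<subseteq> Q \<inter> S" unfolding G(2) by (rule genid_least[OF prime_in_ideal[OF Q'(1)]])
      then have "Q \<inter> S = P" using Q'(2) by blast
      then show "Q = loc_ext S P P" using Q'(3) by simp
    qed
    then show ?thesis using G(3) by simp
  qed
  show ?thesis
    unfolding ideal_height_def subring_on_prime_chain_iff[OF S]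
    by (rule enat_Sup_eq) (use p bound in auto)
qed

section \<open>The embedding into the fraction field\<close>

lemma emb_simps:
  "emb (F + G) = emb F + emb G" "emb (F - G) = emb F - emb G" "emb (F * G) = emb F * emb G"
  "emb (- F) = - emb F" "emb 0 = 0" "emb 1 = 1"
  by (simp_all add: emb_def Zero_fract_def[symmetric] One_fract_def[symmetric])

lemma emb_eq_iff: "emb F = emb G \<longleftrightarrow> F = G"
  by (simp add: emb_def eq_fract)

lemma inj_emb: "inj emb" by (simp add: inj_on_def emb_eq_iff)

lemma emb_eq_0_iff: "emb F = 0 \<longleftrightarrow> F = 0" using emb_eq_iff[of F 0] by (simp add: emb_simps)

lemma emb_mem_iff: "emb F \<in> emb ` S \<longleftrightarrow> F \<in> S" by (auto simp: emb_eq_iff)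

lemma emb_subring: "is_subring S \<Longrightarrow> is_subring (emb ` S)"
  unfolding is_subring_def by (auto simp: emb_simps[symmetric] emb_mem_iff)

lemma emb_ideal: "ideal_in S I \<Longrightarrow> ideal_in (emb ` S) (emb ` I)"
  unfolding ideal_in_def by (auto simp: emb_simps[symmetric] emb_mem_iff)

lemma emb_prime: "prime_in S P \<Longrightarrow> prime_in (emb ` S) (emb ` P)"
  unfolding prime_in_def by (auto simp: emb_ideal emb_simps[symmetric] emb_mem_iff)

lemma emb_local: "local_at S m \<Longrightarrow> local_at (emb ` S) (emb ` m)"
  unfolding local_at_def by (auto simp: emb_ideal emb_simps[symmetric] emb_mem_iff emb_eq_iff)

lemma emb_prime_chain: "prime_chain_in S n p \<Longrightarrow> prime_chain_in (emb ` S) n (\<lambda>i. emb ` p i)"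
  unfolding prime_chain_in_def by (auto simp: emb_prime inj_image_subset_iff[OF inj_emb] psubset_eq inj_image_eq_iff[OF inj_emb])

lemma emb_noeth: "is_subring S \<Longrightarrow> noeth S \<Longrightarrow> noeth (emb ` S)"
  by (rule noeth_image) (simp_all add: emb_simps)

lemma emb_genid: assumes S: "is_subring S" and G: "G \<subseteq> S" shows "genid (emb ` S) (emb ` G) = emb ` genid S G"
proof
  show "emb ` genid S G \<subseteq> genid (emb ` S) (emb ` G)"
    using genid_image[of S emb G] S G by (auto simp: emb_simps)
  show "genid (emb ` S) (emb ` G) \<subseteq> emb ` genid S G"
    by (rule genid_least[OF emb_ideal[OF genid_ideal[OF S G]]]) (auto intro: genid_incl[OF S])
qed

lemma emb_rgen: "emb ` rgen H = rgen (emb ` H)"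
  by (rule rgen_image) (simp_all add: emb_simps)

lemma type_algebra_eq: "ring_of_type_algebra = subring_on (UNIV :: 'a::field set)"
  by (simp add: subring_on_def ring_of_type_algebra_def)

lemma UNIV_subring: "is_subring UNIV" by (simp add: is_subring_def)

lemma ring_adjoin_rgen: "ring_adjoin H = rgen H"
proof
  show "ring_adjoin H \<subseteq> rgen H"
  proof
    fix x assume "x \<in> ring_adjoin H"
    then show "x \<in> rgen H" unfolding ring_adjoin_def type_algebra_eq
      by induction (auto simp: subring_on_minus[OF UNIV_subring] intro: rgen.intros)
  qed
  show "rgen H \<subseteq> ring_adjoin H"
  proof
    fix x assume "x \<in> rgen H"
    then show "x \<in> ring_adjoin H" unfolding ring_adjoin_def type_algebra_eq
    proof induction
      case rgen_one show ?case using generate_ring.one[of "subring_on UNIV" H] by simp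
    next
      case (rgen_incl h) then show ?case by (rule generate_ring.incl)
    next
      case (rgen_minus a) then show ?case using generate_ring.a_inv[of a "subring_on UNIV" H] by (simp add: subring_on_minus[OF UNIV_subring])
    next
      case (rgen_add a b) then show ?case using generate_ring.eng_add[of a "subring_on UNIV" H b] by simp
    next
      case (rgen_mult a b) then show ?case using generate_ring.eng_mult[of a "subring_on UNIV" H b] by simp
    qed
  qed
qed

lemma type_algebra_inverse:
  fixes a :: "'a::field" assumes "a \<noteq> 0" shows "inv\<^bsub>ring_of_type_algebra\<^esub> a = inverse a"
proof -
  interpret R: cring "subring_on (UNIV :: 'a set)" by (rule subring_on_cring[OF UNIV_subring])
  show ?thesis unfolding type_algebra_eq by (rule R.comm_inv_char) (use assms in auto)
qed

lemma field_adjoin_closed: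
  "1 \<in> field_adjoin H" "h \<in> H \<Longrightarrow> h \<in> field_adjoin H"
  "a \<in> field_adjoin H \<Longrightarrow> b \<in> field_adjoin H \<Longrightarrow> a + b \<in> field_adjoin H"
  "a \<in> field_adjoin H \<Longrightarrow> b \<in> field_adjoin H \<Longrightarrow> a * b \<in> field_adjoin H"
  "a \<in> field_adjoin H \<Longrightarrow> - a \<in> field_adjoin H"
  "a \<in> field_adjoin H \<Longrightarrow> a \<noteq> 0 \<Longrightarrow> inverse a \<in> field_adjoin H" for a b :: "'a::field"
proof -
  let ?R = "ring_of_type_algebra :: 'a ring"
  show "1 \<in> field_adjoin H" using generate_field.one[of ?R H] by (simp add: field_adjoin_def type_algebra_eq)
  show "h \<in> H \<Longrightarrow> h \<in> field_adjoin H" by (simp add: field_adjoin_def generate_field.incl)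
  show "a \<in> field_adjoin H \<Longrightarrow> b \<in> field_adjoin H \<Longrightarrow> a + b \<in> field_adjoin H"
    using generate_field.eng_add[of a ?R H b] by (simp add: field_adjoin_def type_algebra_eq)
  show "a \<in> field_adjoin H \<Longrightarrow> b \<in> field_adjoin H \<Longrightarrow> a * b \<in> field_adjoin H"
    using generate_field.eng_mult[of a ?R H b] by (simp add: field_adjoin_def type_algebra_eq)
  show "a \<in> field_adjoin H \<Longrightarrow> - a \<in> field_adjoin H"
    using generate_field.a_inv[of a ?R H] by (simp add: field_adjoin_def type_algebra_eq subring_on_minus[OF UNIV_subring])
  show "a \<in> field_adjoin H \<Longrightarrow> a \<noteq> 0 \<Longrightarrow> inverse a \<in> field_adjoin H"
    using generate_field.m_inv[of a ?R H] type_algebra_inverse[of a] by (simp add: field_adjoin_def type_algebra_eq)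
qed

lemma field_adjoin_subring: "is_subring (field_adjoin H)" for H :: "'a::field set"
  by (rule is_subringI) (auto intro: field_adjoin_closed)

lemma field_adjoin_fractions:
  fixes H :: "'a::field set"
  shows "field_adjoin H = {a / b | a b. a \<in> rgen H \<and> b \<in> rgen H \<and> b \<noteq> 0}" (is "_ = ?Q")
proof
  note R = rgen_subring[of H]
  have I: "a / b \<in> ?Q" if "a \<in> rgen H" "b \<in> rgen H" "b \<noteq> 0" for a b using that by blast
  have base: "a \<in> ?Q" if "a \<in> rgen H" for a using I[OF that, of 1] R by simp
  show "field_adjoin H \<subseteq> ?Q"
  proof
    fix x assume "x \<in> field_adjoin H"
    then have "x \<in> generate_field (subring_on UNIV) H" unfolding field_adjoin_def type_algebra_eq .
    then show "x \<in> ?Q"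
    proof induction
      case one show ?case using base[of 1] R by simp
    next
      case (incl h) then show ?case by (intro base rgen_incl)
    next
      case (a_inv h)
      then obtain a b where "h = a / b" "a \<in> rgen H" "b \<in> rgen H" "b \<noteq> 0" by blast
      then show ?case using I[of "- a" b] R by (simp add: subring_on_minus[OF UNIV_subring])
    next
      case (m_inv h)
      then obtain a b where h: "h = a / b" "a \<in> rgen H" "b \<in> rgen H" "b \<noteq> 0" by blast
      have "h \<noteq> 0" using m_inv(2) by simp
      then show ?case using I[of b a] h type_algebra_inverse[of h] by (auto simp: type_algebra_eq)
    next
      case (eng_add x y)
      then obtain a b c d where *: "x = a / b" "a \<in> rgen H" "b \<in> rgen H" "b \<noteq> 0"
        "y = c / d" "c \<in> rgen H" "d \<in> rgen H" "d \<noteq> 0" by blast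
      have "x + y = (a * d + c * b) / (b * d)" using * by (simp add: field_simps)
      moreover have "(a * d + c * b) / (b * d) \<in> ?Q" using * R by (intro I subring_add[OF R] subring_mult[OF R]) auto
      ultimately show ?case by simp
    next
      case (eng_mult x y)
      then obtain a b c d where *: "x = a / b" "a \<in> rgen H" "b \<in> rgen H" "b \<noteq> 0"
        "y = c / d" "c \<in> rgen H" "d \<in> rgen H" "d \<noteq> 0" by blast
      have "x * y = (a * c) / (b * d)" using * by simp
      moreover have "(a * c) / (b * d) \<in> ?Q" using * R by (intro I subring_mult[OF R]) auto
      ultimately show ?case by simp
    qed
  qed
  have sub: "rgen H \<subseteq> field_adjoin H"
    by (rule rgen_least[OF field_adjoin_subring]) (auto intro: field_adjoin_closed)
  show "?Q \<subseteq> field_adjoin H"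
    using sub by (auto simp: divide_inverse intro!: field_adjoin_closed(4,6))
qed

lemma scalars_emb: "scalars = emb ` (in_x ` kk)"
  by (auto simp: scalars_def in_x_const image_iff)

lemma emb_loc0: "localize_at (emb ` D) (emb ` {d \<in> D. cc d = 0}) = emb ` loc0 D"
proof
  show "localize_at (emb ` D) (emb ` {d \<in> D. cc d = 0}) \<subseteq> emb ` loc0 D"
  proof
    fix x assume "x \<in> localize_at (emb ` D) (emb ` {d \<in> D. cc d = 0})"
    then obtain u w where uw: "x = emb u / emb w" "u \<in> D" "w \<in> D" "emb w \<notin> emb ` {d \<in> D. cc d = 0}"
      by (auto simp: localize_at_def)
    then have "cc w \<noteq> 0" by (auto simp: emb_mem_iff)
    then obtain v where v: "w * v = 1" using pser_unit by blast
    have "emb w * emb v = 1" using v by (simp add: emb_simps[symmetric])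
    then have "inverse (emb w) = emb v" by (rule inverse_unique)
    then have "x = emb (v * u)" unfolding uw(1) by (simp add: emb_simps divide_inverse mult.commute)
    moreover have "w * (v * u) = u" using v by (metis mult.assoc mult_1)
    then have "w * (v * u) \<in> D" using uw(2) by (simp only:)
    then have "v * u \<in> loc0 D" using uw(3) \<open>cc w \<noteq> 0\<close> unfolding loc0_def by blast
    ultimately show "x \<in> emb ` loc0 D" by blast
  qed
  show "emb ` loc0 D \<subseteq> localize_at (emb ` D) (emb ` {d \<in> D. cc d = 0})"
  proof clarify
    fix F assume "F \<in> loc0 D"
    then obtain w where w: "w \<in> D" "cc w \<noteq> 0" "w * F \<in> D" by (auto simp: loc0_def)
    then have "w \<noteq> 0" by auto
    then have "emb F = emb (w * F) / emb w" by (simp add: emb_simps emb_eq_0_iff)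
    moreover have "emb w \<notin> emb ` {d \<in> D. cc d = 0}" using w by (auto simp: emb_mem_iff)
    ultimately show "emb F \<in> localize_at (emb ` D) (emb ` {d \<in> D. cc d = 0})"
      using w unfolding localize_at_def by blast
  qed
qed

lemma kyz_max: "genid (kyz :: 'k::field pser set) {Ys, Zs} = {u \<in> kyz. cc u = 0}"
(is "?I = ?J")
proof
  show "?I \<subseteq> ?J"
    by (auto simp: genid_pair[OF kyz_subring] intro!: subring_add[OF kyz_subring] subring_mult[OF kyz_subring]
        polyYZ_Ys[OF kk_subring] polyYZ_Zs[OF kk_subring])
  show "?J \<subseteq> ?I"
  proof clarify
    fix u :: "'k pser" assume "u \<in> kyz" "cc u = 0"
    then obtain v w where vw: "v \<in> kyz" "w \<in> kyz" "u = Ys * v + Zs * w" using kyz_split by blast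
    then have "u = v * Ys + w * Zs" by (simp add: mult.commute)
    then show "u \<in> ?I" unfolding genid_pair[OF kyz_subring] using vw(1,2) by blast
  qed
qed

lemma kyz_loc_emb: "kyz_loc = emb ` loc0 (kyz :: 'k::field pser set)"
proof -
  let ?k = "kyz :: 'k pser set"
  have D: "ring_adjoin (scalars \<union> {emb Ys, emb Zs}) = emb ` ?k"
    unfolding ring_adjoin_rgen scalars_emb polyYZ_rgen[OF kk_subring] emb_rgen by (simp add: image_Un)
  have sub: "{Ys, Zs} \<subseteq> ?k" using polyYZ_Ys[OF kk_subring] polyYZ_Zs[OF kk_subring] by blast
  have "Idl\<^bsub>subring_on (emb ` ?k)\<^esub> (emb ` {Ys, Zs}) = genid (emb ` ?k) (emb ` {Ys, Zs})"
    by (rule subring_on_genideal[OF emb_subring[OF kyz_subring] image_mono[OF sub]])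
  also have "\<dots> = emb ` {u \<in> ?k. cc u = 0}" unfolding emb_genid[OF kyz_subring sub] kyz_max ..
  finally have "Idl\<^bsub>subring_on (emb ` ?k)\<^esub> {emb Ys, emb Zs} = emb ` {u \<in> ?k. cc u = 0}" by simp
  then show ?thesis unfolding kyz_loc_def Let_def D by (simp add: emb_loc0)
qed

lemma Rstar_emb: "Rstar = emb ` Rst"
  unfolding Rstar_def Rst_def kyz_loc_emb by (auto simp: emb_mem_iff)

context independent_series
begin

lemma B_piece_emb: assumes "r \<ge> 1" shows "B_piece \<alpha> \<beta> r = emb ` loc0 (D r)"
proof -
  have D: "ring_adjoin (scalars \<union> {emb Xs, emb Ys, emb Zs, emb (fps_shift r f), emb (fps_shift r g)}) = emb ` D r"
    unfolding ring_adjoin_rgen scalars_emb D_rgen emb_rgen by (rule arg_cong[of _ _ rgen]) auto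
  have gens: "{emb Xs, emb Ys, emb Zs, emb (fps_shift r f) - emb (fps_const (fps_nth f r)),
      emb (fps_shift r g) - emb (fps_const (fps_nth g r))} = emb ` Dgens r"
    by (simp add: Dgens_def emb_simps)
  have DD: "Dgens r \<subseteq> D r" using Dgens_D by blast
  have "Idl\<^bsub>subring_on (emb ` D r)\<^esub> (emb ` Dgens r) = emb ` {d \<in> D r. cc d = 0}"
    unfolding subring_on_genideal[OF emb_subring[OF D_subring] image_mono[OF DD]] emb_genid[OF D_subring DD] D_max_generated ..
  then show ?thesis unfolding B_piece_def Let_def D gens by (simp add: emb_loc0)
qed

lemma B_ring_emb: "B_ring \<alpha> \<beta> = emb ` B"
  unfolding B_ring_def B_def using B_piece_emb by auto

lemma A_ring_emb: "A_ring \<alpha> \<beta> = emb ` B"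
proof -
  have "D 0 = rgen (in_x ` kk \<union> {Xs, Ys, Zs, f, g})"
    unfolding D_rgen by (rule arg_cong[of _ _ rgen]) auto
  then have D: "rgen (scalars \<union> {emb Xs, emb Ys, emb Zs, emb f, emb g}) = emb ` D 0"
    unfolding scalars_emb by (simp only: emb_rgen image_Un image_insert image_empty)
  have "emb ` (Rst \<inter> frac_set (D 0)) = field_adjoin (scalars \<union> {emb Xs, emb Ys, emb Zs, emb f, emb g}) \<inter> Rstar"
    unfolding field_adjoin_fractions D Rstar_emb
  proof (intro equalityI subsetI)
    fix x assume "x \<in> emb ` (Rst \<inter> frac_set (D 0))"
    then obtain F q where F: "x = emb F" "F \<in> Rst" "q \<in> D 0" "q \<noteq> 0" "q * F \<in> D 0" by (auto simp: frac_set_def)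
    have "x = emb (q * F) / emb q" using F by (simp add: emb_simps emb_eq_0_iff)
    moreover have "emb q \<noteq> 0" using F(4) by (simp add: emb_eq_0_iff)
    ultimately show "x \<in> {a / b |a b. a \<in> emb ` D 0 \<and> b \<in> emb ` D 0 \<and> b \<noteq> 0} \<inter> emb ` Rst"
      using F by blast
  next
    fix x assume "x \<in> {a / b |a b. a \<in> emb ` D 0 \<and> b \<in> emb ` D 0 \<and> b \<noteq> 0} \<inter> emb ` Rst"
    then obtain p q F where F: "x = emb p / emb q" "p \<in> D 0" "q \<in> D 0" "emb q \<noteq> 0" "x = emb F" "F \<in> Rst" by blast
    have "emb (q * F) = emb p" using F by (simp add: emb_simps)
    then have "q * F = p" by (simp add: emb_eq_iff)
    then have "F \<in> frac_set (D 0)" using F by (auto simp: frac_set_def emb_eq_0_iff)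
    then show "x \<in> emb ` (Rst \<inter> frac_set (D 0))" using F by blast
  qed
  then show ?thesis unfolding A_ring_def B_eq_A by simp
qed

lemma B_local: "local_at B {b \<in> B. cc b = 0}"
proof -
  have "prime_in B {b \<in> B. cc b = 0}" by (rule prime_kernel[OF B_subring]) (simp add: is_hom_def)
  moreover have "\<exists>v\<in>B. b * v = 1" if "b \<in> B" "cc b \<noteq> 0" for b
    using pser_unit[OF that(2)] B_unit[OF that] by blast
  ultimately show ?thesis by (auto simp: local_at_def prime_in_def)
qed

lemma B_max_eq: "{b \<in> B. cc b = 0} = genid B {Xs, Ys, Zs}"
proof
  show "{b \<in> B. cc b = 0} \<subseteq> genid B {Xs, Ys, Zs}" using B_max_generated by blast
  have "ideal_in B {b \<in> B. cc b = 0}" using B_local by (simp add: local_at_def)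
  then show "genid B {Xs, Ys, Zs} \<subseteq> {b \<in> B. cc b = 0}" by (rule genid_least) (use XYZ_B in auto)
qed

lemma card_le_3: "card {a, b, c} \<le> 3" and card_le_2: "card {a, b} \<le> 2" and card_le_5: "card {a, b, c, d, e} \<le> 5"
  by (simp_all add: card_insert_if)

lemma A_regular:
  "regular_local_domain (subring_on (emb ` B))" "krull_dim (subring_on (emb ` B)) = 3"
proof -
  have G: "emb ` {b \<in> B. cc b = 0} = genid (emb ` B) (emb ` {Xs, Ys, Zs})"
    using emb_genid[OF B_subring, of "{Xs, Ys, Zs}"] B_max_eq XYZ_B by auto
  have c: "card (emb ` {Xs, Ys, Zs :: 'k pser}) \<le> 3" using card_le_3 by simp
  note * = regular_local_by_chain[OF emb_subring[OF B_subring] emb_noeth[OF B_subring noeth_B] emb_local[OF B_local] _ G c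
      emb_prime_chain[OF B_chain]]
  show "regular_local_domain (subring_on (emb ` B))" by (rule *(1)) simp
  show "krull_dim (subring_on (emb ` B)) = 3" using *(2) by (simp add: numeral_eq_enat)
qed

lemma B_piece_regular:
  "regular_local_domain (subring_on (emb ` loc0 (D r)))" "krull_dim (subring_on (emb ` loc0 (D r))) = 5"
proof -
  let ?M = "{d \<in> D r. cc d = 0}"
  let ?E = "emb ` D r"
  have M: "prime_in (D r) ?M" by (rule prime_kernel[OF D_subring]) (simp add: is_hom_def)
  have E: "is_subring ?E" by (rule emb_subring[OF D_subring])
  have pM: "prime_in ?E (emb ` ?M)" by (rule emb_prime[OF M])
  obtain p where p: "prime_chain_in (D r) 5 p" "p 5 = ?M" using D_chain by blast
  have ch: "prime_chain_in (localize_at ?E (emb ` ?M)) 5 (\<lambda>i. loc_ext ?E (emb ` ?M) (emb ` p i))"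
    by (rule loc_ext_chain[OF E pM emb_prime_chain[OF p(1)]]) (simp add: p(2))
  let ?L = "localize_at ?E (emb ` ?M)"
  have L: "is_subring ?L" by (rule localize_subring[OF E pM])
  have m: "local_at ?L (loc_ext ?E (emb ` ?M) (emb ` ?M))" by (rule localize_local[OF E pM])
  have DD: "Dgens r \<subseteq> D r" using Dgens_D by blast
  have gM: "emb ` ?M = genid ?E (emb ` Dgens r)" using emb_genid[OF D_subring DD] D_max_generated[of r] by simp
  have G: "loc_ext ?E (emb ` ?M) (emb ` ?M) = genid ?L (emb ` Dgens r)"
  proof
    have id: "ideal_in ?L (genid ?L (emb ` Dgens r))"
      using DD localize_base[OF E pM] by (intro genid_ideal L) blast
    show "loc_ext ?E (emb ` ?M) (emb ` ?M) \<subseteq> genid ?L (emb ` Dgens r)"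
    proof
      fix x assume "x \<in> loc_ext ?E (emb ` ?M) (emb ` ?M)"
      then obtain a b where ab: "x = a / b" "a \<in> emb ` ?M" "b \<in> ?E - emb ` ?M" unfolding loc_ext_def by blast
      have "a \<in> genid ?L (emb ` Dgens r)"
        using ab(2) genid_mono[OF localize_base[OF E pM] order_refl] unfolding gM by blast
      moreover have "1 / b \<in> ?L" using localizeI[OF E pM _ ab(3), of 1] E by simp
      ultimately have "(1 / b) * a \<in> genid ?L (emb ` Dgens r)" by (intro ideal_in_lmult[OF id])
      then show "x \<in> genid ?L (emb ` Dgens r)" using ab(1) by simp
    qed
    show "genid ?L (emb ` Dgens r) \<subseteq> loc_ext ?E (emb ` ?M) (emb ` ?M)"
    proof (rule genid_least)
      show "ideal_in ?L (loc_ext ?E (emb ` ?M) (emb ` ?M))" using m by (simp add: local_at_def)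
      show "emb ` Dgens r \<subseteq> loc_ext ?E (emb ` ?M) (emb ` ?M)"
        using loc_ext_contract[OF E pM pM] Dgens_D[of r] by blast
    qed
  qed
  have c: "card (emb ` Dgens r) \<le> 5" unfolding Dgens_def using card_le_5 by simp
  note * = regular_local_by_chain[OF L localize_noeth[OF E pM emb_noeth[OF D_subring noeth_D]] m _ G c ch]
  show "regular_local_domain (subring_on (emb ` loc0 (D r)))"
    using *(1) by (simp add: emb_loc0 Dgens_def)
  show "krull_dim (subring_on (emb ` loc0 (D r))) = 5"
    using *(2) by (simp add: emb_loc0 numeral_eq_enat Dgens_def)
qed

lemma B_piece_mono: "emb ` loc0 (D r) \<subseteq> emb ` loc0 (D (Suc r))"
  using loc0_D_mono[of r "Suc r"] by (intro image_mono) simp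

lemma P_ideal_emb: "P_ideal \<alpha> \<beta> = emb ` genid B {f, g}"
  using subring_on_genideal[OF emb_subring[OF B_subring], of "emb ` {f, g}"] emb_genid[OF B_subring, of "{f, g}"] fg_B
  unfolding P_ideal_def A_ring_emb by auto

lemma P_prime_height:
  "primeideal (emb ` genid B {f, g}) (subring_on (emb ` B))"
  "ideal_height (subring_on (emb ` B)) (emb ` genid B {f, g}) = 2"
proof -
  have S: "is_subring (emb ` B)" by (rule emb_subring[OF B_subring])
  have "prime_in B (genid B {f, g})" unfolding fg_kernel by (rule prime_kernel[OF B_subring ev_hom])
  then have P: "prime_in (emb ` B) (emb ` genid B {f, g})" by (rule emb_prime)
  then show "primeideal (emb ` genid B {f, g}) (subring_on (emb ` B))" using subring_on_primeideal_iff[OF S] by blast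
  have G: "emb ` genid B {f, g} = genid (emb ` B) (emb ` {f, g})" using emb_genid[OF B_subring, of "{f, g}"] fg_B by auto
  have c: "card (emb ` {f, g}) \<le> 2" using card_le_2 by simp
  have "ideal_height (subring_on (emb ` B)) (emb ` genid B {f, g}) = enat 2"
    by (rule height_by_chain[OF S emb_noeth[OF B_subring noeth_B] P _ G c emb_prime_chain[OF P_chain]]) simp_all
  then show "ideal_height (subring_on (emb ` B)) (emb ` genid B {f, g}) = 2" by (simp add: numeral_eq_enat)
qed

end

section \<open>Completions\<close>

lemma ideal_power_0: "ideal_power R I 0 = carrier R"
  and ideal_power_Suc: "ideal_power R I (Suc n) = ideal_prod R (ideal_power R I n) I"
  by (simp_all add: ideal_power_def ideals_set_def nat_pow_def)

text \<open>A sequence \<open>Q\<close> of additively closed sets consists of the powers of \<open>I\<close> if products of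
  elements of \<open>Q n\<close> and \<open>I\<close> are in \<open>Q (n + 1)\<close> and every element of \<open>Q (n + 1)\<close> is a sum of such
  products.\<close>

lemma ideal_power_eqI:
  assumes S: "is_subring S" and Q0: "Q 0 = S"
    and add: "\<And>n a b. a \<in> Q (Suc n) \<Longrightarrow> b \<in> Q (Suc n) \<Longrightarrow> a + b \<in> Q (Suc n)"
    and mult: "\<And>n a b. a \<in> Q n \<Longrightarrow> b \<in> I \<Longrightarrow> a * b \<in> Q (Suc n)"
    and dec: "\<And>n c. c \<in> Q (Suc n) \<Longrightarrow> c \<in> ideal_prod (subring_on S) (Q n) I"
  shows "ideal_power (subring_on S) I n = Q n"
proof (induction n)
  case 0
  then show ?case by (simp add: ideal_power_0 Q0)
next
  case (Suc n)
  have "c \<in> Q (Suc n)" if "c \<in> ideal_prod (subring_on S) (Q n) I" for c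
    using that by induction (auto intro: add mult)
  then show ?case unfolding ideal_power_Suc Suc using dec by blast
qed

text \<open>The ring \<open>T\<close> is the completion of \<open>A\<close> if it is separated with respect to the ideals \<open>J n\<close>,
  contains the limits of the sequences from \<open>A\<close>, has \<open>A\<close> as a dense subring, and if \<open>J n\<close> meets
  \<open>A\<close> in the power \<open>I\<^sup>n\<close>.\<close>

locale completion_setup =
  fixes A T I :: "'a::field set" and J :: "nat \<Rightarrow> 'a set"
  assumes A: "is_subring A" and T: "is_subring T" and AT: "A \<subseteq> T"
    and J: "\<And>n. ideal_in T (J n)" and dec: "\<And>n. J (Suc n) \<subseteq> J n"
    and pow: "\<And>n. ideal_power (subring_on A) I n = A \<inter> J n"
    and dense: "\<And>F n. F \<in> T \<Longrightarrow> \<exists>a\<in>A. F - a \<in> J n"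
    and sep: "\<And>F. (\<And>n. F \<in> J n) \<Longrightarrow> F = 0"
    and complete: "\<And>a. (\<And>n. a n \<in> A) \<Longrightarrow> (\<And>n. a (Suc n) - a n \<in> J n) \<Longrightarrow> \<exists>F\<in>T. \<forall>n. F - a n \<in> J n"
begin

abbreviation "R \<equiv> subring_on A"
abbreviation "C \<equiv> adic_completion R I"

text \<open>The coset of \<open>I\<^sup>n\<close> in \<open>A\<close> that consists of the approximations of \<open>F\<close> modulo \<open>J n\<close>.\<close>

definition phi :: "'a \<Rightarrow> nat \<Rightarrow> 'a set" where
  "phi F n = {a \<in> A. a - F \<in> J n}"

lemma J_diff_swap: "a - b \<in> J n \<Longrightarrow> b - a \<in> J n"
  using ideal_in_minus[OF J T, of "a - b" n] by simp

lemma J_trans: "a - b \<in> J n \<Longrightarrow> b - c \<in> J n \<Longrightarrow> a - c \<in> J n"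
  using ideal_in_add[OF J, of "a - b" n "b - c"] by simp

lemma ideal_n: "ideal (A \<inter> J n) R"
proof -
  have "ideal_in A (A \<inter> J n)"
    using A AT ideal_in_zero[OF J] ideal_in_add[OF J] ideal_in_lmult[OF J] unfolding ideal_in_def
    by (auto simp: subset_iff)
  then show ?thesis using subring_on_ideal_iff[OF A] by blast
qed

lemma coset_eq: assumes "a \<in> A" shows "(A \<inter> J n) +>\<^bsub>R\<^esub> a = {b \<in> A. b - a \<in> J n}"
proof
  show "(A \<inter> J n) +>\<^bsub>R\<^esub> a \<subseteq> {b \<in> A. b - a \<in> J n}" using assms A by (auto simp: a_r_coset_def')
  show "{b \<in> A. b - a \<in> J n} \<subseteq> (A \<inter> J n) +>\<^bsub>R\<^esub> a"
  proof
    fix b assume "b \<in> {b \<in> A. b - a \<in> J n}"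
    then have "b - a \<in> A \<inter> J n" "b = (b - a) + a" using assms A by auto
    then show "b \<in> (A \<inter> J n) +>\<^bsub>R\<^esub> a" unfolding a_r_coset_def' by (metis UN_iff singletonI subring_on_simps(5))
  qed
qed

lemma phi_coset: assumes "a \<in> A" "F - a \<in> J n" shows "phi F n = (A \<inter> J n) +>\<^bsub>R\<^esub> a"
  unfolding coset_eq[OF assms(1)] phi_def using assms(2) J_trans J_diff_swap by blast

lemma phi_completion_map: "a \<in> A \<Longrightarrow> completion_map R I a = phi a"
  unfolding completion_map_def pow using phi_coset[of a a] ideal_in_zero[OF J] by auto

lemma carrier_C: "carrier C = {s. (\<forall>n. \<exists>a\<in>A. s n = (A \<inter> J n) +>\<^bsub>R\<^esub> a) \<and> (\<forall>n. s (Suc n) \<subseteq> s n)}"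
  by (auto simp: adic_completion_def pow FactRing_def A_RCOSETS_def')

lemma phi_carrier: assumes F: "F \<in> T" shows "phi F \<in> carrier C"
  unfolding carrier_C
proof (intro CollectI conjI allI)
  show "\<exists>a\<in>A. phi F n = (A \<inter> J n) +>\<^bsub>R\<^esub> a" for n using dense[OF F, of n] phi_coset by blast
  show "phi F (Suc n) \<subseteq> phi F n" for n using dec[of n] by (auto simp: phi_def)
qed

lemma phi_add_mult:
  assumes F: "F \<in> T" and G: "G \<in> T"
  shows "phi (F + G) = phi F \<oplus>\<^bsub>C\<^esub> phi G" "phi (F * G) = phi F \<otimes>\<^bsub>C\<^esub> phi G"
proof -
  have "phi (F + G) n = phi F n \<oplus>\<^bsub>R Quot (A \<inter> J n)\<^esub> phi G n \<and> phi (F * G) n = phi F n \<otimes>\<^bsub>R Quot (A \<inter> J n)\<^esub> phi G n" for n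
  proof -
    obtain a b where ab: "a \<in> A" "F - a \<in> J n" "b \<in> A" "G - b \<in> J n" using dense[OF F, of n] dense[OF G, of n] by blast
    interpret ideal "A \<inter> J n" R by (rule ideal_n)
    have "(F - a) + (G - b) \<in> J n" using ab by (intro ideal_in_add[OF J])
    then have 1: "(F + G) - (a + b) \<in> J n" by (simp add: algebra_simps)
    have "G * (F - a) + a * (G - b) \<in> J n" using ab G AT by (intro ideal_in_add[OF J] ideal_in_lmult[OF J]) auto
    moreover have "G * (F - a) + a * (G - b) = F * G - a * b" by (simp add: algebra_simps)
    ultimately have 2: "F * G - a * b \<in> J n" by simp
    have "a + b \<in> A" "a * b \<in> A" using ab A by auto
    then show ?thesis
      using phi_coset[OF _ 1] phi_coset[OF _ 2] phi_coset[OF ab(1,2)] phi_coset[OF ab(3,4)] ab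
        rcoset_mult_add[of a b] a_rcos_sum[of a b] by (simp add: FactRing_def)
  qed
  then show "phi (F + G) = phi F \<oplus>\<^bsub>C\<^esub> phi G" "phi (F * G) = phi F \<otimes>\<^bsub>C\<^esub> phi G"
    by (auto simp: adic_completion_def pow)
qed

lemma phi_one: "phi 1 = \<one>\<^bsub>C\<^esub>"
proof
  fix n
  show "phi 1 n = \<one>\<^bsub>C\<^esub> n"
    using phi_coset[of 1 1 n] A ideal_in_zero[OF J] by (simp add: adic_completion_def pow FactRing_def)
qed

lemma phi_zero: "phi 0 = \<zero>\<^bsub>C\<^esub>"
  by (rule ext) (auto simp: adic_completion_def pow FactRing_def phi_def)

lemma phi_inj: assumes F: "F \<in> T" and G: "G \<in> T" and eq: "phi F = phi G" shows "F = G"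
proof -
  have "F - G \<in> J n" for n
  proof -
    obtain a where a: "a \<in> A" "F - a \<in> J n" using dense[OF F] by blast
    have "a \<in> phi F n" using a J_diff_swap by (simp add: phi_def)
    then have "a - G \<in> J n" using eq by (simp add: phi_def)
    then show ?thesis using a(2) J_trans by blast
  qed
  then have "F - G = 0" by (rule sep)
  then show ?thesis by simp
qed

lemma phi_surj: assumes s: "s \<in> carrier C" shows "\<exists>F\<in>T. phi F = s"
proof -
  obtain a where a: "\<And>n. a n \<in> A" "\<And>n. s n = (A \<inter> J n) +>\<^bsub>R\<^esub> a n" and sd: "\<And>n. s (Suc n) \<subseteq> s n"
    using s unfolding carrier_C by (auto simp: Bex_def) metis
  have "a (Suc n) - a n \<in> J n" for n
  proof -
    have "a (Suc n) \<in> s (Suc n)" unfolding a(2) coset_eq[OF a(1)] using a(1) ideal_in_zero[OF J] by simp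
    then have "a (Suc n) \<in> s n" using sd by blast
    then show ?thesis unfolding a(2) coset_eq[OF a(1)] by simp
  qed
  then obtain F where F: "F \<in> T" "\<And>n. F - a n \<in> J n" using complete[of a] a(1) by blast
  have "phi F = s" by (rule ext) (simp add: phi_coset[OF a(1) F(2)] a(2))
  then show ?thesis using F(1) by blast
qed

lemma phi_iso: "phi \<in> ring_iso (subring_on T) C"
proof (rule ring_iso_memI)
  show "bij_betw phi (carrier (subring_on T)) (carrier C)"
    unfolding bij_betw_def
  proof
    show "inj_on phi (carrier (subring_on T))" by (rule inj_onI) (use phi_inj in simp)
    show "phi ` carrier (subring_on T) = carrier C" using phi_carrier phi_surj by auto
  qed
qed (use phi_carrier phi_add_mult phi_one in simp_all)

lemma C_cring: "cring C"
proof -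
  interpret T: cring "subring_on T" by (rule subring_on_cring[OF T])
  have "cring (C\<lparr>zero := phi \<zero>\<^bsub>subring_on T\<^esub>\<rparr>)" by (rule T.ring_iso_imp_img_cring[OF phi_iso])
  then show ?thesis by (simp add: phi_zero)
qed

abbreviation "psi \<equiv> inv_into T phi"

lemma psi_phi: "F \<in> T \<Longrightarrow> psi (phi F) = F"
  by (rule inv_into_f_f) (auto intro: inj_onI phi_inj)

lemma psi_iso: "psi \<in> ring_iso C (subring_on T)"
  using ring_iso_set_sym[OF subring_on_ring[OF T] phi_iso] by simp

theorem completion_is_T: "completion_is R I (subring_on T)"
  unfolding completion_is_def
proof (intro conjI bexI ballI)
  show "carrier R \<subseteq> carrier (subring_on T)" using AT by simp
  show "psi \<in> ring_iso C (subring_on T)" by (rule psi_iso)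
  fix a assume "a \<in> carrier R"
  then show "psi (completion_map R I a) = a" using phi_completion_map psi_phi AT by auto
qed

text \<open>The element \<open>r\<close> is a root of the equation \<open>r\<^sup>2 + 0 \<cdot> r - f g = 0\<close>, whose coefficients lie in
  the first and second power of the extended ideal. The isomorphism \<open>psi\<close> maps this ideal into the
  ideal \<open>(f, g)\<close> of \<open>T\<close>, which does not contain \<open>r\<close>.\<close>

theorem extension_not_integrally_closed:
  assumes fg: "f \<in> A" "g \<in> A" and r: "r \<in> T" "r * r = f * g" "r \<notin> genid T {f, g}"
  shows "\<not> integrally_closed_ideal C (extension_to_completion R I (genid A {f, g}))"
proof -
  interpret C: cring C by (rule C_cring)
  let ?P = "genid A {f, g}"
  define E where "E = extension_to_completion R I ?P"
  have fgT: "f \<in> T" "g \<in> T" using fg AT by auto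
  have PA: "?P \<subseteq> A" by (rule ideal_in_subset[OF genid_ideal[OF A]]) (use fg in auto)
  have imP: "completion_map R I ` ?P \<subseteq> carrier C"
  proof (rule image_subsetI)
    fix a assume "a \<in> ?P"
    then have "a \<in> A" "a \<in> T" using PA AT by blast+
    then show "completion_map R I a \<in> carrier C" using phi_carrier by (simp add: phi_completion_map)
  qed
  have E: "ideal E C" unfolding E_def extension_to_completion_def by (rule C.genideal_ideal[OF imP])
  have PE: "phi a \<in> E" if "a \<in> ?P" for a
  proof -
    have "completion_map R I a \<in> E"
      unfolding E_def extension_to_completion_def
      by (rule subsetD[OF C.genideal_self[OF imP]]) (rule imageI[OF that])
    then show ?thesis using that PA phi_completion_map by auto
  qed
  have fE: "phi f \<in> E" and gE: "phi g \<in> E" by (auto intro!: PE genid_incl[OF A])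
  have "phi r \<notin> E"
  proof
    assume rE: "phi r \<in> E"
    interpret psi: ring_hom_ring C "subring_on T" psi
      by (rule ring_hom_ringI2[OF C.ring_axioms subring_on_ring[OF T]]) (use psi_iso in \<open>simp add: ring_iso_def\<close>)
    have "ideal_in T (genid T {f, g})" using fgT by (intro genid_ideal[OF T]) blast
    then have K: "ideal {x \<in> carrier C. psi x \<in> genid T {f, g}} C"
      using subring_on_ideal_iff[OF T] by (intro psi.ideal_vimage) blast
    have "completion_map R I ` ?P \<subseteq> {x \<in> carrier C. psi x \<in> genid T {f, g}}"
    proof clarify
      fix a assume a: "a \<in> ?P"
      then have "a \<in> genid T {f, g}" using genid_mono[OF AT order_refl] by blast
      moreover have "a \<in> A" using a PA by blast
      ultimately show "completion_map R I a \<in> carrier C \<and> psi (completion_map R I a) \<in> genid T {f, g}"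
        using phi_completion_map phi_carrier psi_phi AT by auto
    qed
    then have "E \<subseteq> {x \<in> carrier C. psi x \<in> genid T {f, g}}"
      unfolding E_def extension_to_completion_def by (rule C.genideal_minimal[OF K])
    then have "psi (phi r) \<in> genid T {f, g}" using rE by blast
    then show False using psi_phi[OF r(1)] r(3) by simp
  qed
  moreover have "integral_over_ideal C E (phi r)"
    unfolding integral_over_ideal_def
  proof (intro exI conjI ballI)
    \<comment> \<open>the coefficients of the equation \<open>r\<^sup>2 + 0 \<cdot> r - f g = 0\<close>\<close>
    let ?a = "\<lambda>i::nat. if i = 2 then phi (- (f * g)) else \<zero>\<^bsub>C\<^esub>"
    have mf: "- f \<in> ?P" "- f \<in> T" using genid_incl[OF A, of f "{f, g}"] ideal_in_minus[OF genid_ideal[OF A] A] fg fgT T by auto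
    have E0: "\<zero>\<^bsub>C\<^esub> \<in> E" using additive_subgroup.zero_closed[OF ideal.axioms(1)[OF E]] .
    have p1: "\<one>\<^bsub>C\<^esub> \<otimes>\<^bsub>C\<^esub> e \<in> ideal_power C E 1" if "e \<in> E" for e
      using ideal_prod.prod[of "\<one>\<^bsub>C\<^esub>" "carrier C" e E C] that by (simp add: ideal_power_Suc ideal_power_0)
    have Ecar: "e \<in> carrier C" if "e \<in> E" for e using ideal.Icarr[OF E that] .
    have one: "?a 1 \<in> ideal_power C E 1" using p1[OF E0] by simp
    have "phi (- f) \<in> ideal_power C E 1" using p1[OF PE[OF mf(1)]] Ecar[OF PE[OF mf(1)]] by simp
    then have "phi (- f) \<otimes>\<^bsub>C\<^esub> phi g \<in> ideal_power C E (Suc 1)"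
      unfolding ideal_power_Suc[of C E 1] using gE by (rule ideal_prod.prod)
    moreover have "phi (- f) \<otimes>\<^bsub>C\<^esub> phi g = phi (- (f * g))" using phi_add_mult(2)[OF mf(2) fgT(2)] by simp
    ultimately have two: "?a 2 \<in> ideal_power C E 2" by (simp add: numeral_2_eq_2)
    show "1 \<le> (2::nat)" by simp
    show "?a i \<in> ideal_power C E i" if "i \<in> {1..2}" for i
    proof -
      have "i = 1 \<or> i = 2" using that by auto
      then show ?thesis using one two by auto
    qed
    have mfg: "- (f * g) \<in> T" using fgT T by auto
    have rc: "phi r \<in> carrier C" "phi (- (f * g)) \<in> carrier C" using phi_carrier r(1) mfg by auto
    have "{1..2::nat} = insert 1 {2}" by auto
    then have "(\<Oplus>\<^bsub>C\<^esub> i\<in>{1..2}. ?a i \<otimes>\<^bsub>C\<^esub> phi r [^]\<^bsub>C\<^esub> (2 - i)) = phi (- (f * g))"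
      using rc by (simp add: C.finsum_insert Pi_def)
    moreover have "phi r [^]\<^bsub>C\<^esub> (2::nat) = phi (f * g)"
      using phi_add_mult(2)[OF r(1) r(1)] r(2) rc by (simp add: numeral_2_eq_2)
    moreover have "phi (f * g) \<oplus>\<^bsub>C\<^esub> phi (- (f * g)) = \<zero>\<^bsub>C\<^esub>"
      using phi_add_mult(1)[of "f * g" "- (f * g)"] mfg fgT T phi_zero by simp
    ultimately show "phi r [^]\<^bsub>C\<^esub> (2::nat) \<oplus>\<^bsub>C\<^esub> (\<Oplus>\<^bsub>C\<^esub> i\<in>{1..2}. ?a i \<otimes>\<^bsub>C\<^esub> phi r [^]\<^bsub>C\<^esub> (2 - i)) = \<zero>\<^bsub>C\<^esub>"
      by simp
  qed
  ultimately show ?thesis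
    unfolding integrally_closed_ideal_def E_def[symmetric] using phi_carrier[OF r(1)] by blast
qed

end

context independent_series
begin

abbreviation "A \<equiv> emb ` B"

lemma A_subring: "is_subring A" by (rule emb_subring[OF B_subring])

lemma genid_Xs: "genid B {Xs} = {b \<in> B. Xs dvd b}"
proof
  have "genid B {Xs} = genid B {Xs, Xs}" by simp
  also have "\<dots> = {a. \<exists>p\<in>B. \<exists>q\<in>B. a = p * Xs + q * Xs}" using genid_pair[OF B_subring] by blast
  also have "\<dots> \<subseteq> {b \<in> B. Xs dvd b}"
    using Xs_B by (auto intro!: subring_add[OF B_subring] subring_mult[OF B_subring])
  finally show "genid B {Xs} \<subseteq> {b \<in> B. Xs dvd b}" .
  show "{b \<in> B. Xs dvd b} \<subseteq> genid B {Xs}"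
  proof clarify
    fix b assume b: "b \<in> B" "Xs dvd b"
    then obtain c where c: "b = Xs * c" by (auto simp: dvd_def)
    then have "c \<in> B" using b(1) B_div by blast
    then have "0 + c * Xs \<in> genid B {Xs}" by (intro genid_step genid_0) simp_all
    then show "b \<in> genid B {Xs}" using c by (simp add: mult.commute)
  qed
qed

lemma xA_emb: "Idl\<^bsub>subring_on A\<^esub> {emb Xs} = emb ` {b \<in> B. Xs dvd b}"
proof -
  have "Idl\<^bsub>subring_on A\<^esub> (emb ` {Xs}) = genid A (emb ` {Xs})"
    by (rule subring_on_genideal[OF A_subring]) (use Xs_B in auto)
  also have "\<dots> = emb ` {b \<in> B. Xs dvd b}" using emb_genid[OF B_subring, of "{Xs}"] Xs_B genid_Xs by simp
  finally show ?thesis by simp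
qed

lemma x_power: "ideal_power (subring_on A) (emb ` {b \<in> B. Xs dvd b}) n = A \<inter> emb ` {F \<in> Rst. Xs ^ n dvd F}"
proof -
  define Q where "Q = (\<lambda>n. emb ` {b \<in> B. Xs ^ n dvd b})"
  have "ideal_power (subring_on A) (emb ` {b \<in> B. Xs dvd b}) n = Q n"
  proof (rule ideal_power_eqI[OF A_subring])
    show "Q 0 = A" by (simp add: Q_def)
    fix n a b
    show "a + b \<in> Q (Suc n)" if "a \<in> Q (Suc n)" "b \<in> Q (Suc n)"
      using that B_subring by (auto simp: Q_def emb_simps[symmetric] emb_mem_iff simp del: power_Suc)
    show "a * b \<in> Q (Suc n)" if ab: "a \<in> Q n" "b \<in> emb ` {b \<in> B. Xs dvd b}"
    proof -
      obtain c d where cd: "a = emb c" "b = emb d" "c \<in> B" "d \<in> B" "Xs ^ n dvd c" "Xs dvd d" using ab by (auto simp: Q_def)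
      have "Xs ^ n * Xs dvd c * d" using cd by (intro mult_dvd_mono)
      then have "c * d \<in> {b \<in> B. Xs ^ Suc n dvd b}" using cd B_subring by (simp add: mult.commute)
      then show ?thesis unfolding Q_def cd by (simp only: emb_simps(3)[symmetric] imageI)
    qed
    show "a \<in> ideal_prod (subring_on A) (Q n) (emb ` {b \<in> B. Xs dvd b})" if aQ: "a \<in> Q (Suc n)"
    proof -
      obtain b c where b: "a = emb b" "b \<in> B" "b = Xs ^ Suc n * c" using aQ by (auto simp: Q_def dvd_def simp del: power_Suc)
      have "Xs * (Xs ^ n * c) \<in> B" using b(2,3) by (simp add: mult.assoc)
      then have "Xs ^ n * c \<in> B" by (rule B_div)
      then have "emb (Xs ^ n * c) \<in> Q n" "emb Xs \<in> emb ` {b \<in> B. Xs dvd b}" using Xs_B by (auto simp: Q_def)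
      then have "emb (Xs ^ n * c) \<otimes>\<^bsub>subring_on A\<^esub> emb Xs \<in> ideal_prod (subring_on A) (Q n) (emb ` {b \<in> B. Xs dvd b})"
        by (rule ideal_prod.prod)
      moreover have "emb (Xs ^ n * c) \<otimes>\<^bsub>subring_on A\<^esub> emb Xs = a" using b by (simp add: emb_simps(3)[symmetric] mult_ac)
      ultimately show ?thesis by simp
    qed
  qed
  also have "Q n = A \<inter> emb ` {F \<in> Rst. Xs ^ n dvd F}" using B_Rst by (auto simp: Q_def emb_mem_iff emb_eq_iff)
  finally show ?thesis .
qed

lemma m_power: "ideal_power (subring_on A) (emb ` {b \<in> B. cc b = 0}) n = A \<inter> emb ` {F. ord_ge n F}"
proof -
  define Q where "Q = (\<lambda>n. emb ` {b \<in> B. ord_ge n b})"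
  let ?m = "emb ` {b \<in> B. cc b = 0}"
  have "ideal_power (subring_on A) ?m n = Q n"
  proof (rule ideal_power_eqI[OF A_subring])
    show "Q 0 = A" by (simp add: Q_def)
    fix n a b
    show "a + b \<in> Q (Suc n)" if "a \<in> Q (Suc n)" "b \<in> Q (Suc n)"
      using that B_subring by (auto simp: Q_def emb_simps[symmetric] emb_mem_iff ord_ge_add)
    show "a * b \<in> Q (Suc n)" if ab: "a \<in> Q n" "b \<in> ?m"
    proof -
      obtain c d where cd: "a = emb c" "b = emb d" "c \<in> B" "d \<in> B" "ord_ge n c" "ord_ge (Suc 0) d"
        using ab by (auto simp: Q_def ord_ge_1)
      then have "c * d \<in> {b \<in> B. ord_ge (Suc n) b}" using ord_ge_mult[OF cd(5,6)] B_subring by simp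
      then show ?thesis unfolding Q_def cd by (simp only: emb_simps(3)[symmetric] imageI)
    qed
    show "a \<in> ideal_prod (subring_on A) (Q n) ?m" if aQ: "a \<in> Q (Suc n)"
    proof -
      obtain b where b: "a = emb b" "b \<in> B" "ord_ge (Suc n) b" using aQ by (auto simp: Q_def)
      obtain b1 b2 b3 where bb: "b1 \<in> B" "b2 \<in> B" "b3 \<in> B" "ord_ge n b1" "ord_ge n b2" "ord_ge n b3"
        "b = b1 * Xs + b2 * Ys + b3 * Zs" using B_split[OF b(2,3)] by blast
      have q: "emb b1 \<in> Q n" "emb b2 \<in> Q n" "emb b3 \<in> Q n" using bb by (auto simp: Q_def)
      have x: "emb Xs \<in> ?m" "emb Ys \<in> ?m" "emb Zs \<in> ?m" using XYZ_B by auto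
      have "a = (emb b1 \<otimes>\<^bsub>subring_on A\<^esub> emb Xs \<oplus>\<^bsub>subring_on A\<^esub> emb b2 \<otimes>\<^bsub>subring_on A\<^esub> emb Ys)
          \<oplus>\<^bsub>subring_on A\<^esub> emb b3 \<otimes>\<^bsub>subring_on A\<^esub> emb Zs"
        unfolding b(1) bb(7) by (simp add: emb_simps)
      also have "\<dots> \<in> ideal_prod (subring_on A) (Q n) ?m"
        by (intro ideal_prod.sum ideal_prod.prod q x)
      finally show ?thesis .
    qed
  qed
  also have "Q n = A \<inter> emb ` {F. ord_ge n F}" by (auto simp: Q_def emb_mem_iff emb_eq_iff)
  finally show ?thesis .
qed

lemma x_completion: "completion_setup A Rstar (emb ` {b \<in> B. Xs dvd b}) (\<lambda>n. emb ` {F \<in> Rst. Xs ^ n dvd F})"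
proof
  show "is_subring A" by (rule A_subring)
  show "is_subring (Rstar :: 'k pfrac set)" unfolding Rstar_emb by (rule emb_subring[OF Rst_subring])
  show "A \<subseteq> Rstar" unfolding Rstar_emb using B_Rst by blast
  show "ideal_in Rstar (emb ` {F \<in> Rst. Xs ^ n dvd F})" for n
    unfolding Rstar_emb by (rule emb_ideal) (use Rst_subring in \<open>auto simp: ideal_in_def\<close>)
  show "emb ` {F \<in> Rst. Xs ^ Suc n dvd F} \<subseteq> emb ` {F \<in> Rst. Xs ^ n dvd F}" for n
    using power_le_dvd[of Xs "Suc n" _ n] by auto
  show "ideal_power (subring_on A) (emb ` {b \<in> B. Xs dvd b}) n = A \<inter> emb ` {F \<in> Rst. Xs ^ n dvd F}" for n
    by (rule x_power)
  show "\<exists>a\<in>A. F - a \<in> emb ` {F \<in> Rst. Xs ^ n dvd F}" if "F \<in> Rstar" for F n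
  proof -
    obtain F' where F': "F = emb F'" "F' \<in> Rst" using \<open>F \<in> Rstar\<close> unfolding Rstar_emb by (elim imageE)
    obtain b where b: "b \<in> B" "Xs ^ n dvd F' - b" using B_dense[OF F'(2)] by blast
    have "F - emb b = emb (F' - b)" "F' - b \<in> Rst" using F' b B_Rst Rst_subring by (auto simp: emb_simps)
    then show ?thesis using b by (intro bexI[of _ "emb b"]) auto
  qed
  show "F = 0" if F: "\<And>n. F \<in> emb ` {F \<in> Rst. Xs ^ n dvd F}" for F
  proof -
    obtain F' where F': "F = emb F'" using F[of 0] by blast
    then have "Xs ^ n dvd F'" for n using F[of n] by (auto simp: emb_eq_iff)
    then show ?thesis using Xs_separated[of F'] F' by (simp add: emb_simps)
  qed
  show "\<exists>F\<in>Rstar. \<forall>n. F - a n \<in> emb ` {F \<in> Rst. Xs ^ n dvd F}"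
    if a: "\<And>n. a n \<in> A" "\<And>n. a (Suc n) - a n \<in> emb ` {F \<in> Rst. Xs ^ n dvd F}" for a
  proof -
    have "\<forall>n. \<exists>b\<in>B. a n = emb b" using a(1) by blast
    then obtain b where b: "\<And>n. b n \<in> B" "\<And>n. a n = emb (b n)" by metis
    have diff: "Xs ^ n dvd b (Suc n) - b n" for n
      using a(2)[of n] by (auto simp: b(2) emb_simps(2)[symmetric] emb_mem_iff)
    have bd: "Xs ^ n dvd b m - b n" if "n \<le> m" for m n
      using that
    proof (induction rule: dec_induct)
      case (step k)
      have "Xs ^ n dvd b (Suc k) - b k" using diff[of k] step(1) power_le_dvd by blast
      then have "Xs ^ n dvd (b (Suc k) - b k) + (b k - b n)" using step.IH by (rule dvd_add)
      then show ?case by simp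
    qed simp
    \<comment> \<open>the coefficient with index \<open>n\<close> is the same in all \<open>b m\<close> with \<open>m > n\<close>\<close>
    define F where "F = Abs_fps (\<lambda>n. fps_nth (b (Suc n)) n)"
    have "F \<in> Rst" using b(1) B_Rst by (auto simp: F_def Rst_def)
    moreover have "Xs ^ n dvd F - b n" for n
      unfolding Xs_power_dvd_iff
    proof (intro allI impI)
      fix k assume k: "k < n"
      have "fps_nth (b n - b (Suc k)) k = 0" using bd[of "Suc k" n] k unfolding Xs_power_dvd_iff by simp
      then show "fps_nth (F - b n) k = 0" by (simp add: F_def)
    qed
    moreover have "F - b n \<in> Rst" for n using \<open>F \<in> Rst\<close> b(1) B_Rst Rst_subring by blast
    ultimately show ?thesis unfolding Rstar_emb
      by (intro bexI[of _ "emb F"]) (auto simp: b(2) emb_simps(2)[symmetric])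
  qed
qed

lemma polynomial_dense: "\<exists>b\<in>kxyz. ord_ge n (F - b)"
proof -
  \<comment> \<open>together with the bounds on \<open>j\<close> and \<open>l\<close> below, this truncates \<open>F\<close> in each variable separately\<close>
  define v where "v = (\<lambda>j l. \<Sum>i<n. fps_X ^ i * fps_const (fps_nth (lam j l F) i))"
  define b where "b = (\<Sum>j<n. \<Sum>l<n. in_x (v j l) * (Ys ^ j * Zs ^ l))"
  have "v j l \<in> kx" for j l
    unfolding v_def using kk_kx X_kx
    by (intro subring_sum[OF kx_subring] subring_mult[OF kx_subring] subring_power[OF kx_subring]) auto
  then have "b \<in> kxyz" unfolding b_def
    by (intro subring_sum[OF kxyz_subring] polyYZ_monomial[OF kx_subring])
  moreover have "co b i a c = co F i a c" if l: "i + a + c < n" for i a c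
  proof -
    have "lam a c b = (\<Sum>j<n. \<Sum>l<n. if a = j \<and> c = l then v j l else 0)"
      unfolding b_def lam_sum by (intro sum.cong refl) (simp add: lam_monomial del: lam_in_x_mult)
    also have "\<dots> = (\<Sum>j<n. if a = j then (\<Sum>l<n. if c = l then v j l else 0) else 0)"
      by (intro sum.cong refl) auto
    also have "\<dots> = v a c" using l by simp
    finally have lam: "lam a c b = v a c" .
    obtain w where "lam a c F - v a c = fps_X ^ n * w" using fps_trunc[of n "lam a c F"] by (auto simp: v_def dvd_def)
    then have "fps_nth (lam a c F - v a c) i = 0" using l by (simp add: fps_X_power_mult_nth)
    then have "fps_nth (lam a c b) i = fps_nth (lam a c F) i" by (simp add: lam)
    then show ?thesis by (simp add: lam_def)
  qed
  then have "ord_ge n (F - b)" by (simp add: ord_ge_def)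
  ultimately show ?thesis by blast
qed

lemma m_completion: "completion_setup A kxyz_series (emb ` {b \<in> B. cc b = 0}) (\<lambda>n. emb ` {F. ord_ge n F})"
proof
  have U: "is_subring (UNIV :: 'k pser set)" by (simp add: is_subring_def)
  show "is_subring A" by (rule A_subring)
  show "is_subring (kxyz_series :: 'k pfrac set)" unfolding kxyz_series_def by (rule emb_subring[OF U])
  show "A \<subseteq> kxyz_series" unfolding kxyz_series_def by blast
  show "ideal_in kxyz_series (emb ` {F. ord_ge n F})" for n
    unfolding kxyz_series_def by (rule emb_ideal) (auto simp: ideal_in_def ord_ge_add ord_ge_lmult)
  show "emb ` {F. ord_ge (Suc n) F} \<subseteq> emb ` {F. ord_ge n F}" for n
    using ord_ge_mono[of "Suc n" _ n] by auto
  show "ideal_power (subring_on A) (emb ` {b \<in> B. cc b = 0}) n = A \<inter> emb ` {F. ord_ge n F}" for n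
    by (rule m_power)
  show "\<exists>a\<in>A. F - a \<in> emb ` {F. ord_ge n F}" if "F \<in> kxyz_series" for F n
  proof -
    obtain F' where F': "F = emb F'" using \<open>F \<in> kxyz_series\<close> unfolding kxyz_series_def by (elim imageE)
    obtain b where b: "b \<in> kxyz" "ord_ge n (F' - b)" using polynomial_dense by blast
    have "b \<in> B" using b(1) kxyz_D[of 0] D_B[of 0] by blast
    then show ?thesis using b F' by (intro bexI[of _ "emb b"]) (auto simp: emb_simps(2)[symmetric])
  qed
  show "F = 0" if F: "\<And>n. F \<in> emb ` {F. ord_ge n F}" for F
  proof -
    obtain F' where F': "F = emb F'" using F[of 0] by blast
    then have "ord_ge n F'" for n using F[of n] by (auto simp: emb_eq_iff)
    then show ?thesis using ord_ge_separated[of F'] F' by (simp add: emb_simps)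
  qed
  show "\<exists>F\<in>kxyz_series. \<forall>n. F - a n \<in> emb ` {F. ord_ge n F}"
    if a: "\<And>n. a n \<in> A" "\<And>n. a (Suc n) - a n \<in> emb ` {F. ord_ge n F}" for a
  proof -
    have "\<forall>n. \<exists>b\<in>B. a n = emb b" using a(1) by blast
    then obtain b where b: "\<And>n. b n \<in> B" "\<And>n. a n = emb (b n)" by metis
    have diff: "ord_ge n (b (Suc n) - b n)" for n
      using a(2)[of n] by (auto simp: b(2) emb_simps(2)[symmetric] emb_mem_iff)
    have bd: "ord_ge n (b m - b n)" if "n \<le> m" for m n
      using that
    proof (induction rule: dec_induct)
      case (step k)
      have "ord_ge n (b (Suc k) - b k)" using ord_ge_mono[OF diff step(1)] .
      then have "ord_ge n ((b (Suc k) - b k) + (b k - b n))" using step.IH by (rule ord_ge_add)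
      then show ?case by simp
    qed simp
    \<comment> \<open>the coefficients of total degree \<open>d\<close> are the same in all \<open>b m\<close> with \<open>m > d\<close>\<close>
    define F where "F = Abs_fps (\<lambda>i. Abs_fps (\<lambda>j. Abs_fps (\<lambda>l. co (b (Suc (i + j + l))) i j l)))"
    have "ord_ge n (F - b n)" for n
      unfolding ord_ge_def
    proof (intro allI impI)
      fix i j l assume k: "i + j + l < n"
      have "co (b n - b (Suc (i + j + l))) i j l = 0" using bd[of "Suc (i + j + l)" n] k by (auto simp: ord_ge_def)
      then show "co (F - b n) i j l = 0" by (simp add: F_def)
    qed
    then show ?thesis unfolding kxyz_series_def
      by (intro bexI[of _ "emb F"]) (auto simp: b(2) emb_simps(2)[symmetric])
  qed
qed

lemma st_square: "emb (s * t) * emb (s * t) = emb f * emb g"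
  by (simp add: emb_simps(3)[symmetric] f_eq g_eq power2_eq_square mult_ac)

lemma st_notin_genid: assumes "is_subring S" shows "emb (s * t) \<notin> genid (emb ` S) {emb f, emb g}"
proof
  assume "emb (s * t) \<in> genid (emb ` S) {emb f, emb g}"
  then obtain p q where "emb (s * t) = emb p * emb f + emb q * emb g"
    unfolding genid_pair[OF emb_subring[OF assms]] by blast
  then have "s * t = f * p + g * q" by (simp add: emb_simps(1,3)[symmetric] emb_eq_iff mult.commute)
  then show False using st_notin by blast
qed

lemma P_gen: "emb ` genid B {f, g} = genid A {emb f, emb g}"
  using emb_genid[OF B_subring, of "{f, g}"] fg_B by simp

end

section \<open>From algebraic independence to transcendence\<close>

text \<open>In a polynomial in two variables, the outer variable stands for \<open>\<beta>\<close> and the inner one for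
  \<open>\<alpha>\<close>. An equation for \<open>\<beta>\<close> over \<open>k[x,\<alpha>]\<close> becomes such a polynomial by representing its
  coefficients as polynomials in \<open>\<alpha>\<close>; if all of these vanish, so do the coefficients.\<close>

lemma independent_pair_transc:
  fixes \<alpha> \<beta> :: "'k::field fps"
  assumes ind: "alg_independent_pair (field_adjoin (scalars \<union> {emb Xs})) (emb (in_x \<alpha>)) (emb (in_x \<beta>))"
  shows "transc kx \<alpha>" "transc (adj kx \<alpha>) \<beta>"
proof -
  define h where "h = (\<lambda>v :: 'k fps. emb (in_x v))"
  have h: "is_hom h" by (simp add: is_hom_def h_def in_x_add in_x_mult in_x_1 emb_simps)
  have hinj: "v = 0" if "h v = 0" for v using that in_x_inj[of v 0] by (simp add: h_def emb_eq_0_iff in_x_0)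
  let ?F = "field_adjoin (scalars \<union> {emb Xs}) :: 'k pfrac set"
  have F: "is_subring ?F" by (rule field_adjoin_subring)
  have "kx \<subseteq> {v. h v \<in> ?F}"
  proof (rule adj_least)
    show "is_subring {v. h v \<in> ?F}"
      using F unfolding is_subring_def[of "Collect _"] by (simp add: hom_one[OF h] hom_diff[OF h] hom_mult[OF h])
    show "kk \<subseteq> {v. h v \<in> ?F}" using scalars_emb by (auto simp: h_def intro!: field_adjoin_closed(2))
    show "fps_X \<in> {v. h v \<in> ?F}" by (auto simp: h_def in_x_X intro!: field_adjoin_closed(2))
  qed
  then have hF: "h v \<in> ?F" if "v \<in> kx" for v using that by blast
  define mp where "mp = (\<lambda>q :: 'k fps poly. \<Sum>j\<le>Polynomial.degree q. Polynomial.monom (h (Polynomial.coeff q j)) j)"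
  have cmp: "Polynomial.coeff (mp q) j = (if j \<le> Polynomial.degree q then h (Polynomial.coeff q j) else 0)" for q j
    by (simp add: mp_def coeff_sum)
  have pmp: "poly (mp q) (h v) = h (poly q v)" for q v
    by (simp add: mp_def poly_sum poly_monom poly_altdef[of q] hom_sum[OF h] hom_mult[OF h] hom_power[OF h])
  have key: "c i = 0" if c: "\<And>i. c i \<in> adj kx \<alpha>" and eq: "(\<Sum>i\<le>n. c i * \<beta> ^ i) = 0" and i: "i \<le> n"
    and inj: "\<And>q. (\<And>j. Polynomial.coeff q j \<in> kx) \<Longrightarrow> mp q = 0 \<Longrightarrow> poly q \<alpha> = 0" for c n i
  proof -
    have "\<exists>q. (\<forall>j. Polynomial.coeff q j \<in> kx) \<and> c i = poly q \<alpha>" for i using c[of i] unfolding adj_def[of kx] by blast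
    then obtain q where q: "\<And>i j. Polynomial.coeff (q i) j \<in> kx" "\<And>i. c i = poly (q i) \<alpha>" by metis
    define P where "P = (\<Sum>i\<le>n. Polynomial.monom (mp (q i)) i)"
    have cP: "Polynomial.coeff P i = (if i \<le> n then mp (q i) else 0)" for i by (simp add: P_def coeff_sum)
    have "poly (poly P [:h \<beta>:]) (h \<alpha>) = (\<Sum>i\<le>n. h (poly (q i) \<alpha>) * h \<beta> ^ i)"
      by (simp add: P_def poly_sum poly_monom pmp)
    also have "\<dots> = h (\<Sum>i\<le>n. c i * \<beta> ^ i)"
      by (simp add: q(2) hom_sum[OF h] hom_mult[OF h] hom_power[OF h])
    finally have "poly (poly P [:h \<beta>:]) (h \<alpha>) = 0" using eq hom_zero[OF h] by simp
    moreover have "Polynomial.coeff (Polynomial.coeff P i) j \<in> ?F" for i j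
      using hF[OF q(1)] subring_zero[OF F] by (auto simp: cP cmp)
    ultimately have "P = 0" using ind unfolding alg_independent_pair_def h_def by blast
    then have "mp (q i) = 0" using cP[of i] i by simp
    then show "c i = 0" using inj[OF q(1)] q(2) by simp
  qed
  have mp0: "q = 0" if "mp q = 0" for q
  proof (rule poly_eqI)
    fix j
    show "Polynomial.coeff q j = Polynomial.coeff 0 j"
      using cmp[of q j] that hinj by (cases "j \<le> Polynomial.degree q") (auto simp: coeff_eq_0)
  qed
  show "transc (adj kx \<alpha>) \<beta>"
    unfolding transc_def
  proof (intro allI impI)
    fix p assume p: "\<forall>i. Polynomial.coeff p i \<in> adj kx \<alpha>" "poly p \<beta> = 0"
    have "Polynomial.coeff p i = 0" for i
    proof (cases "i \<le> Polynomial.degree p")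
      case True
      show ?thesis
        by (rule key[of "Polynomial.coeff p" "Polynomial.degree p"]) (use p True mp0 in \<open>auto simp: poly_altdef dest!: mp0\<close>)
    qed (simp add: coeff_eq_0)
    then show "p = 0" by (simp add: poly_eq_iff)
  qed
  show "transc kx \<alpha>"
    unfolding transc_def
  proof (intro allI impI)
    fix q assume q: "\<forall>j. Polynomial.coeff q j \<in> kx" "poly q \<alpha> = 0"
    have "poly (poly [:mp q:] [:h \<beta>:]) (h \<alpha>) = 0" using q(2) hom_zero[OF h] by (simp add: pmp)
    moreover have "Polynomial.coeff (Polynomial.coeff [:mp q:] i) j \<in> ?F" for i j
      using hF q(1) subring_zero[OF F] by (auto simp: cmp coeff_pCons split: nat.split)
    ultimately have "[:mp q:] = 0" using ind unfolding alg_independent_pair_def h_def by blast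
    then show "q = 0" using mp0 by simp
  qed
qed

theorem theorem3p3:
  fixes \<alpha> \<beta> :: "'k::field_char_0 fps"
  assumes "fps_X dvd \<alpha>" and "fps_X dvd \<beta>"
    and "alg_independent_pair (field_adjoin (scalars \<union> {emb Xs})) (emb (in_x \<alpha>)) (emb (in_x \<beta>))"
  shows
    "(let A = subring_on (A_ring \<alpha> \<beta>); P = P_ideal \<alpha> \<beta>;
          xA = Idl\<^bsub>A\<^esub> {emb Xs}; m = max_ideal A
      in
        (A_ring \<alpha> \<beta> = B_ring \<alpha> \<beta> \<and> regular_local_domain A \<and> krull_dim A = 3 \<and>
         (\<forall>r\<ge>1. B_piece \<alpha> \<beta> r \<subseteq> B_piece \<alpha> \<beta> (Suc r) \<and>
                regular_local_domain (subring_on (B_piece \<alpha> \<beta> r)) \<and>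
                krull_dim (subring_on (B_piece \<alpha> \<beta> r)) = 5)) \<and>
        (primeideal P A \<and> ideal_height A P = 2) \<and>
        (completion_is A xA (subring_on Rstar) \<and>
         \<not> integrally_closed_ideal (adic_completion A xA) (extension_to_completion A xA P)) \<and>
        (completion_is A m (subring_on kxyz_series) \<and>
         \<not> integrally_closed_ideal (adic_completion A m) (extension_to_completion A m P)))"
proof -
  interpret independent_series \<alpha> \<beta>
  proof
    show "fps_nth \<alpha> 0 = 0" "fps_nth \<beta> 0 = 0" using assms(1,2) by (auto simp: dvd_def)
    show "transc kx \<alpha>" "transc (adj kx \<alpha>) \<beta>" by (rule independent_pair_transc[OF assms(3)])+
  qed
  interpret x: completion_setup A Rstar "emb ` {b \<in> B. Xs dvd b}" "\<lambda>n. emb ` {F \<in> Rst. Xs ^ n dvd F}"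
    by (rule x_completion)
  interpret m: completion_setup A kxyz_series "emb ` {b \<in> B. cc b = 0}" "\<lambda>n. emb ` {F. ord_ge n F}"
    by (rule m_completion)
  have max: "max_ideal (subring_on A) = emb ` {b \<in> B. cc b = 0}"
    by (rule subring_on_local(2)[OF A_subring emb_local[OF B_local]])
  have U: "is_subring (UNIV :: 'k pser set)" by (simp add: is_subring_def)
  have fgA: "emb f \<in> A" "emb g \<in> A" using fg_B by auto
  have st: "s * t \<in> Rst"
    unfolding s_def t_def using in_x_Rst polyYZ_Rst polyYZ_Ys[OF kk_subring] polyYZ_Zs[OF kk_subring]
    by (intro subring_mult[OF Rst_subring] subring_diff[OF Rst_subring]) blast+
  have nx: "\<not> integrally_closed_ideal x.C (extension_to_completion x.R (emb ` {b \<in> B. Xs dvd b}) (genid A {emb f, emb g}))"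
    by (rule x.extension_not_integrally_closed[OF fgA _ st_square])
      (use st st_notin_genid[OF Rst_subring] in \<open>auto simp: Rstar_emb\<close>)
  have nm: "\<not> integrally_closed_ideal m.C (extension_to_completion m.R (emb ` {b \<in> B. cc b = 0}) (genid A {emb f, emb g}))"
    by (rule m.extension_not_integrally_closed[OF fgA _ st_square])
      (use st_notin_genid[OF U] in \<open>auto simp: kxyz_series_def\<close>)
  have pieces: "B_piece \<alpha> \<beta> r \<subseteq> B_piece \<alpha> \<beta> (Suc r) \<and> regular_local_domain (subring_on (B_piece \<alpha> \<beta> r)) \<and>
      krull_dim (subring_on (B_piece \<alpha> \<beta> r)) = 5" if "1 \<le> r" for r
    using that B_piece_emb[of r] B_piece_emb[of "Suc r"] B_piece_mono B_piece_regular by simp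
  show ?thesis
    unfolding Let_def A_ring_emb P_ideal_emb xA_emb max B_ring_emb
    using A_regular P_prime_height x.completion_is_T m.completion_is_T nx nm pieces
    unfolding P_gen by blast
qed

end
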